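(* Let $\widehat\mu$ be defined with the random Monte Carlo weights $\omega_{ij}=\omega_{ij}^{\mathrm{MC}}$ of the context. Assume: the data generating conditions (i)-(iv) of the context; these weights are admissible (as defined in the context); every $\phi_k$ is Lipschitz continuous; there exist $\alpha\in(0,1]$ and a measurable $L_\mu:\mathcal U\to\mathbb R_+$ with $\int_{\mathcal U}L_\mu^2\,d\nu<\infty$ and $|\mu(u,t)-\mu(u,t')|\le L_\mu(u)|t-t'|^\alpha$ for all $u\in\mathcal U$, $t,t'\in\mathcal T$; there are $s>0$ and a finite $C_s>0$ with $\sum_{k\ge1}k^{2s}\|\beta_k\|^2_{L^2(\mathcal U)}\le C_s$; the polynomial growth condition of the context holds with constants $q\ge0$ and $\bar C_{\mathrm{MC}}>0$; $\Gamma_X$ is continuous on $\mathcal T\times\mathcal T$; and $1\le m_i\le m_{\max}<\infty$ for all $1\le i\le n$. Then for every $M\ge4$ and every integer $K\ge1$, $$\mathcal R(\widehat\mu;K)\le C_sK^{-2s}+C_1^{\mathrm{MC}}\frac KM+\bar C_{\mathrm{MC}}\Bigl(\frac{K}{M^{1+2\alpha}}+\frac{K^{1+2q}}{M^3}\Bigr),$$ with $C_1^{\mathrm{MC}}=\kappa\,\bigl(\|\Gamma_X\|_\infty m_{\max}+\|\tau\|_\infty^2\,\nu(\mathcal U)\bigr)/g_{\min}$, where $\kappa$ is a constant depending only on $g_{\min}$ and $g_{\max}$ such that $\mathbb E\bigl[\sum_{i,j}(\omega_{ij}^{\mathrm{MC}})^2h(T_{ij})\bigr]\le\frac{\kappa}{M}\int_{\mathcal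 T}h(t)g(t)\,dt$ for every non-negative integrable function $h(T)$.
   Context: $\mathcal T\subset\mathbb R$ is a compact interval with Lebesgue measure; $(\mathcal U,d_{\mathcal U})$ is a separable metric space with its Borel $\sigma$-field and a finite Borel measure $\nu$. For subjects $i=1,\dots,n$ and visits $j=1,\dots,m_i$ ($m_i\ge1$ deterministic), one observes $(T_{ij},Y_{ij}(\cdot))$ with $$Y_{ij}(u)=\mu(u,T_{ij})+X_i(u,T_{ij})+\varepsilon_{ij}(u),\quad u\in\mathcal U,$$ where $\mu\in L^2(\mathcal U\times\mathcal T)$ is deterministic. $M=m_1+\dots+m_n$. Data generating conditions: (i) the $X_i$ are independent copies of a random field $X$ on $\mathcal U\times\mathcal T$ with $\mathbb E\|X\|^2_{L^2(\mathcal U\times\mathcal T)}<\infty$ and $\mathbb E[X(u,t)]=0$ for all $(u,t)$; (ii) the $T_{ij}$ are i.i.d. copies of $T$ with Lipschitz continuous density $g$, positive on $\mathcal T$; $g_{\min}=\inf_{\mathcal T}g$, $g_{\max}=\sup_{\mathcal T}g$; (iii) $\varepsilon_{ij}(u)=\tau(T_{ij})\eta_{ij}(u)$ with $\tau:\mathcal T\to\mathbb R_+$ bounded deterministic and $\eta_{ij}$ i.i.d. random fields on $\mathcal U$ with $\mathbb E[\eta_{ij}(u)]=0$, $\mathrm{Var}(\eta_{ij}(u))=1$ for all $u$; (iv) the collections $\{T_{ij}\}$, $\{X_i\}$, $\{\eta_{ij}\}$ are mutually independent. $\Gamma_X(t,t')=\mathbb E\langle X(\cdot,t),X(\cdot,t')\rangle_{L^2(\mathcal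 U)}$; $\|\cdot\|_\infty$ is the sup norm. $\{\phi_k\}_{k\ge1}$ is an orthonormal basis of $L^2(\mathcal T)$, $\beta_k(u)=\int_{\mathcal T}\mu(u,t)\phi_k(t)\,dt$. Estimator (with $g$ known): $\widehat\beta_k(u)=\sum_{i,j}\omega_{ij}Y_{ij}(u)\phi_k(T_{ij})/g(T_{ij})$, $\widehat\mu_K(u,t)=\sum_{k=1}^K\widehat\beta_k(u)\phi_k(t)$, $\mathcal R(\widehat\mu;K)=\mathbb E\|\widehat\mu_K-\mu\|^2_{L^2(\mathcal U\times\mathcal T)}$. Admissible weights: the $\omega_{ij}$ are measurable with respect to $\sigma(\{T_{ij}\})$, $\sum_{i,j}\omega_{ij}=1$; for any integrable $\psi(T)$, $\sum_{i,j}\mathbb E[\omega_{ij}\psi(T_{ij})]=\mathbb E[\psi(T)]$; and there is $C_0\ge0$ with $\sum_{i,j}\omega_{ij}^2\le1+C_0M^{-1}$. Monte Carlo (control-neighbors) weights: let $\mathcal S=\{T_{ij}\}$ be the set of all design points. For $t\in\mathcal T$, $\widehat N(t;\mathcal S\setminus\{T_{i'j'}\})$ is the nearest neighbor of $t$ in $\mathcal S\setminus\{T_{i'j'}\}$ (ties broken by lexicographic order of indices). For $(i,j)\ne(i',j')$ let $\mathcal V_{ij}^{(i'j')}=\{t\in\mathcal T:\widehat N(t;\mathcal S\setminus\{T_{i'j'}\})=T_{ij}\}$ and $V_{ij}^{(i'j')}=\int_{\mathcal V_{ij}^{(i'j')}}g(v)\,dv$. Put $\widehat d_{ij}=\sum_{(i',j')\ne(i,j)}\mathbf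 1\{T_{i'j'}\in\mathcal V_{ij}^{(i'j')}\}$, $\widehat c_{ij}=\sum_{(i',j')\ne(i,j)}V_{ij}^{(i'j')}$ and $\omega_{ij}^{\mathrm{MC}}=(1+\widehat c_{ij}-\widehat d_{ij})/M$. Polynomial growth condition: with $B_k(u)=\sum_{i,j}\omega_{ij}^{\mathrm{MC}}\mu(u,T_{ij})\phi_k(T_{ij})/g(T_{ij})$, let $C_{1,\mathrm{MC}}(u)$ and $C_{2,\mathrm{MC}}(u;k)$ be constants (not depending on $M$) such that, for $M\ge4$, $\mathrm{Var}(B_k(u))\le C_{1,\mathrm{MC}}^2(u)M^{-1-2\alpha}+C_{2,\mathrm{MC}}^2(u;k)M^{-3}$ (such constants are known to exist under the other assumptions). The condition is: there exist $q\ge0$ and $\bar C_{\mathrm{MC}}>0$ with $\int_{\mathcal U}C_{1,\mathrm{MC}}^2(u)\,d\nu(u)\le\bar C_{\mathrm{MC}}$ and $\int_{\mathcal U}C_{2,\mathrm{MC}}^2(u;k)\,d\nu(u)\le\bar C_{\mathrm{MC}}k^{2q}$ for all $k\ge1$. *)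

theory Defs
  imports "HOL-Probability.Probability"
begin

definition leb_on :: "real \<Rightarrow> real \<Rightarrow> real measure" where
  "leb_on a b = restrict_space lborel {a..b}"

definition design_law :: "real \<Rightarrow> real \<Rightarrow> (real \<Rightarrow> real) \<Rightarrow> real measure" where
  "design_law a b g = density (leb_on a b) (\<lambda>t. ennreal (g t))"

definition design_density :: "real \<Rightarrow> real \<Rightarrow> (real \<Rightarrow> real) \<Rightarrow> bool" where
  "design_density a b g \<longleftrightarrow>
     (\<exists>L. L-lipschitz_on {a..b} g) \<and> (\<forall>t\<in>{a..b}. 0 < g t) \<and> prob_space (design_law a b g)"

definition visits :: "nat \<Rightarrow> (nat \<Rightarrow> nat) \<Rightarrow> (nat \<times> nat) set" where
  "visits n m = (SIGMA i:{1..n}. {1..m i})"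

text \<open>The squared \<open>L\<^sup>2\<close> norm is taken in \<open>[0, \<infinity>]\<close>, so that a bound on it includes finiteness.\<close>

definition sq_norm_L2 :: "'a measure \<Rightarrow> ('a \<Rightarrow> real) \<Rightarrow> ennreal" where
  "sq_norm_L2 N f = (\<integral>\<^sup>+x. ennreal ((f x)\<^sup>2) \<partial>N)"

definition in_L2 :: "'a measure \<Rightarrow> ('a \<Rightarrow> real) \<Rightarrow> bool" where
  "in_L2 N f \<longleftrightarrow> f \<in> borel_measurable N \<and> sq_norm_L2 N f < \<infinity>"

text \<open>The basis functions are indexed by \<open>k \<ge> 1\<close>; the value \<open>\<phi> 0\<close> is never used.\<close>

definition orthonormal_basis_L2 :: "'a measure \<Rightarrow> (nat \<Rightarrow> 'a \<Rightarrow> real) \<Rightarrow> bool" where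
  "orthonormal_basis_L2 N \<phi> \<longleftrightarrow>
     (\<forall>k\<ge>1. in_L2 N (\<phi> k)) \<and>
     (\<forall>j\<ge>1. \<forall>k\<ge>1. (LINT t|N. \<phi> j t * \<phi> k t) = (if j = k then 1 else 0)) \<and>
     (\<forall>f. in_L2 N f \<longrightarrow>
       (\<lambda>K. sq_norm_L2 N (\<lambda>t. f t - (\<Sum>k=1..K. (LINT s|N. f s * \<phi> k s) * \<phi> k t))) \<longlonglongrightarrow> 0)"

definition coef :: "real \<Rightarrow> real \<Rightarrow> ('u \<Rightarrow> real \<Rightarrow> real) \<Rightarrow> (nat \<Rightarrow> real \<Rightarrow> real) \<Rightarrow> nat \<Rightarrow> 'u \<Rightarrow> real" where
  "coef a b \<mu> \<phi> k u = (LINT t|leb_on a b. \<mu> u t * \<phi> k t)"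

text \<open>The \<open>\<sigma>\<close>-field on the sample space generated by a family of random elements.\<close>

definition family_algebra ::
    "'w measure \<Rightarrow> 'b measure \<Rightarrow> ('i \<Rightarrow> 'w \<Rightarrow> 'b) \<Rightarrow> 'i set \<Rightarrow> 'w measure" where
  "family_algebra P N Z I = sigma (space P) (\<Union>i\<in>I. {Z i -` A \<inter> space P |A. A \<in> sets N})"

text \<open>
  A random field is a random element of a measurable space \<open>S\<close> of functions whose \<open>\<sigma>\<close>-field
  makes evaluation jointly measurable in the function and its argument. Independence and equality
  in law of fields refer to this \<open>\<sigma>\<close>-field. Joint measurability of a field on the sample space,
  with independence of the coordinate processes only, would not be enough to evaluate the field at
  an independent random point: if \<open>T\<close> has a density, the field \<open>1{t = T}\<close> is null at each fixed
  \<open>t\<close>, hence independent of \<open>T\<close> in that weaker sense, but equals \<open>1\<close> at \<open>T\<close>.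
\<close>

definition surface_space :: "real \<Rightarrow> real \<Rightarrow> 'u measure \<Rightarrow> ('u \<Rightarrow> real \<Rightarrow> real) measure \<Rightarrow> bool" where
  "surface_space a b \<nu> S \<longleftrightarrow>
     (\<lambda>(x, u, t). x u t) \<in> borel_measurable (S \<Otimes>\<^sub>M (\<nu> \<Otimes>\<^sub>M leb_on a b))"

definition curve_space :: "'u measure \<Rightarrow> ('u \<Rightarrow> real) measure \<Rightarrow> bool" where
  "curve_space \<nu> S \<longleftrightarrow> (\<lambda>(e, u). e u) \<in> borel_measurable (S \<Otimes>\<^sub>M \<nu>)"

definition cov_trace :: "'w measure \<Rightarrow> 'u measure \<Rightarrow> ('w \<Rightarrow> 'u \<Rightarrow> real \<Rightarrow> real) \<Rightarrow> real \<Rightarrow> real \<Rightarrow> real" where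
  "cov_trace P \<nu> X t t' = (LINT \<omega>|P. (LINT u|\<nu>. X \<omega> u t * X \<omega> u t'))"

definition obs ::
    "('u \<Rightarrow> real \<Rightarrow> real) \<Rightarrow> (nat \<Rightarrow> 'w \<Rightarrow> 'u \<Rightarrow> real \<Rightarrow> real) \<Rightarrow> (real \<Rightarrow> real) \<Rightarrow>
     (nat \<times> nat \<Rightarrow> 'w \<Rightarrow> 'u \<Rightarrow> real) \<Rightarrow> (nat \<times> nat \<Rightarrow> 'w \<Rightarrow> real) \<Rightarrow> nat \<times> nat \<Rightarrow> 'w \<Rightarrow> 'u \<Rightarrow> real" where
  "obs \<mu> X \<tau> \<eta> T p \<omega> u =
     \<mu> u (T p \<omega>) + X (fst p) \<omega> u (T p \<omega>) + \<tau> (T p \<omega>) * \<eta> p \<omega> u"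

definition coef_hat ::
    "(nat \<times> nat) set \<Rightarrow> (nat \<times> nat \<Rightarrow> 'w \<Rightarrow> real) \<Rightarrow> (real \<Rightarrow> real) \<Rightarrow> (nat \<Rightarrow> real \<Rightarrow> real) \<Rightarrow>
     (nat \<times> nat \<Rightarrow> 'w \<Rightarrow> real) \<Rightarrow> (nat \<times> nat \<Rightarrow> 'w \<Rightarrow> 'u \<Rightarrow> real) \<Rightarrow> nat \<Rightarrow> 'w \<Rightarrow> 'u \<Rightarrow> real" where
  "coef_hat I W g \<phi> T Y k \<omega> u = (\<Sum>p\<in>I. W p \<omega> * Y p \<omega> u * \<phi> k (T p \<omega>) / g (T p \<omega>))"

definition mean_hat ::
    "(nat \<times> nat) set \<Rightarrow> (nat \<times> nat \<Rightarrow> 'w \<Rightarrow> real) \<Rightarrow> (real \<Rightarrow> real) \<Rightarrow> (nat \<Rightarrow> real \<Rightarrow> real) \<Rightarrow>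
     (nat \<times> nat \<Rightarrow> 'w \<Rightarrow> real) \<Rightarrow> (nat \<times> nat \<Rightarrow> 'w \<Rightarrow> 'u \<Rightarrow> real) \<Rightarrow> nat \<Rightarrow>
     'w \<Rightarrow> 'u \<Rightarrow> real \<Rightarrow> real" where
  "mean_hat I W g \<phi> T Y K \<omega> u t = (\<Sum>k=1..K. coef_hat I W g \<phi> T Y k \<omega> u * \<phi> k t)"

definition risk ::
    "'w measure \<Rightarrow> 'u measure \<Rightarrow> real \<Rightarrow> real \<Rightarrow> ('w \<Rightarrow> 'u \<Rightarrow> real \<Rightarrow> real) \<Rightarrow> ('u \<Rightarrow> real \<Rightarrow> real) \<Rightarrow> ennreal" where
  "risk P \<nu> a b \<mu>h \<mu> =
     (\<integral>\<^sup>+\<omega>. sq_norm_L2 (\<nu> \<Otimes>\<^sub>M leb_on a b) (\<lambda>(u, t). \<mu>h \<omega> u t - \<mu> u t) \<partial>P)"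

definition admissible_weights ::
    "'w measure \<Rightarrow> real \<Rightarrow> real \<Rightarrow> (real \<Rightarrow> real) \<Rightarrow> (nat \<times> nat) set \<Rightarrow> (nat \<times> nat \<Rightarrow> 'w \<Rightarrow> real) \<Rightarrow>
     (nat \<times> nat \<Rightarrow> 'w \<Rightarrow> real) \<Rightarrow> bool" where
  "admissible_weights P a b g I T W \<longleftrightarrow>
     (\<forall>p\<in>I. W p \<in> borel_measurable (family_algebra P (leb_on a b) T I)) \<and>
     (AE \<omega> in P. (\<Sum>p\<in>I. W p \<omega>) = 1) \<and>
     (\<forall>\<psi>. integrable (design_law a b g) \<psi> \<longrightarrow>
       (\<Sum>p\<in>I. LINT \<omega>|P. W p \<omega> * \<psi> (T p \<omega>)) = (LINT t|design_law a b g. \<psi> t)) \<and>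
     (\<exists>C\<^sub>0\<ge>0. AE \<omega> in P. (\<Sum>p\<in>I. (W p \<omega>)\<^sup>2) \<le> 1 + C\<^sub>0 / real (card I))"

text \<open>
  Below, \<open>s\<close> is a realisation of the design points, indexed by visits. Neighbours are
  identified by their index rather than by their position, which is the same as long as the
  design points are distinct (an almost sure event) and lets the tie-breaking rule be total.
  The order on pairs is spelled out because the library order on products is componentwise.
\<close>

definition lex_le :: "nat \<times> nat \<Rightarrow> nat \<times> nat \<Rightarrow> bool" where
  "lex_le p q \<longleftrightarrow> fst p < fst q \<or> fst p = fst q \<and> snd p \<le> snd q"

definition nearest :: "(nat \<times> nat \<Rightarrow> real) \<Rightarrow> (nat \<times> nat) set \<Rightarrow> real \<Rightarrow> nat \<times> nat" where
  "nearest s A t = (THE p. p \<in> A \<and>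
     (\<forall>q\<in>A. \<bar>t - s p\<bar> < \<bar>t - s q\<bar> \<or> \<bar>t - s p\<bar> = \<bar>t - s q\<bar> \<and> lex_le p q))"

definition loo_cell ::
    "real \<Rightarrow> real \<Rightarrow> (nat \<times> nat) set \<Rightarrow> (nat \<times> nat \<Rightarrow> real) \<Rightarrow> nat \<times> nat \<Rightarrow> nat \<times> nat \<Rightarrow> real set" where
  "loo_cell a b I s q p = {t \<in> {a..b}. nearest s (I - {q}) t = p}"

definition loo_degree ::
    "real \<Rightarrow> real \<Rightarrow> (nat \<times> nat) set \<Rightarrow> (nat \<times> nat \<Rightarrow> real) \<Rightarrow> nat \<times> nat \<Rightarrow> real" where
  "loo_degree a b I s p = (\<Sum>q\<in>I - {p}. indicator (loo_cell a b I s q p) (s q))"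

definition loo_volume ::
    "real \<Rightarrow> real \<Rightarrow> (real \<Rightarrow> real) \<Rightarrow> (nat \<times> nat) set \<Rightarrow> (nat \<times> nat \<Rightarrow> real) \<Rightarrow> nat \<times> nat \<Rightarrow> real" where
  "loo_volume a b g I s p = (\<Sum>q\<in>I - {p}. LINT v:loo_cell a b I s q p|lborel. g v)"

definition mc_weight ::
    "real \<Rightarrow> real \<Rightarrow> (real \<Rightarrow> real) \<Rightarrow> (nat \<times> nat) set \<Rightarrow> (nat \<times> nat \<Rightarrow> real) \<Rightarrow> nat \<times> nat \<Rightarrow> real" where
  "mc_weight a b g I s p = (1 + loo_volume a b g I s p - loo_degree a b I s p) / real (card I)"

definition mc_weights ::
    "real \<Rightarrow> real \<Rightarrow> (real \<Rightarrow> real) \<Rightarrow> (nat \<times> nat) set \<Rightarrow> (nat \<times> nat \<Rightarrow> 'w \<Rightarrow> real) \<Rightarrow>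
     nat \<times> nat \<Rightarrow> 'w \<Rightarrow> real" where
  "mc_weights a b g I T p \<omega> = mc_weight a b g I (\<lambda>q. T q \<omega>) p"

definition mc_signal_coef ::
    "real \<Rightarrow> real \<Rightarrow> (real \<Rightarrow> real) \<Rightarrow> (nat \<times> nat) set \<Rightarrow> (nat \<times> nat \<Rightarrow> 'w \<Rightarrow> real) \<Rightarrow>
     ('u \<Rightarrow> real \<Rightarrow> real) \<Rightarrow> (nat \<Rightarrow> real \<Rightarrow> real) \<Rightarrow> nat \<Rightarrow> 'u \<Rightarrow> 'w \<Rightarrow> real" where
  "mc_signal_coef a b g I T \<mu> \<phi> k u \<omega> =
     (\<Sum>p\<in>I. mc_weights a b g I T p \<omega> * \<mu> u (T p \<omega>) * \<phi> k (T p \<omega>) / g (T p \<omega>))"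

text \<open>
  \<open>\<kappa>\<close> is a function of \<open>g\<^sub>m\<^sub>i\<^sub>n\<close> and \<open>g\<^sub>m\<^sub>a\<^sub>x\<close> alone: one \<open>\<kappa>\<close> serves all intervals, densities,
  sample sizes and functions \<open>h\<close>. The i.i.d. design is realised by the coordinates of the
  product space, so that \<open>\<kappa>\<close> does not depend on an underlying probability space either.
\<close>

definition mc_moment_constant :: "(real \<Rightarrow> real \<Rightarrow> real) \<Rightarrow> bool" where
  "mc_moment_constant \<kappa> \<longleftrightarrow>
     (\<forall>a b g n m h.
        a < b \<longrightarrow> design_density a b g \<longrightarrow> (\<forall>i\<in>{1..n}. 1 \<le> m i) \<longrightarrow> 4 \<le> (\<Sum>i=1..n. m i) \<longrightarrow>
        (\<forall>t\<in>{a..b}. 0 \<le> h t) \<longrightarrow> integrable (design_law a b g) h \<longrightarrow>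
        (\<integral>\<^sup>+s. ennreal (\<Sum>p\<in>visits n m. (mc_weight a b g (visits n m) s p)\<^sup>2 * h (s p))
            \<partial>PiM (visits n m) (\<lambda>_. design_law a b g))
          \<le> ennreal (\<kappa> (INF t\<in>{a..b}. g t) (SUP t\<in>{a..b}. g t) / real (\<Sum>i=1..n. m i)
                       * (LINT t|leb_on a b. h t * g t)))"

end

theory Submission
  imports Defs
begin

text \<open>
  By Parseval's identity in \<open>t\<close>, the risk is the tail \<open>\<Sum>k>K. \<parallel>\<beta>\<^sub>k\<parallel>\<^sup>2\<close> plus the mean squared errors of
  the first \<open>K\<close> estimated coefficients. Given the design points, the error of a coefficient is a
  constant, the quadrature error of the signal, plus centred, pairwise independent contributions
  of the subjects and of the measurement errors. Its second moment is therefore at most the sum of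
  the variance of the signal coefficient and of
  \<open>\<Sum>\<^sub>p \<omega>\<^sub>p\<^sup>2 \<phi>\<^sub>k(T\<^sub>p)\<^sup>2 / g(T\<^sub>p)\<^sup>2 (m\<^sub>m\<^sub>a\<^sub>x \<Gamma>\<^sub>X(T\<^sub>p, T\<^sub>p) + \<tau>(T\<^sub>p)\<^sup>2)\<close>.

  For the moment constant, condition on \<open>T\<^sub>p = t\<close>. The point \<open>T\<^sub>p\<close> can be the nearest neighbour of \<open>v\<close>
  only if none of the \<open>N\<close> other points lies between \<open>t\<close> and \<open>v\<close>, an event of probability at most
  \<open>(1 - g\<^sub>m\<^sub>i\<^sub>n \<bar>v - t\<bar>)\<^sup>N \<le> exp (- N g\<^sub>m\<^sub>i\<^sub>n \<bar>v - t\<bar>)\<close>. Integrating over \<open>v\<close>, and over pairs \<open>v, w\<close>,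
  bounds the conditional second moments of the leave-one-out volumes and degrees by constants.
\<close>

subsection \<open>Nearest neighbours and measurability of the weights\<close>

text \<open>Admissibility bounds the sum of the squared weights only by a constant, whereas the term
  \<open>K / M\<close> requires mean order \<open>1 / M\<close>. This is why the second moment of
  \<open>M * \<omega>\<^sub>p\<close> is bounded conditionally on \<open>T\<^sub>p\<close>. The
  constant depends on the density through \<open>g_max / g_min\<close> alone: \<open>g_min\<close>
  governs the decay in the distance, \<open>g_max\<close> the mass within that distance. At least
  one competitor must remain after the point itself and two further points have been removed, which
  is where \<open>4 \<le> M\<close> enters. Admissibility serves another purpose: it makes the
  signal coefficient unbiased, so that the second moment of its quadrature error is a variance and
  the growth condition applies. Visits of one subject are dependent and are added up before
  independence is used; Cauchy-Schwarz within a subject produces \<open>m_max\<close>. Most bounds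
  are carried out in [0, \<infinity>], where Tonelli's theorem needs no integrability. The price is
  that \<open>ennreal\<close> truncates negative reals to 0, so signs are checked whenever a bound
  returns to the reals.\<close>

lemma lex_le_total: "lex_le p q \<or> lex_le q p"
  by (auto simp: lex_le_def)

lemma lex_le_antisym: "lex_le p q \<Longrightarrow> lex_le q p \<Longrightarrow> p = q"
  by (auto simp: lex_le_def prod_eq_iff)

lemma lex_le_trans: "lex_le p q \<Longrightarrow> lex_le q r \<Longrightarrow> lex_le p r"
  by (auto simp: lex_le_def)

text \<open>This is the predicate under the definite description in \<open>nearest\<close>. It is
  kept separate because it is a finite combination of comparisons, from which measurability and the
  moment bounds can be read off once its witness is known to exist and to be unique.\<close>

definition closest :: "(nat \<times> nat \<Rightarrow> real) \<Rightarrow> (nat \<times> nat) set \<Rightarrow> real \<Rightarrow> nat \<times> nat \<Rightarrow> bool" where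
  "closest s A t p \<longleftrightarrow> p \<in> A \<and>
     (\<forall>q\<in>A. \<bar>t - s p\<bar> < \<bar>t - s q\<bar> \<or> \<bar>t - s p\<bar> = \<bar>t - s q\<bar> \<and> lex_le p q)"

text \<open>A newly inserted point has to be compared with the previous winner only, since ordering
  by distance and then by index is total and transitive.\<close>

lemma closest_exists:
  assumes "finite A" "A \<noteq> {}"
  shows "\<exists>p. closest s A t p"
  using assms
proof (induction A rule: finite_ne_induct)
  case (singleton x)
  then show ?case using lex_le_total[of x x] by (auto simp: closest_def)
next
  case (insert x F)
  then obtain p where p: "closest s F t p" by blast
  show ?case
  proof (cases "\<bar>t - s p\<bar> < \<bar>t - s x\<bar> \<or> \<bar>t - s p\<bar> = \<bar>t - s x\<bar> \<and> lex_le p x")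
    case True
    then have "closest s (insert x F) t p" using p by (auto simp: closest_def)
    then show ?thesis by blast
  next
    case False
    then have x: "\<bar>t - s x\<bar> < \<bar>t - s p\<bar> \<or> \<bar>t - s x\<bar> = \<bar>t - s p\<bar> \<and> lex_le x p"
      using lex_le_total[of p x] by auto
    have "closest s (insert x F) t x"
      unfolding closest_def
    proof (intro conjI ballI)
      fix q assume "q \<in> insert x F"
      then consider "q = x" | "q \<in> F" by auto
      then show "\<bar>t - s x\<bar> < \<bar>t - s q\<bar> \<or> \<bar>t - s x\<bar> = \<bar>t - s q\<bar> \<and> lex_le x q"
      proof cases
        case 1
        then show ?thesis using lex_le_total[of x x] by auto
      next
        case 2
        then have "\<bar>t - s p\<bar> < \<bar>t - s q\<bar> \<or> \<bar>t - s p\<bar> = \<bar>t - s q\<bar> \<and> lex_le p q"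
          using p by (auto simp: closest_def)
        then show ?thesis using x lex_le_trans[of x p q] by auto
      qed
    qed simp
    then show ?thesis by blast
  qed
qed

lemma closest_unique: "closest s A t p \<Longrightarrow> closest s A t q \<Longrightarrow> p = q"
  unfolding closest_def using lex_le_antisym[of p q] by force

text \<open>For an empty set no index is closest and \<open>nearest\<close> is an unspecified pair;
  nonemptiness makes the description meaningful. Leave-one-out sets are nonempty as soon as there
  are two visits.\<close>

lemma nearest_eq_iff:
  assumes "finite A" "A \<noteq> {}"
  shows "nearest s A t = p \<longleftrightarrow> closest s A t p"
proof -
  obtain p' where "closest s A t p'" using closest_exists[OF assms] by blast
  then have "nearest s A t = p'"
    unfolding nearest_def closest_def[symmetric] using closest_unique by blast
  with \<open>closest s A t p'\<close> show ?thesis using closest_unique by blast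
qed

text \<open>The moment bounds use nearest neighbours through this weak inequality, valid for strict
  comparisons and ties alike.\<close>

lemma closest_le: "closest s A t p \<Longrightarrow> r \<in> A \<Longrightarrow> \<bar>t - s p\<bar> \<le> \<bar>t - s r\<bar>"
  by (auto simp: closest_def)

lemma nearest_cong: "(\<And>q. q \<in> A \<Longrightarrow> s q = s' q) \<Longrightarrow> nearest s A t = nearest s' A t"
  unfolding nearest_def by (rule arg_cong[where f = The]) (auto intro!: ext)

text \<open>Needed to replace the random map \<open>\<lambda>q. T q \<omega>\<close> by its
  restriction to the index set, which is a point of the product space on which the law of the design
  is known.\<close>

lemma mc_weight_cong:
  assumes "\<And>q. q \<in> I \<Longrightarrow> s q = s' q"
  shows "mc_weight a b g I s p = mc_weight a b g I s' p"
proof -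
  have cell: "loo_cell a b I s q p = loo_cell a b I s' q p" for q
    unfolding loo_cell_def using nearest_cong[of "I - {q}" s s'] assms by simp
  have "loo_degree a b I s p = loo_degree a b I s' p"
    unfolding loo_degree_def using assms by (intro sum.cong) (auto simp: cell)
  moreover have "loo_volume a b g I s p = loo_volume a b g I s' p"
    unfolding loo_volume_def by (simp add: cell)
  ultimately show ?thesis unfolding mc_weight_def by simp
qed

section \<open>The index set of the visits, the measures on the interval, and the weights as
  measurable functions of the design\<close>

lemma finite_visits [simp]: "finite (visits n m)"
  by (simp add: visits_def)

lemma card_visits: "card (visits n m) = (\<Sum>i=1..n. m i)"
  by (simp add: visits_def)

lemma space_leb_on [simp]: "space (leb_on a b) = {a..b}"
  by (simp add: leb_on_def space_restrict_space)

lemma space_design_law [simp]: "space (design_law a b g) = {a..b}"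
  by (simp add: design_law_def)

lemma sets_design_law [measurable_cong, simp]: "sets (design_law a b g) = sets (leb_on a b)"
  by (simp add: design_law_def)

lemma borel_measurable_leb_on_id [simp]: "(\<lambda>x. x) \<in> borel_measurable (leb_on a b)"
  unfolding leb_on_def by (rule measurable_restrict_space1) simp

lemma borel_measurable_leb_on_continuous:
  "continuous_on {a..b} f \<Longrightarrow> (f :: real \<Rightarrow> real) \<in> borel_measurable (leb_on a b)"
  unfolding leb_on_def
  using borel_measurable_continuous_on_restrict[of "{a..b}" f]
  by (simp add: measurable_def space_restrict_space sets_restrict_space)

lemma nn_integral_leb_on:
  "(\<integral>\<^sup>+x. f x \<partial>leb_on a b) = (\<integral>\<^sup>+x. f x * indicator {a..b} x \<partial>lborel)"
  unfolding leb_on_def by (subst nn_integral_restrict_space) auto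

lemma finite_measure_leb_on: "finite_measure (leb_on a b)"
  unfolding leb_on_def by (intro finite_measureI) (simp add: space_restrict_space emeasure_restrict_space emeasure_lborel_Icc_eq)

text \<open>The set integral over a cell becomes an integral over a fixed measure of an integrand
  depending on \<open>s\<close>, the form in which measurability in a parameter can be
  proved.\<close>

lemma loo_volume_eq:
  "loo_volume a b g I s p =
    (\<Sum>q\<in>I - {p}. LINT v|leb_on a b. (if nearest s (I - {q}) v = p then g v else 0))"
  unfolding loo_volume_def set_lebesgue_integral_def leb_on_def loo_cell_def
  by (subst integral_restrict_space)
    (auto intro!: sum.cong Bochner_Integration.integral_cong simp: indicator_def)

lemma loo_degree_eq:
  assumes "\<And>q. q \<in> I \<Longrightarrow> s q \<in> {a..b}"
  shows "loo_degree a b I s p = (\<Sum>q\<in>I - {p}. if nearest s (I - {q}) (s q) = p then 1 else 0)"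
  unfolding loo_degree_def loo_cell_def using assms by (intro sum.cong) (auto simp: indicator_def)

lemma closest_measurable:
  assumes "finite A" and f: "f \<in> borel_measurable N"
    and s: "\<And>r. r \<in> insert p A \<Longrightarrow> (\<lambda>x. s x r) \<in> borel_measurable N"
  shows "Measurable.pred N (\<lambda>x. closest (s x) A (f x) p)"
proof -
  have less: "Measurable.pred N (\<lambda>x. \<bar>f x - s x q\<bar> < \<bar>f x - s x r\<bar>)"
    if "q \<in> insert p A" "r \<in> insert p A" for q r
    using that f s by (intro borel_measurable_pred_less borel_measurable_abs borel_measurable_diff) auto
  \<comment> \<open>Equality of distances is replaced by a negated strict inequality, the opposite
    strict inequality being the other alternative; what remains is a Boolean combination of strict
    comparisons.\<close>
  have eq: "closest (s x) A (f x) p \<longleftrightarrow> p \<in> A \<and> (\<forall>r\<in>A. \<bar>f x - s x p\<bar> < \<bar>f x - s x r\<bar> \<or>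
      \<not> \<bar>f x - s x r\<bar> < \<bar>f x - s x p\<bar> \<and> lex_le p r)" for x
    unfolding closest_def by (metis linorder_less_linear order_less_asym order_less_irrefl)
  show ?thesis
    unfolding eq
    by (intro pred_intros_logic pred_intros_finite less) (use \<open>finite A\<close> in auto)
qed

text \<open>The degrees only need the nearest-neighbour predicate at \<open>s q\<close>, whereas the
  volumes are integrals with parameter \<open>s\<close> and need it jointly in \<open>s\<close> and
  \<open>v\<close>. The condition on the cardinality keeps every leave-one-out set nonempty.\<close>

lemma mc_weight_measurable:
  assumes "finite I" "2 \<le> card I" "p \<in> I" "g \<in> borel_measurable (leb_on a b)"
  shows "(\<lambda>s. mc_weight a b g I s p) \<in> borel_measurable (PiM I (\<lambda>_. leb_on a b))"
proof -
  let ?S = "PiM I (\<lambda>_. leb_on a b)"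
  note [measurable] = assms(4)
  interpret L: finite_measure "leb_on a b" by (rule finite_measure_leb_on)
  have ne: "I - {q} \<noteq> {}" for q
  proof
    assume "I - {q} = {}"
    then have "card I \<le> card {q}" by (intro card_mono) auto
    then show False using assms(2) by simp
  qed
  have cl: "nearest s (I - {q}) v = p \<longleftrightarrow> closest s (I - {q}) v p" for s q v
    using ne assms(1) by (intro nearest_eq_iff) auto
  have comp: "(\<lambda>s. s r) \<in> borel_measurable ?S" if "r \<in> I" for r
    using measurable_compose[OF measurable_component_singleton[OF that] borel_measurable_leb_on_id] .
  have comp1: "(\<lambda>z. fst z r) \<in> borel_measurable (?S \<Otimes>\<^sub>M leb_on a b)" if "r \<in> I" for r
    using measurable_compose[OF measurable_fst comp[OF that]] .
  have m1: "Measurable.pred ?S (\<lambda>s. nearest s (I - {q}) (s q) = p)" if "q \<in> I" for q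
    unfolding cl using assms(1,3) comp that by (intro closest_measurable) auto
  have [measurable]: "Measurable.pred (?S \<Otimes>\<^sub>M leb_on a b)
      (\<lambda>z. nearest (fst z) (I - {q}) (snd z) = p)" for q
    unfolding cl using assms(1,3) comp1
    by (intro closest_measurable measurable_compose[OF measurable_snd borel_measurable_leb_on_id]) auto
  have "(\<lambda>s. loo_volume a b g I s p) \<in> borel_measurable ?S"
    unfolding loo_volume_eq
    by (intro borel_measurable_sum L.borel_measurable_lebesgue_integral) (simp add: split_beta')
  moreover have "(\<lambda>s. loo_degree a b I s p) \<in> borel_measurable ?S
      \<longleftrightarrow> (\<lambda>s. \<Sum>q\<in>I - {p}. if nearest s (I - {q}) (s q) = p then 1 else (0::real)) \<in> borel_measurable ?S"
    by (intro measurable_cong loo_degree_eq) (auto simp: space_PiM)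
  moreover have "(\<lambda>s. \<Sum>q\<in>I - {p}. if nearest s (I - {q}) (s q) = p then 1 else (0::real)) \<in> borel_measurable ?S"
    using m1 by (intro borel_measurable_sum measurable_If) auto
  ultimately show ?thesis unfolding mc_weight_def by simp
qed

subsection \<open>Moments of the weights\<close>

text \<open>The integrand is at most \<open>1 / c\<close> times the sum of two exponential densities
  of rate \<open>c\<close>, one starting at \<open>t\<close> and one reflected there; each has mass
  1.\<close>

lemma nn_integral_exp_abs:
  assumes "0 < c"
  shows "(\<integral>\<^sup>+v. ennreal (exp (- (c * \<bar>v - t\<bar>))) \<partial>lborel) \<le> ennreal (2 / c)"
proof -
  let ?f = "exponential_density c"
  interpret E: prob_space "density lborel (\<lambda>x. ennreal (?f x))"
    using prob_space_exponential_density[OF assms] .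
  have tot: "(\<integral>\<^sup>+x. ennreal (?f x) \<partial>lborel) = 1"
    using E.emeasure_space_1 by (simp add: emeasure_density)
  have meas [measurable]: "?f \<in> borel_measurable borel" by simp
  have shift: "(\<integral>\<^sup>+v. ennreal (?f (v - t)) \<partial>lborel) = 1"
    using nn_integral_real_affine[of "\<lambda>x. ennreal (?f x)" 1 "-t"] tot by simp
  have refl: "(\<integral>\<^sup>+v. ennreal (?f (t - v)) \<partial>lborel) = 1"
    using nn_integral_real_affine[of "\<lambda>x. ennreal (?f x)" "-1" t] tot by simp
  have "(\<integral>\<^sup>+v. ennreal (exp (- (c * \<bar>v - t\<bar>))) \<partial>lborel)
      \<le> (\<integral>\<^sup>+v. ennreal (1 / c) * (ennreal (?f (v - t)) + ennreal (?f (t - v))) \<partial>lborel)"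
  proof (intro nn_integral_mono)
    fix v
    \<comment> \<open>At \<open>v = t\<close> both densities equal \<open>c\<close>, so the
      right-hand side is 2 there; elsewhere exactly one of them is nonzero and equality
      holds.\<close>
    have "exp (- (c * \<bar>v - t\<bar>)) \<le> 1 / c * (?f (v - t) + ?f (t - v))"
      using assms by (cases "v = t"; cases "v < t") (auto simp: exponential_density_def field_simps)
    then have "ennreal (exp (- (c * \<bar>v - t\<bar>))) \<le> ennreal (1 / c * (?f (v - t) + ?f (t - v)))"
      by (rule ennreal_leI)
    also have "\<dots> = ennreal (1 / c) * (ennreal (?f (v - t)) + ennreal (?f (t - v)))"
      using assms by (subst ennreal_mult) (auto simp: exponential_density_def)
    finally show "ennreal (exp (- (c * \<bar>v - t\<bar>))) \<le> \<dots>" .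
  qed
  also have "\<dots> = ennreal (1 / c) * (1 + 1)"
    using shift refl by (simp add: nn_integral_cmult nn_integral_add)
  also have "\<dots> = ennreal (2 / c)"
    using assms by (subst one_add_one, subst ennreal_numeral[symmetric], subst ennreal_mult[symmetric]) auto
  finally show ?thesis .
qed

locale design =
  fixes a b :: real and g :: "real \<Rightarrow> real"
  assumes less: "a < b" and density: "design_density a b g"
begin

abbreviation "g_min \<equiv> INF t\<in>{a..b}. g t"
abbreviation "g_max \<equiv> SUP t\<in>{a..b}. g t"
abbreviation "law \<equiv> design_law a b g"

sublocale prob_space law
  using density by (simp add: design_density_def)

lemma continuous_density: "continuous_on {a..b} g"
  using density lipschitz_on_continuous_on by (auto simp: design_density_def)

lemma density_measurable [measurable]: "g \<in> borel_measurable (leb_on a b)"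
  by (rule borel_measurable_leb_on_continuous[OF continuous_density])

lemma bdd_density: "bdd_below (g ` {a..b})" "bdd_above (g ` {a..b})"
proof -
  have "bounded (g ` {a..b})"
    using compact_continuous_image[OF continuous_density] compact_imp_bounded by blast
  then show "bdd_below (g ` {a..b})" "bdd_above (g ` {a..b})"
    by (auto intro: bounded_imp_bdd_below bounded_imp_bdd_above)
qed

lemma g_min_le: "t \<in> {a..b} \<Longrightarrow> g_min \<le> g t"
  using bdd_density by (intro cINF_lower) auto

lemma le_g_max: "t \<in> {a..b} \<Longrightarrow> g t \<le> g_max"
  using bdd_density by (intro cSUP_upper) auto

text \<open>Positivity at each point becomes a positive lower bound because the density is
  continuous and attains its minimum on the compact interval.\<close>

lemma g_min_pos: "0 < g_min"
proof -
  obtain t where t: "t \<in> {a..b}" "\<forall>x\<in>{a..b}. g t \<le> g x"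
    using continuous_attains_inf[of "{a..b}" g] continuous_density less by auto
  have "g t \<le> g_min" using t less by (intro cINF_greatest) auto
  moreover have "0 < g t" using t density by (auto simp: design_density_def)
  ultimately show ?thesis by simp
qed

lemma density_pos: "t \<in> {a..b} \<Longrightarrow> 0 < g t"
  using g_min_pos g_min_le by fastforce

lemma g_max_pos: "0 < g_max"
  using density_pos[of a] le_g_max[of a] less by auto

lemma nn_integral_law:
  "f \<in> borel_measurable (leb_on a b) \<Longrightarrow> (\<integral>\<^sup>+t. f t \<partial>law) = (\<integral>\<^sup>+t. ennreal (g t) * f t \<partial>leb_on a b)"
  unfolding design_law_def by (rule nn_integral_density) auto

text \<open>The exponent is halved in anticipation of the geometric mean used for pairs, which turns
  the factor 2 of \<open>nn_integral_exp_abs\<close> into 4. Replacing the density by its supremum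
  contributes \<open>g_max\<close>.\<close>

lemma nn_integral_law_exp:
  assumes "0 < N"
  shows "(\<integral>\<^sup>+v. ennreal (exp (- (N * g_min * \<bar>v - t\<bar> / 2))) \<partial>law) \<le> ennreal (4 * g_max / g_min / N)"
proof -
  note [measurable] = borel_measurable_leb_on_id
  let ?c = "N * g_min / 2"
  have c: "0 < ?c" using assms g_min_pos by simp
  have "(\<integral>\<^sup>+v. ennreal (exp (- (N * g_min * \<bar>v - t\<bar> / 2))) \<partial>law)
      = (\<integral>\<^sup>+v. ennreal (g v) * ennreal (exp (- (?c * \<bar>v - t\<bar>))) \<partial>leb_on a b)"
    by (subst nn_integral_law) simp_all
  also have "\<dots> \<le> (\<integral>\<^sup>+v. ennreal g_max * ennreal (exp (- (?c * \<bar>v - t\<bar>))) \<partial>leb_on a b)"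
    by (intro nn_integral_mono mult_right_mono ennreal_leI le_g_max) auto
  also have "\<dots> = ennreal g_max * (\<integral>\<^sup>+v. ennreal (exp (- (?c * \<bar>v - t\<bar>))) \<partial>leb_on a b)"
    by (rule nn_integral_cmult) simp
  also have "\<dots> \<le> ennreal g_max * (\<integral>\<^sup>+v. ennreal (exp (- (?c * \<bar>v - t\<bar>))) \<partial>lborel)"
    unfolding nn_integral_leb_on by (intro mult_left_mono nn_integral_mono) (auto simp: indicator_def)
  also have "\<dots> \<le> ennreal g_max * ennreal (2 / ?c)"
    by (intro mult_left_mono nn_integral_exp_abs[OF c]) auto
  also have "\<dots> = ennreal (4 * g_max / g_min / N)"
    using g_max_pos c by (subst ennreal_mult[symmetric]) (auto simp: field_simps)
  finally show ?thesis .
qed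

text \<open>The indicator that \<open>y\<close> is at least as distant from \<open>v\<close> as
  \<open>t\<close> is. If \<open>t\<close> is the nearest neighbour of \<open>v\<close>, it equals 1
  at every competitor, so a product of such factors dominates the indicator of that event and
  factorises under independence. Values in [0, \<infinity>] spare all integrability
  conditions.\<close>

definition far :: "real \<Rightarrow> real \<Rightarrow> real \<Rightarrow> ennreal" where
  "far v t y = (if \<bar>v - t\<bar> \<le> \<bar>v - y\<bar> then 1 else 0)"

lemma far_measurable [measurable]:
  assumes "f \<in> borel_measurable N" "h \<in> borel_measurable N" "k \<in> borel_measurable N"
  shows "(\<lambda>x. far (f x) (h x) (k x)) \<in> borel_measurable N"
  unfolding far_def using assms by measurable

text \<open>Competitors are excluded from a whole ball around \<open>v\<close>, but near an endpoint
  half of that ball may leave the interval. The open segment between \<open>t\<close> and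
  \<open>v\<close> always stays inside, so only this half is used; its mass is at least
  \<open>g_min\<close> times its length, and \<open>1 - x \<le> exp (- x)\<close> finishes.\<close>

lemma nn_integral_far:
  assumes v: "v \<in> {a..b}" and t: "t \<in> {a..b}"
  shows "(\<integral>\<^sup>+y. far v t y \<partial>law) \<le> ennreal (exp (- (g_min * \<bar>v - t\<bar>)))"
proof -
  note [measurable] = borel_measurable_leb_on_id
  let ?S = "{min v t<..<max v t}"
  have S: "?S \<subseteq> {a..b}" using v t by auto
  have "ennreal (g_min * \<bar>v - t\<bar>) = (\<integral>\<^sup>+y. ennreal g_min * indicator ?S y \<partial>lborel)"
    using g_min_pos by (subst nn_integral_cmult_indicator) (auto simp: ennreal_mult min_def max_def)
  also have "\<dots> = (\<integral>\<^sup>+y. ennreal g_min * indicator ?S y \<partial>leb_on a b)"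
    unfolding nn_integral_leb_on using S by (intro nn_integral_cong) (auto simp: indicator_def)
  also have "\<dots> \<le> (\<integral>\<^sup>+y. ennreal (g y) * (1 - far v t y) \<partial>leb_on a b)"
  proof (intro nn_integral_mono)
    fix y assume "y \<in> space (leb_on a b)"
    then have "g_min \<le> g y" by (simp add: g_min_le)
    moreover have "far v t y = 0" if "y \<in> ?S" using that by (auto simp: far_def)
    ultimately show "ennreal g_min * indicator ?S y \<le> ennreal (g y) * (1 - far v t y)"
      by (auto simp: indicator_def ennreal_leI)
  qed
  also have "\<dots> = (\<integral>\<^sup>+y. (1 - far v t y) \<partial>law)"
    by (subst nn_integral_law) simp_all
  finally have *: "ennreal (g_min * \<bar>v - t\<bar>) \<le> (\<integral>\<^sup>+y. (1 - far v t y) \<partial>law)" .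
  \<comment> \<open>Subtracting masses in [0, \<infinity>] is avoided by bounding their sum by 1;
    this also shows the first one to be finite, so that the rest is real arithmetic.\<close>
  have "(\<integral>\<^sup>+y. far v t y \<partial>law) + ennreal (g_min * \<bar>v - t\<bar>)
      \<le> (\<integral>\<^sup>+y. far v t y \<partial>law) + (\<integral>\<^sup>+y. (1 - far v t y) \<partial>law)"
    using * by (intro add_left_mono)
  also have "\<dots> = (\<integral>\<^sup>+y. far v t y + (1 - far v t y) \<partial>law)"
    by (rule nn_integral_add[symmetric]) auto
  also have "\<dots> = (\<integral>\<^sup>+y. 1 \<partial>law)"
    by (intro nn_integral_cong) (simp add: far_def)
  also have "\<dots> = 1" using emeasure_space_1 by simp
  finally have le: "(\<integral>\<^sup>+y. far v t y \<partial>law) + ennreal (g_min * \<bar>v - t\<bar>) \<le> 1" .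
  then have "(\<integral>\<^sup>+y. far v t y \<partial>law) \<noteq> \<infinity>" by (auto simp: top_unique)
  then obtain r where r: "0 \<le> r" "(\<integral>\<^sup>+y. far v t y \<partial>law) = ennreal r"
    by (metis ennreal_cases infinity_ennreal_def)
  have "ennreal (r + g_min * \<bar>v - t\<bar>) \<le> ennreal 1"
    using le r g_min_pos by (subst ennreal_plus) auto
  then have "r \<le> 1 + - (g_min * \<bar>v - t\<bar>)" by (subst (asm) ennreal_le_iff) auto
  also have "\<dots> \<le> exp (- (g_min * \<bar>v - t\<bar>))" by (rule exp_ge_add_one_self)
  finally show ?thesis unfolding r(2) by (rule ennreal_leI)
qed

text \<open>The smaller of two exponentials is bounded by their geometric mean, which factorises in \<open>v\<close> and \<open>w\<close>.\<close>

lemma nn_integral_far_pair: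
  assumes "v \<in> {a..b}" "w \<in> {a..b}" "t \<in> {a..b}"
  shows "(\<integral>\<^sup>+y. far v t y * far w t y \<partial>law) \<le> ennreal (exp (- (g_min * (\<bar>v - t\<bar> + \<bar>w - t\<bar>) / 2)))"
proof (cases "\<bar>w - t\<bar> \<le> \<bar>v - t\<bar>")
  case True
  have "(\<integral>\<^sup>+y. far v t y * far w t y \<partial>law) \<le> (\<integral>\<^sup>+y. far v t y \<partial>law)"
    by (intro nn_integral_mono) (auto simp: far_def)
  also have "\<dots> \<le> ennreal (exp (- (g_min * \<bar>v - t\<bar>)))" by (rule nn_integral_far) fact+
  also have "\<dots> \<le> ennreal (exp (- (g_min * (\<bar>v - t\<bar> + \<bar>w - t\<bar>) / 2)))"
    using True g_min_pos by (intro ennreal_leI) simp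
  finally show ?thesis .
next
  case False
  have "(\<integral>\<^sup>+y. far v t y * far w t y \<partial>law) \<le> (\<integral>\<^sup>+y. far w t y \<partial>law)"
    by (intro nn_integral_mono) (auto simp: far_def)
  also have "\<dots> \<le> ennreal (exp (- (g_min * \<bar>w - t\<bar>)))" by (rule nn_integral_far) fact+
  also have "\<dots> \<le> ennreal (exp (- (g_min * (\<bar>v - t\<bar> + \<bar>w - t\<bar>) / 2)))"
    using False g_min_pos by (intro ennreal_leI) simp
  finally show ?thesis .
qed

abbreviation "design_product J \<equiv> PiM J (\<lambda>_. law)"

sublocale product: product_prob_space "\<lambda>_. law" J for J
  by standard

text \<open>Independent coordinates factorise the integral. Coordinates of the product space outside
  \<open>J\<close> carry the factor 1 and integrate to 1. The power of the pair bound then splits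
  into one factor for \<open>v\<close> and one for \<open>w\<close>.\<close>

lemma nn_integral_far_prod:
  assumes "finite J'" "J \<subseteq> J'" and v: "v \<in> {a..b}" "w \<in> {a..b}" "t \<in> {a..b}"
  shows "(\<integral>\<^sup>+s. (\<Prod>r\<in>J. far v t (s r) * far w t (s r)) \<partial>design_product J')
    \<le> ennreal (exp (- (real (card J) * g_min * \<bar>v - t\<bar> / 2))) *
       ennreal (exp (- (real (card J) * g_min * \<bar>w - t\<bar> / 2)))"
proof -
  note [measurable] = borel_measurable_leb_on_id
  let ?e = "exp (- (g_min * (\<bar>v - t\<bar> + \<bar>w - t\<bar>) / 2))"
  have "(\<integral>\<^sup>+s. (\<Prod>r\<in>J. far v t (s r) * far w t (s r)) \<partial>design_product J')
      = (\<integral>\<^sup>+s. (\<Prod>r\<in>J'. (if r \<in> J then far v t (s r) * far w t (s r) else 1)) \<partial>design_product J')"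
    using assms(1,2) by (simp add: prod.If_cases Int_absorb1)
  also have "\<dots> = (\<Prod>r\<in>J'. (\<integral>\<^sup>+y. (if r \<in> J then far v t y * far w t y else 1) \<partial>law))"
    by (rule product.product_nn_integral_prod[where f = "\<lambda>r y. if r \<in> J then far v t y * far w t y else 1"])
      (use assms(1) in \<open>auto\<close>)
  also have "\<dots> = (\<Prod>r\<in>J'. if r \<in> J then (\<integral>\<^sup>+y. far v t y * far w t y \<partial>law) else 1)"
    by (intro prod.cong) (auto simp: emeasure_space_1[unfolded space_design_law])
  also have "\<dots> = (\<integral>\<^sup>+y. far v t y * far w t y \<partial>law) ^ card J"
    using assms(1,2) by (simp add: prod.If_cases Int_absorb1)
  also have "\<dots> \<le> ennreal ?e ^ card J"
    by (intro power_mono nn_integral_far_pair v) auto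
  also have "\<dots> = ennreal (?e ^ card J)" by (simp add: ennreal_power)
  also have "?e ^ card J = exp (- (real (card J) * g_min * \<bar>v - t\<bar> / 2)) * exp (- (real (card J) * g_min * \<bar>w - t\<bar> / 2))"
    by (simp flip: exp_of_nat_mult exp_add) (simp add: field_simps)
  finally show ?thesis by (simp add: ennreal_mult)
qed

lemma law_id_measurable [simp]: "(\<lambda>x. x) \<in> borel_measurable law"
  unfolding measurable_cong_sets[OF sets_design_law refl] by simp

text \<open>Divided by the number of competitors, this bounds the mean mass of the points that have
  a given design point as nearest neighbour.\<close>

abbreviation "ratio \<equiv> 4 * g_max / g_min"

lemma ratio_pos: "0 < ratio"
  using g_min_pos g_max_pos by simp

text \<open>The share of one test point \<open>v\<close> in the bound of
  \<open>nn_integral_far_prod\<close> when there are \<open>N\<close> competitors; the centre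
  \<open>t\<close> is the position of the conditioned point.\<close>

definition decay :: "real \<Rightarrow> real \<Rightarrow> real \<Rightarrow> ennreal" where
  "decay N t v = ennreal (exp (- (N * g_min * \<bar>v - t\<bar> / 2)))"

lemma decay_measurable [measurable]:
  assumes [measurable]: "f \<in> borel_measurable N"
  shows "(\<lambda>x. decay c t (f x)) \<in> borel_measurable N"
  unfolding decay_def by measurable

lemma nn_integral_decay: "0 < N \<Longrightarrow> (\<integral>\<^sup>+v. decay N t v \<partial>law) \<le> ennreal (ratio / N)"
  unfolding decay_def using nn_integral_law_exp[of N t] by simp

lemma nn_integral_decay2:
  assumes "0 < N"
  shows "(\<integral>\<^sup>+v. (\<integral>\<^sup>+w. decay N t v * decay N t w \<partial>law) \<partial>law) \<le> ennreal ((ratio / N)\<^sup>2)"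
proof -
  note [measurable] = law_id_measurable
  have "(\<integral>\<^sup>+v. (\<integral>\<^sup>+w. decay N t v * decay N t w \<partial>law) \<partial>law)
      = (\<integral>\<^sup>+v. decay N t v \<partial>law) * (\<integral>\<^sup>+w. decay N t w \<partial>law)"
    by (simp add: nn_integral_cmult nn_integral_multc)
  also have "\<dots> \<le> ennreal (ratio / N) * ennreal (ratio / N)"
    by (intro mult_mono nn_integral_decay assms) auto
  also have "\<dots> = ennreal ((ratio / N)\<^sup>2)"
    using less_imp_le[OF divide_pos_pos[OF ratio_pos assms]]
    by (subst ennreal_mult[symmetric]) (simp_all only: power2_eq_square)
  finally show ?thesis .
qed

section \<open>Volumes and degrees of leave-one-out cells when one design point is held
  fixed\<close>

lemma component_measurable:
  "r \<in> J \<Longrightarrow> (\<lambda>x. x r) \<in> borel_measurable (design_product J)"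
  by (rule measurable_compose[OF measurable_component_singleton]) simp_all

text \<open>The square of the volume is an integral over pairs \<open>(v, w)\<close> of points of
  the cell, and for both of them every competitor is far. The left-out index \<open>q\<close> does
  not compete and is absent from \<open>J\<close>.\<close>

lemma leave_one_out_volume:
  assumes I: "finite I" "p \<in> I" "q \<in> I - {p}" and "t \<in> {a..b}"
  defines "J \<equiv> I - {p, q}"
  shows "ennreal ((LINT v|leb_on a b. (if nearest (x(p := t)) (I - {q}) v = p then g v else 0))\<^sup>2)
    \<le> (\<integral>\<^sup>+v. (\<integral>\<^sup>+w. (\<Prod>r\<in>J. far v t (x r) * far w t (x r)) \<partial>law) \<partial>law)"
    (is "ennreal (?V\<^sup>2) \<le> _")
proof -
  note [measurable] = law_id_measurable borel_measurable_leb_on_id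
  let ?f = "\<lambda>v. if nearest (x(p := t)) (I - {q}) v = p then g v else 0"
  let ?F = "\<lambda>v. (\<Prod>r\<in>J. far v t (x r))"
  have nn: "0 \<le> ?f v" if "v \<in> space (leb_on a b)" for v
    using that density_pos[of v] by auto
  then have V: "0 \<le> ?V" by (intro Bochner_Integration.integral_nonneg)
  have "ennreal ?V \<le> (\<integral>\<^sup>+v. ennreal (?f v) \<partial>leb_on a b)"
  \<comment> \<open>If the integrand is not integrable, the integral has the default value 0 and the
    inequality is trivial, so measurability of the cell does not have to be established
    first.\<close>
  proof (cases "integrable (leb_on a b) ?f")
    case True
    then show ?thesis using nn by (subst nn_integral_eq_integral) (auto intro!: AE_I2 simp del: space_leb_on)
  qed (simp add: not_integrable_integral_eq)
  also have "\<dots> \<le> (\<integral>\<^sup>+v. ennreal (g v) * ?F v \<partial>leb_on a b)"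
  proof (intro nn_integral_mono)
    fix v
    have "?F v = 1" if "nearest (x(p := t)) (I - {q}) v = p"
    proof (rule prod.neutral, rule ballI)
      fix r assume r: "r \<in> J"
      have "closest (x(p := t)) (I - {q}) v p"
        using that I by (subst (asm) nearest_eq_iff) auto
      from closest_le[OF this, of r] show "far v t (x r) = 1"
        using r by (auto simp: far_def J_def)
    qed
    then show "ennreal (?f v) \<le> ennreal (g v) * ?F v" by auto
  qed
  also have "\<dots> = (\<integral>\<^sup>+v. ?F v \<partial>law)" by (subst nn_integral_law) simp_all
  finally have le: "ennreal ?V \<le> (\<integral>\<^sup>+v. ?F v \<partial>law)" .
  have "ennreal (?V\<^sup>2) = ennreal ?V * ennreal ?V"
    using V by (simp add: ennreal_mult power2_eq_square)
  also have "\<dots> \<le> (\<integral>\<^sup>+v. ?F v \<partial>law) * (\<integral>\<^sup>+w. ?F w \<partial>law)"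
    by (intro mult_mono le) auto
  also have "\<dots> = (\<integral>\<^sup>+v. (\<integral>\<^sup>+w. ?F v * ?F w \<partial>law) \<partial>law)"
    by (simp add: nn_integral_cmult nn_integral_multc)
  finally show ?thesis by (simp add: prod.distrib)
qed

text \<open>Tonelli's theorem moves the expectation over the competitors inside, where
  \<open>v\<close> and \<open>w\<close> are frozen and the coordinates factorise. Each of the two
  outer integrations then gains a factor \<open>ratio / real (card J)\<close>.\<close>

lemma nn_integral_leave_one_out_volume:
  assumes "finite J'" "J \<subseteq> J'" "J \<noteq> {}" "t \<in> {a..b}"
  shows "(\<integral>\<^sup>+x. (\<integral>\<^sup>+v. (\<integral>\<^sup>+w. (\<Prod>r\<in>J. far v t (x r) * far w t (x r)) \<partial>law) \<partial>law) \<partial>design_product J')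
    \<le> ennreal ((ratio / real (card J))\<^sup>2)"
proof -
  let ?Q = "design_product J'"
  interpret Q: prob_space ?Q by (intro prob_space_PiM) (rule prob_space_axioms)
  interpret L2: prob_space "law \<Otimes>\<^sub>M law" by (intro prob_space_pair prob_space_axioms)
  interpret QLL: pair_sigma_finite ?Q "law \<Otimes>\<^sub>M law" ..
  let ?G = "\<lambda>x v w. \<Prod>r\<in>J. far v t (x r) * far w t (x r)"
  have comp: "(\<lambda>z. fst z r) \<in> borel_measurable (?Q \<Otimes>\<^sub>M (law \<Otimes>\<^sub>M law))" if "r \<in> J" for r
    by (rule measurable_compose[OF measurable_fst component_measurable]) (use that assms(2) in auto)
  note id = law_id_measurable
  have fs: "(\<lambda>z. fst (snd z)) \<in> borel_measurable (?Q \<Otimes>\<^sub>M (law \<Otimes>\<^sub>M law))"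
      "(\<lambda>z. snd (snd z)) \<in> borel_measurable (?Q \<Otimes>\<^sub>M (law \<Otimes>\<^sub>M law))"
    using measurable_compose[OF measurable_compose[OF measurable_snd measurable_fst] id]
      measurable_compose[OF measurable_compose[OF measurable_snd measurable_snd] id] by auto
  have G: "(\<lambda>z. ?G (fst z) (fst (snd z)) (snd (snd z))) \<in> borel_measurable (?Q \<Otimes>\<^sub>M (law \<Otimes>\<^sub>M law))"
    by (intro borel_measurable_prod_ennreal borel_measurable_times_ennreal far_measurable comp fs) auto
  have "(\<integral>\<^sup>+x. (\<integral>\<^sup>+v. (\<integral>\<^sup>+w. ?G x v w \<partial>law) \<partial>law) \<partial>?Q)
      = (\<integral>\<^sup>+x. (\<integral>\<^sup>+z. ?G x (fst z) (snd z) \<partial>(law \<Otimes>\<^sub>M law)) \<partial>?Q)"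
  proof (intro nn_integral_cong)
    fix x assume "x \<in> space ?Q"
    from measurable_Pair2[OF G this] show
      "(\<integral>\<^sup>+v. (\<integral>\<^sup>+w. ?G x v w \<partial>law) \<partial>law) = (\<integral>\<^sup>+z. ?G x (fst z) (snd z) \<partial>(law \<Otimes>\<^sub>M law))"
      by (subst nn_integral_fst[symmetric]) auto
  qed
  also have "\<dots> = (\<integral>\<^sup>+z. (\<integral>\<^sup>+x. ?G x (fst z) (snd z) \<partial>?Q) \<partial>(law \<Otimes>\<^sub>M law))"
    using G by (intro QLL.Fubini'[symmetric]) (simp add: split_beta')
  also have "\<dots> \<le> (\<integral>\<^sup>+z. decay (real (card J)) t (fst z) * decay (real (card J)) t (snd z) \<partial>(law \<Otimes>\<^sub>M law))"
    unfolding decay_def using assms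
    by (intro nn_integral_mono nn_integral_far_prod) (auto simp: space_pair_measure)
  also have "\<dots> = (\<integral>\<^sup>+v. (\<integral>\<^sup>+w. decay (real (card J)) t v * decay (real (card J)) t w \<partial>law) \<partial>law)"
    by (subst nn_integral_fst[symmetric])
      (auto intro!: borel_measurable_times_ennreal decay_measurable measurable_compose[OF measurable_fst id]
        measurable_compose[OF measurable_snd id])
  also have "\<dots> \<le> ennreal ((ratio / real (card J))\<^sup>2)"
    using assms finite_subset[of J J'] by (intro nn_integral_decay2) (auto simp: card_gt_0_iff)
  finally show ?thesis .
qed

text \<open>For distinct \<open>q\<close> and \<open>q'\<close>, the point \<open>x q'\<close>
  competes in the event of \<open>q\<close>, and conversely. Both are dropped from the product, at
  the cost of one competitor in each event, so that the remaining coordinates are independent of the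
  two test points.\<close>

lemma nearest_neighbour_pair:
  assumes I: "finite I" "p \<in> I" "q \<in> I - {p}" "q' \<in> I - {p}"
  shows "(if nearest (x(p := t)) (I - {q}) (x q) = p then 1 else 0) *
      (if nearest (x(p := t)) (I - {q'}) (x q') = p then 1 else 0)
    \<le> (\<Prod>r\<in>I - {p, q, q'}. far (x q) t (x r) * far (x q') t (x r))"
proof -
  have far: "far (x k) t (x r) = 1"
    if k: "k \<in> I - {p}" "nearest (x(p := t)) (I - {k}) (x k) = p" and r: "r \<in> I - {p, k}" for k r
  proof -
    have "closest (x(p := t)) (I - {k}) (x k) p"
      using k I by (subst (asm) nearest_eq_iff) auto
    from closest_le[OF this, of r] show ?thesis using r by (auto simp: far_def)
  qed
  have "(\<Prod>r\<in>I - {p, q, q'}. far (x q) t (x r) * far (x q') t (x r)) = 1"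
    if "nearest (x(p := t)) (I - {q}) (x q) = p" "nearest (x(p := t)) (I - {q'}) (x q') = p"
    using far[OF I(3) that(1)] far[OF I(4) that(2)] by (intro prod.neutral) auto
  then show ?thesis by auto
qed

text \<open>The test points are design points themselves. Splitting off the coordinates
  \<open>q\<close> and \<open>q'\<close> turns them into integration variables with law
  \<open>law\<close>, after which the double integral is the one already met for the
  volumes.\<close>

lemma nn_integral_nearest_neighbour_pair:
  assumes "finite J" "J \<noteq> {}" "q \<notin> J" "q' \<notin> J" "q \<noteq> q'" "t \<in> {a..b}"
  shows "(\<integral>\<^sup>+x. (\<Prod>r\<in>J. far (x q) t (x r) * far (x q') t (x r)) \<partial>design_product (insert q (insert q' J)))
    \<le> ennreal ((ratio / real (card J))\<^sup>2)"
proof -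
  let ?N = "real (card J)"
  have J: "r \<in> J \<Longrightarrow> r \<noteq> q \<and> r \<noteq> q'" for r using assms by auto
  have m: "(\<lambda>x. \<Prod>r\<in>J. far (x q) t (x r) * far (x q') t (x r))
      \<in> borel_measurable (design_product (insert q (insert q' J)))"
    by (intro borel_measurable_prod_ennreal borel_measurable_times_ennreal far_measurable
        component_measurable) auto
  have m': "(\<lambda>x. \<Prod>r\<in>J. far v t (x r) * far (x q') t (x r))
      \<in> borel_measurable (design_product (insert q' J))" for v
    by (intro borel_measurable_prod_ennreal borel_measurable_times_ennreal far_measurable
        component_measurable) auto
  have e1: "(\<Prod>r\<in>J. far ((x(q := v)) q) t ((x(q := v)) r) * far ((x(q := v)) q') t ((x(q := v)) r))
      = (\<Prod>r\<in>J. far v t (x r) * far (x q') t (x r))" for x v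
    using J assms(5) by (intro prod.cong) auto
  have e2: "(\<Prod>r\<in>J. far v t ((x(q' := w)) r) * far ((x(q' := w)) q') t ((x(q' := w)) r))
      = (\<Prod>r\<in>J. far v t (x r) * far w t (x r))" for x v w
    using J by (intro prod.cong) auto
  have "(\<integral>\<^sup>+x. (\<Prod>r\<in>J. far (x q) t (x r) * far (x q') t (x r)) \<partial>design_product (insert q (insert q' J)))
      = (\<integral>\<^sup>+v. (\<integral>\<^sup>+x. (\<Prod>r\<in>J. far v t (x r) * far (x q') t (x r)) \<partial>design_product (insert q' J)) \<partial>law)"
    using assms m by (subst product.product_nn_integral_insert_rev) (simp_all only: e1 finite_insert insert_iff simp_thms)
  also have "\<dots> = (\<integral>\<^sup>+v. (\<integral>\<^sup>+w. (\<integral>\<^sup>+x. (\<Prod>r\<in>J. far v t (x r) * far w t (x r)) \<partial>design_product J) \<partial>law) \<partial>law)"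
    using assms m' by (subst product.product_nn_integral_insert_rev) (simp_all only: e2 simp_thms)
  also have "\<dots> \<le> (\<integral>\<^sup>+v. (\<integral>\<^sup>+w. decay ?N t v * decay ?N t w \<partial>law) \<partial>law)"
    unfolding decay_def using assms by (intro nn_integral_mono nn_integral_far_prod) auto
  also have "\<dots> \<le> ennreal ((ratio / ?N)\<^sup>2)"
    using assms by (intro nn_integral_decay2) (auto simp: card_gt_0_iff)
  finally show ?thesis .
qed

text \<open>The diagonal case: one test point means a single integration, which gains only one
  factor \<open>1 / real (card J)\<close>. One of the two equal decay factors is bounded by
  1.\<close>

lemma nn_integral_nearest_neighbour:
  assumes "finite J" "J \<noteq> {}" "q \<notin> J" "t \<in> {a..b}"
  shows "(\<integral>\<^sup>+x. (\<Prod>r\<in>J. far (x q) t (x r) * far (x q) t (x r)) \<partial>design_product (insert q J))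
    \<le> ennreal (ratio / real (card J))"
proof -
  let ?N = "real (card J)"
  have m: "(\<lambda>x. \<Prod>r\<in>J. far (x q) t (x r) * far (x q) t (x r))
      \<in> borel_measurable (design_product (insert q J))"
    by (intro borel_measurable_prod_ennreal borel_measurable_times_ennreal far_measurable
        component_measurable) auto
  have e: "(\<Prod>r\<in>J. far ((x(q := v)) q) t ((x(q := v)) r) * far ((x(q := v)) q) t ((x(q := v)) r))
      = (\<Prod>r\<in>J. far v t (x r) * far v t (x r))" for x v
    using assms(3) by (intro prod.cong) auto
  have "(\<integral>\<^sup>+x. (\<Prod>r\<in>J. far (x q) t (x r) * far (x q) t (x r)) \<partial>design_product (insert q J))
      = (\<integral>\<^sup>+v. (\<integral>\<^sup>+x. (\<Prod>r\<in>J. far v t (x r) * far v t (x r)) \<partial>design_product J) \<partial>law)"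
    using assms m by (subst product.product_nn_integral_insert_rev) (simp_all only: e simp_thms)
  also have "\<dots> \<le> (\<integral>\<^sup>+v. decay ?N t v * decay ?N t v \<partial>law)"
    unfolding decay_def using assms by (intro nn_integral_mono nn_integral_far_prod) auto
  also have "\<dots> \<le> (\<integral>\<^sup>+v. decay ?N t v * 1 \<partial>law)"
    using g_min_pos by (intro nn_integral_mono mult_left_mono) (auto simp: decay_def)
  also have "\<dots> \<le> ennreal (ratio / ?N)"
    using nn_integral_decay[of ?N t] assms by (simp add: card_gt_0_iff)
  finally show ?thesis .
qed

end

section \<open>The second moment of a weight given the position of its own design point\<close>

lemma sum_delta_plus_const:
  assumes "finite A"
  shows "(\<Sum>q\<in>A. \<Sum>q'\<in>A. (if q = q' then x else 0) + (y::real)) = real (card A) * x + (real (card A))\<^sup>2 * y"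
  using assms by (simp add: sum.distrib power2_eq_square distrib_left)

context design
begin

lemma PiM_law_sets: "sets (design_product J) = sets (PiM J (\<lambda>_. leb_on a b))"
  by (intro sets_PiM_cong) auto

lemma weight_measurable:
  assumes "finite I" "2 \<le> card I" "p \<in> I"
  shows "(\<lambda>s. mc_weight a b g I s p) \<in> borel_measurable (design_product I)"
  unfolding measurable_cong_sets[OF PiM_law_sets refl]
  using assms by (intro mc_weight_measurable) auto

text \<open>With \<open>n\<close> the sample size, the factor 3 comes from squaring the three terms
  of \<open>1 + c - d\<close>. The volumes contribute at most
  \<open>((n - 1) / (n - 2))\<^sup>2 * ratio\<^sup>2\<close>, the pairs in the squared degree
  \<open>((n - 1) / (n - 3))\<^sup>2 * ratio\<^sup>2\<close>, and its diagonal in addition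
  \<open>(n - 1) / (n - 2) * ratio\<close>. For \<open>4 \<le> n\<close> the prefactors are at most
  9, 9 and 2.\<close>

lemma conditional_second_moment:
  assumes I: "finite I" "p \<in> I" "4 \<le> card I" and t: "t \<in> {a..b}"
  shows "(\<integral>\<^sup>+x. ennreal ((real (card I) * mc_weight a b g I (x(p := t)) p)\<^sup>2) \<partial>design_product (I - {p}))
    \<le> ennreal (3 * (1 + 2 * ratio + 18 * ratio\<^sup>2))"
proof -
  define J where "J = I - {p}"
  define n where "n = real (card I)"
  define V where "V x q = (LINT v|leb_on a b. (if nearest (x(p := t)) (I - {q}) v = p then g v else 0))" for x q
  define H where "H x q = (if nearest (x(p := t)) (I - {q}) (x q) = p then 1 else 0 :: real)" for x q
  define A where "A x q = (\<integral>\<^sup>+v. (\<integral>\<^sup>+w. (\<Prod>r\<in>I - {p, q}. far v t (x r) * far w t (x r)) \<partial>law) \<partial>law)" for x q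
  define B where "B x q q' = (\<Prod>r\<in>I - {p, q, q'}. far (x q) t (x r) * far (x q') t (x r))" for x q q'
  let ?Q = "design_product J"
  have n: "4 \<le> n" using I unfolding n_def by linarith
  have cJ: "card J = card I - 1" "real (card J) = n - 1" "finite J"
    using I n by (auto simp: J_def n_def)
  have Q: "prob_space ?Q" by (intro prob_space_PiM) (rule prob_space_axioms)
  have weight: "n * mc_weight a b g I (x(p := t)) p = 1 + (\<Sum>q\<in>J. V x q) - (\<Sum>q\<in>J. H x q)"
    if "x \<in> space ?Q" for x
  proof -
    have "(x(p := t)) q \<in> {a..b}" if "q \<in> I" for q
      using that t PiE_mem[of x J "\<lambda>_. {a..b}" q] \<open>x \<in> space ?Q\<close>
      by (cases "q = p") (simp_all add: space_PiM J_def)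
    then have "loo_degree a b I (x(p := t)) p = (\<Sum>q\<in>J. H x q)"
      unfolding J_def H_def by (subst loo_degree_eq) (auto intro!: sum.cong)
    moreover have "loo_volume a b g I (x(p := t)) p = (\<Sum>q\<in>J. V x q)"
      unfolding J_def V_def by (rule loo_volume_eq)
    ultimately show ?thesis
      using n by (simp add: mc_weight_def n_def)
  qed
  have pointwise: "ennreal ((n * mc_weight a b g I (x(p := t)) p)\<^sup>2)
      \<le> 3 * (1 + (ennreal (n - 1) * (\<Sum>q\<in>J. A x q) + (\<Sum>q\<in>J. \<Sum>q'\<in>J. B x q q')))"
    if x: "x \<in> space ?Q" for x
  proof -
    let ?c = "\<Sum>q\<in>J. V x q" and ?d = "\<Sum>q\<in>J. H x q"
    have "(1 + ?c - ?d)\<^sup>2 \<le> 3 * (1 + (?c\<^sup>2 + ?d\<^sup>2))"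
    proof -
      \<comment> \<open>The sum of these three squares is exactly the right-hand side minus the
        left-hand side.\<close>
      have "0 \<le> (1 - ?c)\<^sup>2 + (1 + ?d)\<^sup>2 + (?c + ?d)\<^sup>2" by simp
      then show ?thesis by (simp add: power2_eq_square algebra_simps)
    qed
    \<comment> \<open>Cauchy-Schwarz suffices for the volumes, since each has a second moment of
      order \<open>1 / n\<^sup>2\<close>. For the degrees it would lose a factor \<open>n\<close>,
      because an indicator equals its square and its mean is only bounded by order
      \<open>1 / n\<close>; their square is therefore expanded into pairs.\<close>
    also have "\<dots> \<le> 3 * (1 + ((n - 1) * (\<Sum>q\<in>J. (V x q)\<^sup>2) + (\<Sum>q\<in>J. \<Sum>q'\<in>J. H x q * H x q')))"
      using sum_squared_le_sum_of_squares[of "V x" J] cJ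
      by (simp add: power2_eq_square[of ?d] sum_product mult.commute)
    finally have "ennreal ((n * mc_weight a b g I (x(p := t)) p)\<^sup>2)
        \<le> ennreal (3 * (1 + ((n - 1) * (\<Sum>q\<in>J. (V x q)\<^sup>2) + (\<Sum>q\<in>J. \<Sum>q'\<in>J. H x q * H x q'))))"
      unfolding weight[OF x] by (rule ennreal_leI)
    also have "\<dots> = 3 * (1 + (ennreal (n - 1) * (\<Sum>q\<in>J. ennreal ((V x q)\<^sup>2))
        + (\<Sum>q\<in>J. \<Sum>q'\<in>J. ennreal (H x q * H x q'))))"
      using n by (simp add: ennreal_mult ennreal_plus sum_nonneg H_def flip: sum_ennreal)
    also have "\<dots> \<le> 3 * (1 + (ennreal (n - 1) * (\<Sum>q\<in>J. A x q) + (\<Sum>q\<in>J. \<Sum>q'\<in>J. B x q q')))"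
    proof (intro mult_left_mono add_mono sum_mono order_refl zero_le)
      fix q assume q: "q \<in> J"
      show "ennreal ((V x q)\<^sup>2) \<le> A x q"
        unfolding V_def A_def using I t q by (intro leave_one_out_volume) (auto simp: J_def)
      fix q' assume q': "q' \<in> J"
      have "ennreal (H x q * H x q') = (if nearest (x(p := t)) (I - {q}) (x q) = p then 1 else 0) *
        (if nearest (x(p := t)) (I - {q'}) (x q') = p then 1 else 0)"
        by (auto simp: H_def)
      also have "\<dots> \<le> B x q q'"
        unfolding B_def using I t q q' by (intro nearest_neighbour_pair) (auto simp: J_def)
      finally show "ennreal (H x q * H x q') \<le> B x q q'" .
    qed
    finally show ?thesis .
  qed
  have card2: "real (card (I - {p, q})) = n - 2" "I - {p, q} \<noteq> {}" if "q \<in> J" for q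
  proof -
    have "card (I - {p, q}) = card I - 2"
      using I that by (subst card_Diff_subset) (auto simp: J_def)
    then show "real (card (I - {p, q})) = n - 2" using I by (simp add: n_def)
    then show "I - {p, q} \<noteq> {}" using n by force
  qed
  have card3: "real (card (I - {p, q, q'})) = n - 3" "I - {p, q, q'} \<noteq> {}"
    if "q \<in> J" "q' \<in> J" "q \<noteq> q'" for q q'
  proof -
    have "card (I - {p, q, q'}) = card I - 3"
      using I that by (subst card_Diff_subset) (auto simp: J_def)
    then show "real (card (I - {p, q, q'})) = n - 3" using I by (simp add: n_def)
    then show "I - {p, q, q'} \<noteq> {}" using n by force
  qed
  have A: "(\<integral>\<^sup>+x. A x q \<partial>?Q) \<le> ennreal ((ratio / (n - 2))\<^sup>2)" if q: "q \<in> J" for q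
    using nn_integral_leave_one_out_volume[of J "I - {p, q}" t] card2[OF q] cJ t
    unfolding A_def by (auto simp: J_def)
  \<comment> \<open>The square is kept on the diagonal as well, so that one formula covers both
    cases and the double sum has the shape of \<open>sum_delta_plus_const\<close>.\<close>
  have B: "(\<integral>\<^sup>+x. B x q q' \<partial>?Q)
      \<le> ennreal ((if q = q' then ratio / (n - 2) else 0) + (ratio / (n - 3))\<^sup>2)"
    if q: "q \<in> J" "q' \<in> J" for q q'
  proof (cases "q = q'")
    case True
    have "J = insert q (I - {p, q})" using q by (auto simp: J_def)
    then have "(\<integral>\<^sup>+x. B x q q' \<partial>?Q) \<le> ennreal (ratio / (n - 2))"
      using nn_integral_nearest_neighbour[of "I - {p, q}" q t] card2[OF q(1)] I t True
      by (simp add: B_def insert_commute)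
    also have "\<dots> \<le> ennreal (ratio / (n - 2) + (ratio / (n - 3))\<^sup>2)" by (intro ennreal_leI) simp
    finally show ?thesis using True by simp
  next
    case False
    have "J = insert q (insert q' (I - {p, q, q'}))" using q by (auto simp: J_def)
    then show ?thesis
      using nn_integral_nearest_neighbour_pair[of "I - {p, q, q'}" q q' t] card3[OF q False] I t False
      by (simp add: B_def)
  qed
  have comp: "(\<lambda>x. x r) \<in> borel_measurable ?Q" if "r \<in> J" for r
    using that by (rule component_measurable)
  have A_meas: "(\<lambda>x. A x q) \<in> borel_measurable ?Q" for q
  proof -
    interpret LL: prob_space "law \<Otimes>\<^sub>M law" by (intro prob_space_pair prob_space_axioms)
    have c1: "(\<lambda>z. fst (fst z) r) \<in> borel_measurable ((?Q \<Otimes>\<^sub>M law) \<Otimes>\<^sub>M law)" if "r \<in> I - {p, q}" for r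
      by (rule measurable_compose[OF measurable_fst measurable_compose[OF measurable_fst comp]])
        (use that in \<open>auto simp: J_def\<close>)
    show ?thesis
      unfolding A_def
      by (intro borel_measurable_nn_integral)
        (auto simp: split_beta' intro!: borel_measurable_nn_integral borel_measurable_prod_ennreal
          borel_measurable_times_ennreal far_measurable c1
          measurable_compose[OF measurable_snd law_id_measurable]
          measurable_compose[OF measurable_fst measurable_compose[OF measurable_snd law_id_measurable]])
  qed
  have B_meas: "(\<lambda>x. B x q q') \<in> borel_measurable ?Q" if "q \<in> J" "q' \<in> J" for q q'
    unfolding B_def using that
    by (intro borel_measurable_prod_ennreal borel_measurable_times_ennreal far_measurable comp)
      (auto simp: J_def)
  have "(\<integral>\<^sup>+x. ennreal ((n * mc_weight a b g I (x(p := t)) p)\<^sup>2) \<partial>?Q)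
      \<le> (\<integral>\<^sup>+x. 3 * (1 + (ennreal (n - 1) * (\<Sum>q\<in>J. A x q) + (\<Sum>q\<in>J. \<Sum>q'\<in>J. B x q q'))) \<partial>?Q)"
    by (intro nn_integral_mono pointwise)
  also have "\<dots> = 3 * (1 + (ennreal (n - 1) * (\<Sum>q\<in>J. \<integral>\<^sup>+x. A x q \<partial>?Q)
      + (\<Sum>q\<in>J. \<Sum>q'\<in>J. \<integral>\<^sup>+x. B x q q' \<partial>?Q)))"
    using A_meas B_meas prob_space.emeasure_space_1[OF Q]
    by (simp add: nn_integral_cmult nn_integral_add nn_integral_sum borel_measurable_sum)
  also have "\<dots> \<le> 3 * (1 + (ennreal (n - 1) * (\<Sum>q\<in>J. ennreal ((ratio / (n - 2))\<^sup>2))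
      + (\<Sum>q\<in>J. \<Sum>q'\<in>J. ennreal ((if q = q' then ratio / (n - 2) else 0) + (ratio / (n - 3))\<^sup>2))))"
    by (intro mult_left_mono add_mono sum_mono A B order_refl zero_le)
  also have "\<dots> = ennreal (3 * (1 + ((n - 1) * (\<Sum>q\<in>J. (ratio / (n - 2))\<^sup>2)
      + (\<Sum>q\<in>J. \<Sum>q'\<in>J. (if q = q' then ratio / (n - 2) else 0) + (ratio / (n - 3))\<^sup>2))))"
  proof -
    have "0 \<le> (if q = q' then ratio / (n - 2) else 0) + (ratio / (n - 3))\<^sup>2" for q q' :: "nat \<times> nat"
    proof -
      have "0 \<le> ratio / (n - 2)" using n less_imp_le[OF ratio_pos] by (intro divide_nonneg_nonneg[of ratio]) linarith+
      then show ?thesis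
        by (intro add_nonneg_nonneg zero_le_power2) (simp only: order_refl simp_thms split: if_split)
    qed
    then show ?thesis
      using n by (simp add: ennreal_mult ennreal_plus sum_nonneg sum_ennreal del: sum_constant)
  qed
  also have "\<dots> \<le> ennreal (3 * (1 + 2 * ratio + 18 * ratio\<^sup>2))"
  proof (intro ennreal_leI)
    have "(n - 1) * (\<Sum>q\<in>J. (ratio / (n - 2))\<^sup>2) = ((n - 1) / (n - 2))\<^sup>2 * ratio\<^sup>2"
    proof -
      have "x * (x * (r / z)\<^sup>2) = (x / z)\<^sup>2 * r\<^sup>2" for x r z :: real
        by (simp add: power2_eq_square)
      then show ?thesis unfolding sum_constant cJ(2) .
    qed
    moreover have "((n - 1) / (n - 2))\<^sup>2 \<le> 3\<^sup>2"
      using n by (intro power_mono) (auto simp: divide_simps)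
    moreover have "(n - 1) * (ratio / (n - 2)) \<le> 2 * ratio"
    proof -
      have "(n - 1) / (n - 2) \<le> 2" using n by (auto simp: divide_simps)
      then have "(n - 1) / (n - 2) * ratio \<le> 2 * ratio" using ratio_pos by (intro mult_right_mono) auto
      then show ?thesis by (simp add: mult.commute)
    qed
    moreover have "(n - 1)\<^sup>2 * (ratio / (n - 3))\<^sup>2 = ((n - 1) / (n - 3))\<^sup>2 * ratio\<^sup>2"
      by (simp add: power_divide power_mult_distrib)
    moreover have "((n - 1) / (n - 3))\<^sup>2 \<le> 3\<^sup>2"
      using n by (intro power_mono) (auto simp: divide_simps)
    ultimately have "(n - 1) * (\<Sum>q\<in>J. (ratio / (n - 2))\<^sup>2) \<le> 3\<^sup>2 * ratio\<^sup>2"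
      "(n - 1)\<^sup>2 * (ratio / (n - 3))\<^sup>2 \<le> 3\<^sup>2 * ratio\<^sup>2" "(n - 1) * (ratio / (n - 2)) \<le> 2 * ratio"
      by (auto intro: mult_right_mono)
    then show "3 * (1 + ((n - 1) * (\<Sum>q\<in>J. (ratio / (n - 2))\<^sup>2)
        + (\<Sum>q\<in>J. \<Sum>q'\<in>J. (if q = q' then ratio / (n - 2) else 0) + (ratio / (n - 3))\<^sup>2)))
      \<le> 3 * (1 + 2 * ratio + 18 * ratio\<^sup>2)"
      unfolding sum_delta_plus_const[OF cJ(3)] cJ(2) by simp
  qed
  finally show ?thesis unfolding n_def J_def .
qed

text \<open>Splitting off the coordinate \<open>p\<close> makes \<open>h (s p)\<close> a constant of
  the inner integral, so that the conditional bound applies at each \<open>t\<close>. Each of the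
  \<open>card I\<close> summands is of order \<open>1 / (card I)\<^sup>2\<close>, which leaves
  \<open>1 / card I\<close> in total.\<close>

lemma weighted_moment:
  assumes I: "finite I" "4 \<le> card I"
    and h: "\<forall>t\<in>{a..b}. 0 \<le> h t" "integrable law h"
  shows "(\<integral>\<^sup>+s. ennreal (\<Sum>p\<in>I. (mc_weight a b g I s p)\<^sup>2 * h (s p)) \<partial>design_product I)
    \<le> ennreal (3 * (1 + 2 * ratio + 18 * ratio\<^sup>2) / real (card I) * (LINT t|leb_on a b. h t * g t))"
proof -
  let ?W = "\<lambda>s p. mc_weight a b g I s p"
  define C where "C = 3 * (1 + 2 * ratio + 18 * ratio\<^sup>2)"
  let ?n = "real (card I)"
  have C: "0 \<le> C" using ratio_pos by (simp add: C_def)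
  have [measurable]: "h \<in> borel_measurable law" using h by auto
  have hs: "(\<lambda>s. h (s p)) \<in> borel_measurable (design_product I)" if "p \<in> I" for p
    using that by measurable
  have Wm: "(\<lambda>s. ?W s p) \<in> borel_measurable (design_product I)" if "p \<in> I" for p
    using I that by (intro weight_measurable) auto
  have int: "(LINT t|law. h t) = (LINT t|leb_on a b. h t * g t)"
  proof -
    have "h \<in> borel_measurable (leb_on a b)" using h(2) by (auto simp: measurable_cong_sets[OF sets_design_law refl])
    then have "(LINT t|law. h t) = (LINT t|leb_on a b. g t *\<^sub>R h t)"
      unfolding design_law_def using density_pos
      by (intro integral_density) (auto intro!: AE_I2 less_imp_le)
    then show ?thesis by (simp add: mult.commute)
  qed
  have summand: "(\<integral>\<^sup>+s. ennreal ((?W s p)\<^sup>2 * h (s p)) \<partial>design_product I)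
      \<le> ennreal (C / ?n\<^sup>2) * ennreal (LINT t|law. h t)" if p: "p \<in> I" for p
  proof -
    have ins: "insert p (I - {p}) = I" using p by auto
    have m: "(\<lambda>s. ennreal ((?W s p)\<^sup>2 * h (s p))) \<in> borel_measurable (design_product (insert p (I - {p})))"
      unfolding ins using Wm[OF p] hs[OF p] by simp
    have "(\<integral>\<^sup>+s. ennreal ((?W s p)\<^sup>2 * h (s p)) \<partial>design_product (insert p (I - {p})))
        = (\<integral>\<^sup>+t. (\<integral>\<^sup>+x. ennreal ((?W (x(p := t)) p)\<^sup>2 * h ((x(p := t)) p)) \<partial>design_product (I - {p})) \<partial>law)"
      using I by (intro product.product_nn_integral_insert_rev m) auto
    also have "\<dots> \<le> (\<integral>\<^sup>+t. ennreal (C / ?n\<^sup>2) * ennreal (h t) \<partial>law)"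
    proof (intro nn_integral_mono)
      fix t assume "t \<in> space law"
      then have t: "t \<in> {a..b}" by simp
      have upd: "(\<lambda>x. x(p := t)) \<in> measurable (design_product (I - {p})) (design_product I)"
        using measurable_fun_upd[of I "I - {p}" p "\<lambda>x. x" "design_product (I - {p})" "\<lambda>_. law" "\<lambda>_. t"] ins t by simp
      have "(\<integral>\<^sup>+x. ennreal ((?W (x(p := t)) p)\<^sup>2 * h ((x(p := t)) p)) \<partial>design_product (I - {p}))
          = (\<integral>\<^sup>+x. ennreal (h t / ?n\<^sup>2) * ennreal ((?n * ?W (x(p := t)) p)\<^sup>2) \<partial>design_product (I - {p}))"
        using h t I by (intro nn_integral_cong) (auto simp: power_mult_distrib simp flip: ennreal_mult)
      also have "\<dots> = ennreal (h t / ?n\<^sup>2) * (\<integral>\<^sup>+x. ennreal ((?n * ?W (x(p := t)) p)\<^sup>2) \<partial>design_product (I - {p}))"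
        using measurable_compose[OF upd Wm[OF p]] by (intro nn_integral_cmult) simp
      also have "\<dots> \<le> ennreal (h t / ?n\<^sup>2) * ennreal C"
        unfolding C_def using I p t by (intro mult_left_mono conditional_second_moment) auto
      also have "\<dots> = ennreal (C / ?n\<^sup>2) * ennreal (h t)"
        using h t C by (simp add: ac_simps flip: ennreal_mult)
      finally show "(\<integral>\<^sup>+x. ennreal ((?W (x(p := t)) p)\<^sup>2 * h ((x(p := t)) p)) \<partial>design_product (I - {p})) \<le> \<dots>" .
    qed
    also have "\<dots> = ennreal (C / ?n\<^sup>2) * (\<integral>\<^sup>+t. ennreal (h t) \<partial>law)"
      by (intro nn_integral_cmult) simp
    also have "(\<integral>\<^sup>+t. ennreal (h t) \<partial>law) = ennreal (LINT t|law. h t)"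
      using h by (intro nn_integral_eq_integral) (auto intro!: AE_I2)
    finally show ?thesis unfolding ins .
  qed
  have "(\<integral>\<^sup>+s. ennreal (\<Sum>p\<in>I. (?W s p)\<^sup>2 * h (s p)) \<partial>design_product I)
      = (\<integral>\<^sup>+s. (\<Sum>p\<in>I. ennreal ((?W s p)\<^sup>2 * h (s p))) \<partial>design_product I)"
    using h by (intro nn_integral_cong) (auto simp: space_PiM PiE_def Pi_def intro!: sum_ennreal[symmetric] mult_nonneg_nonneg)
  also have "\<dots> = (\<Sum>p\<in>I. \<integral>\<^sup>+s. ennreal ((?W s p)\<^sup>2 * h (s p)) \<partial>design_product I)"
    using Wm hs by (intro nn_integral_sum) simp
  also have "\<dots> \<le> (\<Sum>p\<in>I. ennreal (C / ?n\<^sup>2) * ennreal (LINT t|law. h t))"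
    by (intro sum_mono summand)
  also have "\<dots> = ennreal (?n * (C / ?n\<^sup>2 * (LINT t|law. h t)))"
  proof -
    have "0 \<le> (LINT t|law. h t)" using h by (intro Bochner_Integration.integral_nonneg) auto
    then show ?thesis using C by (simp add: ennreal_of_nat_eq_real_of_nat flip: ennreal_mult)
  qed
  also have "?n * (C / ?n\<^sup>2 * (LINT t|law. h t)) = C / ?n * (LINT t|leb_on a b. h t * g t)"
    using I unfolding int by (simp add: power2_eq_square)
  finally show ?thesis unfolding C_def .
qed

end

text \<open>The witness is the constant of \<open>weighted_moment\<close> with \<open>ratio\<close>
  written as a function of the two bounds of the density. Existence matters because the risk bound
  is stated for every such \<kappa> and could otherwise be vacuous.\<close>

lemma mc_moment_constant_exists: "\<exists>\<kappa>. mc_moment_constant \<kappa>"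
proof
  show "mc_moment_constant (\<lambda>x y. 3 * (1 + 2 * (4 * y / x) + 18 * (4 * y / x)\<^sup>2))"
    unfolding mc_moment_constant_def
  proof (intro allI impI)
    fix a b :: real and g :: "real \<Rightarrow> real" and n :: nat and m :: "nat \<Rightarrow> nat" and h :: "real \<Rightarrow> real"
    assume *: "a < b" "design_density a b g" "4 \<le> (\<Sum>i=1..n. m i)"
      "\<forall>t\<in>{a..b}. 0 \<le> h t" "integrable (design_law a b g) h"
    then interpret design a b g by unfold_locales
    show "(\<integral>\<^sup>+s. ennreal (\<Sum>p\<in>visits n m. (mc_weight a b g (visits n m) s p)\<^sup>2 * h (s p))
            \<partial>PiM (visits n m) (\<lambda>_. design_law a b g))
          \<le> ennreal (3 * (1 + 2 * (4 * g_max / g_min) + 18 * (4 * g_max / g_min)\<^sup>2)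
            / real (\<Sum>i=1..n. m i) * (LINT t|leb_on a b. h t * g t))"
      using weighted_moment[of "visits n m" h] * by (simp only: card_visits finite_visits)
  qed
qed

subsection \<open>Orthonormal expansions of surfaces\<close>

lemma in_L2_integrable_mult:
  assumes "in_L2 N f" "in_L2 N h"
  shows "integrable N (\<lambda>x. f x * h x)"
proof -
  have [measurable]: "f \<in> borel_measurable N" "h \<in> borel_measurable N"
    using assms by (auto simp: in_L2_def)
  have sq: "integrable N (\<lambda>x. (f x)\<^sup>2)" "integrable N (\<lambda>x. (h x)\<^sup>2)"
    using assms by (auto intro!: integrableI_nonneg simp: in_L2_def sq_norm_L2_def)
  show ?thesis
  proof (rule Bochner_Integration.integrable_bound[OF Bochner_Integration.integrable_add[OF sq]])
    show "AE x in N. norm (f x * h x) \<le> norm ((f x)\<^sup>2 + (h x)\<^sup>2)"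
    proof (intro AE_I2)
      fix x
      have "0 \<le> (\<bar>f x\<bar> - \<bar>h x\<bar>)\<^sup>2" "0 \<le> (f x)\<^sup>2 + (h x)\<^sup>2" by auto
      then have "2 * (\<bar>f x\<bar> * \<bar>h x\<bar>) \<le> (f x)\<^sup>2 + (h x)\<^sup>2"
        by (simp add: power2_diff)
      moreover have "0 \<le> \<bar>f x\<bar> * \<bar>h x\<bar>" by simp
      ultimately show "norm (f x * h x) \<le> norm ((f x)\<^sup>2 + (h x)\<^sup>2)"
        unfolding real_norm_def abs_mult by linarith
    qed
  qed simp
qed

lemma sq_norm_L2_eq_integral:
  assumes "in_L2 N f"
  shows "sq_norm_L2 N f = ennreal (LINT x|N. (f x)\<^sup>2)"
  unfolding sq_norm_L2_def
  using in_L2_integrable_mult[OF assms assms]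
  by (intro nn_integral_eq_integral) (auto simp: power2_eq_square)

text \<open>Pythagoras: completing the square around the Fourier coefficients splits the error into
  its part in the span and the squared distance of \<open>f\<close> to the span. The coefficients
  \<open>c\<close> are arbitrary because those of the estimator are random.\<close>

lemma in_L2_diff_combination:
  assumes f: "in_L2 N f" and e: "\<And>k. k \<in> A \<Longrightarrow> in_L2 N (e k)"
    and on: "\<And>j k. j \<in> A \<Longrightarrow> k \<in> A \<Longrightarrow> (LINT x|N. e j x * e k x) = (if j = k then 1 else 0)"
    and fin: "finite A"
  shows "in_L2 N (\<lambda>x. (\<Sum>k\<in>A. c k * e k x) - f x)"
    and "(LINT x|N. ((\<Sum>k\<in>A. c k * e k x) - f x)\<^sup>2)
      = (\<Sum>k\<in>A. (c k - (LINT x|N. f x * e k x))\<^sup>2)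
        + ((LINT x|N. (f x)\<^sup>2) - (\<Sum>k\<in>A. (LINT x|N. f x * e k x)\<^sup>2))"
proof -
  let ?b = "\<lambda>k. LINT x|N. f x * e k x"
  have [measurable]: "f \<in> borel_measurable N" "k \<in> A \<Longrightarrow> e k \<in> borel_measurable N" for k
    using f e by (auto simp: in_L2_def)
  have i1: "integrable N (\<lambda>x. (\<Sum>j\<in>A. \<Sum>k\<in>A. (c j * c k) * (e j x * e k x)))"
    by (intro Bochner_Integration.integrable_sum integrable_mult_right in_L2_integrable_mult e)
  have i2: "integrable N (\<lambda>x. (\<Sum>k\<in>A. (2 * c k) * (f x * e k x)))"
    by (intro Bochner_Integration.integrable_sum integrable_mult_right in_L2_integrable_mult e f)
  have i3: "integrable N (\<lambda>x. (f x)\<^sup>2)"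
    using in_L2_integrable_mult[OF f f] by (simp add: power2_eq_square)
  have expand: "((\<Sum>k\<in>A. c k * e k x) - f x)\<^sup>2
      = (\<Sum>j\<in>A. \<Sum>k\<in>A. (c j * c k) * (e j x * e k x)) - (\<Sum>k\<in>A. (2 * c k) * (f x * e k x)) + (f x)\<^sup>2" for x
  proof -
    have "(\<Sum>k\<in>A. c k * e k x) * (\<Sum>k\<in>A. c k * e k x) = (\<Sum>j\<in>A. \<Sum>k\<in>A. (c j * c k) * (e j x * e k x))"
      by (simp add: sum_product ac_simps)
    moreover have "2 * (\<Sum>k\<in>A. c k * e k x) * f x = (\<Sum>k\<in>A. (2 * c k) * (f x * e k x))"
      by (simp add: sum_distrib_left sum_distrib_right ac_simps)
    ultimately show ?thesis by (simp add: power2_diff power2_eq_square[of "sum _ _"])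
  qed
  have int: "integrable N (\<lambda>x. ((\<Sum>k\<in>A. c k * e k x) - f x)\<^sup>2)"
    unfolding expand using i1 i2 i3 by simp
  then show "in_L2 N (\<lambda>x. (\<Sum>k\<in>A. c k * e k x) - f x)"
    unfolding in_L2_def sq_norm_L2_def
    by (auto simp: nn_integral_eq_integral)
  have "(LINT x|N. ((\<Sum>k\<in>A. c k * e k x) - f x)\<^sup>2)
      = (\<Sum>j\<in>A. \<Sum>k\<in>A. (c j * c k) * (LINT x|N. e j x * e k x)) - (\<Sum>k\<in>A. (2 * c k) * ?b k)
        + (LINT x|N. (f x)\<^sup>2)"
  proof -
    have ee: "integrable N (\<lambda>x. e j x * e k x)" if "j \<in> A" "k \<in> A" for j k
      using that by (intro in_L2_integrable_mult e)
    have fe: "integrable N (\<lambda>x. f x * e k x)" if "k \<in> A" for k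
      using that by (intro in_L2_integrable_mult e f)
    have "(LINT x|N. (\<Sum>j\<in>A. \<Sum>k\<in>A. (c j * c k) * (e j x * e k x)))
        = (\<Sum>j\<in>A. \<Sum>k\<in>A. (c j * c k) * (LINT x|N. e j x * e k x))"
      by (simp add: Bochner_Integration.integral_sum Bochner_Integration.integrable_sum ee)
    moreover have "(LINT x|N. (\<Sum>k\<in>A. (2 * c k) * (f x * e k x))) = (\<Sum>k\<in>A. (2 * c k) * ?b k)"
      by (simp add: Bochner_Integration.integral_sum Bochner_Integration.integrable_sum fe)
    ultimately show ?thesis
      unfolding expand using i1 i2 i3 by simp
  qed
  also have "(\<Sum>j\<in>A. \<Sum>k\<in>A. (c j * c k) * (LINT x|N. e j x * e k x)) = (\<Sum>j\<in>A. (c j)\<^sup>2)"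
  proof (intro sum.cong refl)
    fix j assume "j \<in> A"
    then have "(\<Sum>k\<in>A. (c j * c k) * (LINT x|N. e j x * e k x)) = (\<Sum>k\<in>A. if j = k then c j * c k else 0)"
      using on by (intro sum.cong) auto
    then show "(\<Sum>k\<in>A. (c j * c k) * (LINT x|N. e j x * e k x)) = (c j)\<^sup>2"
      using fin \<open>j \<in> A\<close> by (simp add: power2_eq_square)
  qed
  finally show "(LINT x|N. ((\<Sum>k\<in>A. c k * e k x) - f x)\<^sup>2)
      = (\<Sum>k\<in>A. (c k - ?b k)\<^sup>2) + ((LINT x|N. (f x)\<^sup>2) - (\<Sum>k\<in>A. (?b k)\<^sup>2))"
    by (simp add: power2_diff sum.distrib sum_subtractf ac_simps)
qed

text \<open>The coefficients \<open>c\<close> affect only the first \<open>K\<close> directions.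
  With \<open>c = \<beta>\<close> the preceding decomposition identifies the remainder after
  \<open>K\<close> terms, and completeness of the basis sends it to 0 as \<open>K\<close> grows,
  which is Parseval's identity.\<close>

lemma sq_norm_basis_expansion_error:
  assumes basis: "orthonormal_basis_L2 N \<phi>" and f: "in_L2 N f"
  defines "\<beta> \<equiv> \<lambda>k. LINT t|N. f t * \<phi> k t"
  shows "sq_norm_L2 N (\<lambda>t. (\<Sum>k=1..K. c k * \<phi> k t) - f t)
    = (\<Sum>k=1..K. ennreal ((c k - \<beta> k)\<^sup>2)) + (\<Sum>k. ennreal ((\<beta> (Suc (k + K)))\<^sup>2))"
proof -
  have L2: "in_L2 N (\<lambda>t. (\<Sum>k=1..K. c k * \<phi> k t) - f t)"
    and eq: "(LINT t|N. ((\<Sum>k=1..K. c k * \<phi> k t) - f t)\<^sup>2)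
      = (\<Sum>k=1..K. (c k - \<beta> k)\<^sup>2) + ((LINT t|N. (f t)\<^sup>2) - (\<Sum>k=1..K. (\<beta> k)\<^sup>2))" for c :: "nat \<Rightarrow> real" and K
    using in_L2_diff_combination[OF f, of "{1..K}" \<phi> c] basis
    by (auto simp: orthonormal_basis_L2_def \<beta>_def)
  have "(\<lambda>K. sq_norm_L2 N (\<lambda>t. f t - (\<Sum>k=1..K. \<beta> k * \<phi> k t))) \<longlonglongrightarrow> 0"
    using basis f unfolding orthonormal_basis_L2_def \<beta>_def by blast
  moreover have "sq_norm_L2 N (\<lambda>t. f t - (\<Sum>k=1..K. \<beta> k * \<phi> k t))
      = ennreal ((LINT t|N. (f t)\<^sup>2) - (\<Sum>k=1..K. (\<beta> k)\<^sup>2))" for K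
    using sq_norm_L2_eq_integral[OF L2[of \<beta> K]] eq[of \<beta> K]
    by (simp add: sq_norm_L2_def power2_commute)
  ultimately have lim: "(\<lambda>K. ennreal ((LINT t|N. (f t)\<^sup>2) - (\<Sum>k=1..K. (\<beta> k)\<^sup>2))) \<longlonglongrightarrow> ennreal 0"
    by simp
  \<comment> \<open>Bessel's inequality. It is needed before the limit can be taken back to the
    reals: \<open>ennreal\<close> sends negative numbers to 0, so a limit 0 in [0, \<infinity>]
    alone would say nothing about them.\<close>
  have nonneg: "0 \<le> (LINT t|N. (f t)\<^sup>2) - (\<Sum>k=1..K. (\<beta> k)\<^sup>2)" for K
  proof -
    have "(\<Sum>k=1..K. (\<beta> k - \<beta> k)\<^sup>2) = 0" by simp
    moreover have "0 \<le> (LINT t|N. ((\<Sum>k=1..K. \<beta> k * \<phi> k t) - f t)\<^sup>2)"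
      by (intro Bochner_Integration.integral_nonneg) simp
    ultimately show ?thesis using eq[of \<beta> K] by linarith
  qed
  have "(\<lambda>K. (LINT t|N. (f t)\<^sup>2) - (\<Sum>k=1..K. (\<beta> k)\<^sup>2)) \<longlonglongrightarrow> 0"
    using lim nonneg by (subst (asm) tendsto_ennreal_iff) auto
  from tendsto_diff[OF tendsto_const[of "LINT t|N. (f t)\<^sup>2"] this]
  have "(\<lambda>K. \<Sum>k=1..K. (\<beta> k)\<^sup>2) \<longlonglongrightarrow> (LINT t|N. (f t)\<^sup>2)" by simp
  moreover have shift: "(\<Sum>k=1..K. (\<beta> k)\<^sup>2) = (\<Sum>k<K. (\<beta> (Suc k))\<^sup>2)" for K
    by (simp add: sum.atLeast1_atMost_eq)
  ultimately have sums: "(\<lambda>k. (\<beta> (Suc k))\<^sup>2) sums (LINT t|N. (f t)\<^sup>2)" by (simp add: sums_def)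
  \<comment> \<open>The basis starts at index 1, so the terms after the first \<open>K\<close> are
    those with index \<open>Suc (k + K)\<close>.\<close>
  then have "(\<lambda>k. (\<beta> (Suc (k + K)))\<^sup>2) sums ((LINT t|N. (f t)\<^sup>2) - (\<Sum>k=1..K. (\<beta> k)\<^sup>2))"
    unfolding shift using sums_iff_shift[of "\<lambda>k. (\<beta> (Suc k))\<^sup>2" K] by simp
  then have "(\<Sum>k. ennreal ((\<beta> (Suc (k + K)))\<^sup>2)) = ennreal ((LINT t|N. (f t)\<^sup>2) - (\<Sum>k=1..K. (\<beta> k)\<^sup>2))"
    by (intro suminf_ennreal_eq) auto
  then show ?thesis
    unfolding sq_norm_L2_eq_integral[OF L2] eq using nonneg
    by (simp add: ennreal_plus sum_nonneg sum_ennreal)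
qed

text \<open>With \<open>t\<close> as inner variable the one-variable identity applies at every
  \<open>u\<close>. The series does not involve \<open>b\<close>, so it stays deterministic when the
  \<open>b k\<close> are random.\<close>

lemma sq_norm_L2_surface_error:
  assumes basis: "orthonormal_basis_L2 N \<phi>" and N: "sigma_finite_measure N"
    and meas: "(\<lambda>(u, t). \<mu> u t) \<in> borel_measurable (\<nu> \<Otimes>\<^sub>M N)"
    and L2: "\<And>u. u \<in> space \<nu> \<Longrightarrow> in_L2 N (\<mu> u)"
    and b: "\<And>k. k \<in> {1..K} \<Longrightarrow> b k \<in> borel_measurable \<nu>"
  defines "\<beta> \<equiv> \<lambda>k u. LINT t|N. \<mu> u t * \<phi> k t"
  shows "sq_norm_L2 (\<nu> \<Otimes>\<^sub>M N) (\<lambda>(u, t). (\<Sum>k=1..K. b k u * \<phi> k t) - \<mu> u t)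
    = (\<Sum>k=1..K. sq_norm_L2 \<nu> (\<lambda>u. b k u - \<beta> k u)) + (\<Sum>k. sq_norm_L2 \<nu> (\<beta> (Suc (k + K))))"
proof -
  interpret N: sigma_finite_measure N by fact
  note [measurable] = meas b
  have \<phi>: "\<phi> k \<in> borel_measurable N" if "1 \<le> k" for k
    using basis that by (auto simp: orthonormal_basis_L2_def in_L2_def)
  have \<beta>: "\<beta> k \<in> borel_measurable \<nu>" if "1 \<le> k" for k
    unfolding \<beta>_def using \<phi>[OF that] meas
    by (intro N.borel_measurable_lebesgue_integral) (simp add: split_beta')
  have m1: "(\<lambda>u. ennreal ((b k u - \<beta> k u)\<^sup>2)) \<in> borel_measurable \<nu>" if "k \<in> {1..K}" for k
    using b[OF that] \<beta>[of k] that by simp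
  have m2: "(\<lambda>u. ennreal ((\<beta> (Suc k) u)\<^sup>2)) \<in> borel_measurable \<nu>" for k
    using \<beta>[of "Suc k"] by simp
  have m: "(\<lambda>z. ennreal (((\<Sum>k=1..K. b k (fst z) * \<phi> k (snd z)) - \<mu> (fst z) (snd z))\<^sup>2)) \<in> borel_measurable (\<nu> \<Otimes>\<^sub>M N)"
    using meas
    by (intro measurable_compose[OF _ measurable_ennreal] borel_measurable_power borel_measurable_diff
        borel_measurable_sum borel_measurable_times measurable_compose[OF measurable_fst b]
        measurable_compose[OF measurable_snd \<phi>]) (auto simp: split_beta')
  have "sq_norm_L2 (\<nu> \<Otimes>\<^sub>M N) (\<lambda>(u, t). (\<Sum>k=1..K. b k u * \<phi> k t) - \<mu> u t)
      = (\<integral>\<^sup>+u. sq_norm_L2 N (\<lambda>t. (\<Sum>k=1..K. b k u * \<phi> k t) - \<mu> u t) \<partial>\<nu>)"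
    unfolding sq_norm_L2_def using m by (subst N.nn_integral_fst[symmetric]) (auto simp: split_beta')
  also have "\<dots> = (\<integral>\<^sup>+u. (\<Sum>k=1..K. ennreal ((b k u - \<beta> k u)\<^sup>2)) + (\<Sum>k. ennreal ((\<beta> (Suc (k + K)) u)\<^sup>2)) \<partial>\<nu>)"
    unfolding \<beta>_def by (intro nn_integral_cong sq_norm_basis_expansion_error basis L2)
  also have "\<dots> = (\<integral>\<^sup>+u. (\<Sum>k=1..K. ennreal ((b k u - \<beta> k u)\<^sup>2)) \<partial>\<nu>) + (\<integral>\<^sup>+u. (\<Sum>k. ennreal ((\<beta> (Suc (k + K)) u)\<^sup>2)) \<partial>\<nu>)"
    by (intro nn_integral_add borel_measurable_sum borel_measurable_suminf_order m1 m2)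
  also have "(\<integral>\<^sup>+u. (\<Sum>k=1..K. ennreal ((b k u - \<beta> k u)\<^sup>2)) \<partial>\<nu>) = (\<Sum>k=1..K. sq_norm_L2 \<nu> (\<lambda>u. b k u - \<beta> k u))"
    unfolding sq_norm_L2_def by (intro nn_integral_sum m1)
  also have "(\<integral>\<^sup>+u. (\<Sum>k. ennreal ((\<beta> (Suc (k + K)) u)\<^sup>2)) \<partial>\<nu>) = (\<Sum>k. sq_norm_L2 \<nu> (\<beta> (Suc (k + K))))"
    unfolding sq_norm_L2_def by (intro nn_integral_suminf m2)
  finally show ?thesis .
qed

text \<open>Every index in the tail exceeds \<open>K\<close>, so its weight is at least
  \<open>real K powr (2 * s)\<close>, which can be taken out of the series and moved to the other
  side as an inverse power.\<close>

lemma suminf_tail_le: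
  fixes f :: "nat \<Rightarrow> ennreal"
  assumes "(\<Sum>k. ennreal (real (Suc k) powr (2 * s)) * f (Suc k)) \<le> ennreal C"
    and "0 < s" "1 \<le> K" "0 \<le> C"
  shows "(\<Sum>k. f (Suc (k + K))) \<le> ennreal (C * real K powr (- 2 * s))"
proof -
  have K: "0 < real K powr (2 * s)" using assms by simp
  have "ennreal (real K powr (2 * s)) * (\<Sum>k. f (Suc (k + K)))
      = (\<Sum>k. ennreal (real K powr (2 * s)) * f (Suc (k + K)))" by simp
  also have "\<dots> \<le> (\<Sum>k. ennreal (real (Suc (k + K)) powr (2 * s)) * f (Suc (k + K)))"
    using assms by (intro suminf_le mult_right_mono ennreal_leI powr_mono2) auto
  also have "\<dots> \<le> (\<Sum>k. ennreal (real (Suc k) powr (2 * s)) * f (Suc k))"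
    using suminf_offset[of "\<lambda>k. ennreal (real (Suc k) powr (2 * s)) * f (Suc k)" K] by simp
  also have "\<dots> \<le> ennreal C" by fact
  finally have le: "ennreal (real K powr (2 * s)) * (\<Sum>k. f (Suc (k + K))) \<le> ennreal C" .
  have "(\<Sum>k. f (Suc (k + K))) = ennreal (real K powr (- 2 * s)) * (ennreal (real K powr (2 * s)) * (\<Sum>k. f (Suc (k + K))))"
    using K by (simp add: mult.assoc[symmetric] powr_minus flip: ennreal_mult)
  also have "\<dots> \<le> ennreal (real K powr (- 2 * s)) * ennreal C"
    by (intro mult_left_mono le) auto
  also have "\<dots> = ennreal (C * real K powr (- 2 * s))"
    using assms by (simp add: ennreal_mult mult.commute)
  finally show ?thesis .
qed

subsection \<open>Independence and second moments\<close>

text \<open>Square integrability is not needed: an infinite second moment makes the right-hand side infinite.\<close>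

lemma (in prob_space) second_moment_pairwise_indep:
  fixes Z :: "'i \<Rightarrow> 'a \<Rightarrow> real"
  assumes fin: "finite R"
    and int: "\<And>r. r \<in> R \<Longrightarrow> integrable M (Z r)"
    and centred: "\<And>r. r \<in> R \<Longrightarrow> expectation (Z r) = 0"
    and indep: "\<And>r r'. r \<in> R \<Longrightarrow> r' \<in> R \<Longrightarrow> r \<noteq> r' \<Longrightarrow> indep_var borel (Z r) borel (Z r')"
  shows "(\<integral>\<^sup>+\<omega>. ennreal ((b + (\<Sum>r\<in>R. Z r \<omega>))\<^sup>2) \<partial>M) \<le> ennreal (b\<^sup>2) + (\<Sum>r\<in>R. \<integral>\<^sup>+\<omega>. ennreal ((Z r \<omega>)\<^sup>2) \<partial>M)"
proof (cases "\<exists>r\<in>R. (\<integral>\<^sup>+\<omega>. ennreal ((Z r \<omega>)\<^sup>2) \<partial>M) = \<infinity>")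
  case True
  then have "(\<Sum>r\<in>R. \<integral>\<^sup>+\<omega>. ennreal ((Z r \<omega>)\<^sup>2) \<partial>M) = \<infinity>"
    using fin by (auto simp: sum.remove)
  then show ?thesis by simp
next
  case False
  have [measurable]: "r \<in> R \<Longrightarrow> Z r \<in> borel_measurable M" for r using int by auto
  have sq: "integrable M (\<lambda>\<omega>. Z r \<omega> * Z r \<omega>)" if "r \<in> R" for r
    using False that unfolding power2_eq_square[symmetric]
    by (intro integrableI_nonneg) (auto simp: less_top)
  have cross: "integrable M (\<lambda>\<omega>. Z r \<omega> * Z r' \<omega>)"
    "expectation (\<lambda>\<omega>. Z r \<omega> * Z r' \<omega>) = (if r = r' then expectation (\<lambda>\<omega>. Z r \<omega> * Z r \<omega>) else 0)"
    if "r \<in> R" "r' \<in> R" for r r'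
    using that sq indep_var_integrable[OF indep int int] indep_var_lebesgue_integral[OF indep int int] centred
    by (cases "r = r'"; simp)+
  have expand: "(b + (\<Sum>r\<in>R. Z r \<omega>))\<^sup>2 = b\<^sup>2 + (2 * b * (\<Sum>r\<in>R. Z r \<omega>) + (\<Sum>r\<in>R. \<Sum>r'\<in>R. Z r \<omega> * Z r' \<omega>))" for \<omega>
    by (simp add: power2_sum power2_eq_square[of "sum _ _"] sum_product)
  have ints: "integrable M (\<lambda>\<omega>. 2 * b * (\<Sum>r\<in>R. Z r \<omega>))"
    "integrable M (\<lambda>\<omega>. \<Sum>r\<in>R. \<Sum>r'\<in>R. Z r \<omega> * Z r' \<omega>)"
    using int cross by (auto intro!: Bochner_Integration.integrable_sum integrable_mult_right)
  have int_sq: "integrable M (\<lambda>\<omega>. (b + (\<Sum>r\<in>R. Z r \<omega>))\<^sup>2)"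
    unfolding expand by (intro Bochner_Integration.integrable_add ints integrable_const)
  have "expectation (\<lambda>\<omega>. \<Sum>r\<in>R. Z r \<omega>) = 0"
    using int centred by (simp add: Bochner_Integration.integral_sum)
  then have e1: "expectation (\<lambda>\<omega>. 2 * b * (\<Sum>r\<in>R. Z r \<omega>)) = 0"
    by (simp only: integral_mult_right_zero mult_zero_right)
  have "expectation (\<lambda>\<omega>. \<Sum>r\<in>R. \<Sum>r'\<in>R. Z r \<omega> * Z r' \<omega>)
      = (\<Sum>r\<in>R. \<Sum>r'\<in>R. expectation (\<lambda>\<omega>. Z r \<omega> * Z r' \<omega>))"
    using cross(1) by (simp add: Bochner_Integration.integral_sum Bochner_Integration.integrable_sum)
  also have "\<dots> = (\<Sum>r\<in>R. \<Sum>r'\<in>R. if r = r' then expectation (\<lambda>\<omega>. Z r \<omega> * Z r \<omega>) else 0)"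
    by (intro sum.cong refl cross(2))
  finally have e2: "expectation (\<lambda>\<omega>. \<Sum>r\<in>R. \<Sum>r'\<in>R. Z r \<omega> * Z r' \<omega>) = \<dots>" .
  have "(\<integral>\<^sup>+\<omega>. ennreal ((b + (\<Sum>r\<in>R. Z r \<omega>))\<^sup>2) \<partial>M) = ennreal (expectation (\<lambda>\<omega>. (b + (\<Sum>r\<in>R. Z r \<omega>))\<^sup>2))"
    by (intro nn_integral_eq_integral int_sq) simp
  also have "expectation (\<lambda>\<omega>. (b + (\<Sum>r\<in>R. Z r \<omega>))\<^sup>2)
      = b\<^sup>2 + (\<Sum>r\<in>R. \<Sum>r'\<in>R. if r = r' then expectation (\<lambda>\<omega>. Z r \<omega> * Z r \<omega>) else 0)"
  proof -
    have "expectation (\<lambda>\<omega>. b\<^sup>2 + (2 * b * (\<Sum>r\<in>R. Z r \<omega>) + (\<Sum>r\<in>R. \<Sum>r'\<in>R. Z r \<omega> * Z r' \<omega>)))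
        = expectation (\<lambda>\<omega>. b\<^sup>2) + (expectation (\<lambda>\<omega>. 2 * b * (\<Sum>r\<in>R. Z r \<omega>))
          + expectation (\<lambda>\<omega>. \<Sum>r\<in>R. \<Sum>r'\<in>R. Z r \<omega> * Z r' \<omega>))"
      using ints by (subst Bochner_Integration.integral_add) (auto intro: Bochner_Integration.integrable_add)
    then show ?thesis
      unfolding expand e1 e2 by (simp add: prob_space)
  qed
  also have "\<dots> = b\<^sup>2 + (\<Sum>r\<in>R. expectation (\<lambda>\<omega>. (Z r \<omega>)\<^sup>2))"
    using fin by (simp add: power2_eq_square)
  also have "ennreal \<dots> = ennreal (b\<^sup>2) + (\<Sum>r\<in>R. ennreal (expectation (\<lambda>\<omega>. (Z r \<omega>)\<^sup>2)))"
    by (simp add: ennreal_plus sum_nonneg sum_ennreal)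
  also have "(\<Sum>r\<in>R. ennreal (expectation (\<lambda>\<omega>. (Z r \<omega>)\<^sup>2))) = (\<Sum>r\<in>R. \<integral>\<^sup>+\<omega>. ennreal ((Z r \<omega>)\<^sup>2) \<partial>M)"
    using sq by (intro sum.cong refl nn_integral_eq_integral[symmetric]) (auto simp: power2_eq_square)
  finally show ?thesis by simp
qed

section \<open>Generated sigma-fields, grouping of independent sources, and conditioning\<close>

lemma space_family_algebra [simp]: "space (family_algebra P N Z I) = space P"
  by (auto simp: family_algebra_def space_measure_of_conv)

lemma measurable_family_algebra:
  assumes "i \<in> I" "Z i \<in> measurable P N"
  shows "Z i \<in> measurable (family_algebra P N Z I) N"
proof (rule measurableI)
  fix A assume "A \<in> sets N"
  then have "Z i -` A \<inter> space P \<in> (\<Union>i\<in>I. {Z i -` A \<inter> space P |A. A \<in> sets N})"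
    using assms by blast
  then show "Z i -` A \<inter> space (family_algebra P N Z I) \<in> sets (family_algebra P N Z I)"
    unfolding family_algebra_def by (subst sets_measure_of) (auto simp: space_measure_of_conv)
qed (use assms measurable_space in auto)

lemma measurable_restrict_family_algebra:
  assumes "\<And>i. i \<in> I \<Longrightarrow> Z i \<in> measurable P N"
  shows "(\<lambda>\<omega>. \<lambda>i\<in>I. Z i \<omega>) \<in> measurable (family_algebra P N Z I) (PiM I (\<lambda>_. N))"
  using assms by (intro measurable_restrict measurable_family_algebra)

lemma (in prob_space) indep_var_from_subalgebras:
  assumes indep: "indep_set (sets A) (sets B)" and "space A = space M" "space B = space M"
    and "f \<in> measurable A S" "h \<in> measurable B S'"
  shows "indep_var S f S' h"
proof -
  have sub: "sets A \<subseteq> sets M" "sets B \<subseteq> sets M" using indep by (auto simp: indep_sets2_eq)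
  have f: "random_variable S f" "random_variable S' h"
    using assms sub by (auto simp: measurable_def)
  have "sigma_sets (space M) {f -` X \<inter> space M |X. X \<in> sets S} \<subseteq> sets A"
    using sets.sigma_sets_subset[of "{f -` X \<inter> space M |X. X \<in> sets S}" A] assms(2,4)
    by (fastforce dest: measurable_sets)
  moreover have "sigma_sets (space M) {h -` X \<inter> space M |X. X \<in> sets S'} \<subseteq> sets B"
    using sets.sigma_sets_subset[of "{h -` X \<inter> space M |X. X \<in> sets S'}" B] assms(3,5)
    by (fastforce dest: measurable_sets)
  ultimately have "indep_set (sigma_sets (space M) {f -` X \<inter> space M |X. X \<in> sets S})
      (sigma_sets (space M) {h -` X \<inter> space M |X. X \<in> sets S'})"
    using indep unfolding indep_sets2_eq by (meson subset_iff order_trans)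
  with f show ?thesis unfolding indep_var_eq by simp
qed

text \<open>The design is to be frozen against all other randomness at once, so the last two
  sigma-fields are merged; grouping is legitimate because sigma-fields are stable under
  intersections. Independence of these two from each other is kept for the second moments at a
  frozen design.\<close>

lemma (in prob_space) indep_sets_three:
  assumes "indep_sets ((!) [sets A, sets B, sets C]) {..<3}"
    and "space A = space M" "space B = space M" "space C = space M"
  shows "indep_set (sets B) (sets C)"
    and "indep_set (sets A) (sets (sigma (space M) (sets B \<union> sets C)))"
proof -
  have E: "(!) [sets A, sets B, sets C] 0 = sets A" "(!) [sets A, sets B, sets C] 1 = sets B"
    "(!) [sets A, sets B, sets C] (Suc 0) = sets B" "(!) [sets A, sets B, sets C] 2 = sets C"
    by (simp_all add: numeral_2_eq_2)
  let ?E = "(!) [sets A, sets B, sets C]"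
  have sub: "sets A \<subseteq> events" "sets B \<subseteq> events" "sets C \<subseteq> events"
  proof -
    have "?E i \<subseteq> events" if "i < 3" for i using assms(1) that by (auto simp: indep_sets_def)
    from this[of 0] this[of 1] this[of 2] show "sets A \<subseteq> events" "sets B \<subseteq> events" "sets C \<subseteq> events"
      by (simp_all add: E)
  qed
  show "indep_set (sets B) (sets C)"
    unfolding indep_sets2_eq
  proof (intro conjI ballI sub)
    fix x y assume "x \<in> sets B" "y \<in> sets C"
    then have "prob (\<Inter>j\<in>{1,2::nat}. if j = 1 then x else y) = (\<Prod>j\<in>{1,2::nat}. prob (if j = 1 then x else y))"
      using E by (intro indep_setsD[OF assms(1)]) auto
    then show "prob (x \<inter> y) = prob x * prob y" by (simp add: Int_commute)
  qed
  \<comment> \<open>A partition of the three positions into the first one and the other two, indexed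
    by booleans to match \<open>indep_set\<close>.\<close>
  define I where "I = case_bool {0} {1, 2::nat}"
  have I: "I True = {0}" "I False = {1, 2}" by (simp_all add: I_def)
  have union: "(\<Union>j\<in>UNIV. I j) = {..<3}" unfolding UNIV_bool by (auto simp: I)
  have ind: "indep_sets (\<lambda>j. sigma_sets (space M) (\<Union>i\<in>I j. ?E i)) UNIV"
  proof (rule indep_sets_collect_sigma)
    show "indep_sets ?E (\<Union>j\<in>UNIV. I j)" unfolding union by (rule assms(1))
    show "disjoint_family_on I UNIV" by (simp add: disjoint_family_on_def I UNIV_bool)
    fix j i assume "i \<in> I j"
    then have "i = 0 \<or> i = 1 \<or> i = 2" by (cases j) (auto simp: I)
    then have "\<exists>N. ?E i = sets N" using E by metis
    then show "Int_stable (?E i)" by (metis sets.Int_stable)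
  qed
  have BC: "sets B \<union> sets C \<subseteq> Pow (space M)" using sub sets.space_closed by blast
  have gA: "sigma_sets (space M) (\<Union>i\<in>I True. ?E i) = sets A"
    using sets.sigma_sets_eq[of A] assms(2) by (simp add: I)
  have gBC: "sigma_sets (space M) (\<Union>i\<in>I False. ?E i) = sets (sigma (space M) (sets B \<union> sets C))"
    using BC by (simp add: I E)
  have "sigma_sets (space M) (\<Union>i\<in>I j. ?E i)
      = case_bool (sets A) (sets (sigma (space M) (sets B \<union> sets C))) j" for j
    by (cases j) (simp_all only: bool.case gA gBC)
  then have "(\<lambda>j. sigma_sets (space M) (\<Union>i\<in>I j. ?E i))
      = case_bool (sets A) (sets (sigma (space M) (sets B \<union> sets C)))"
    by (rule ext)
  with ind show "indep_set (sets A) (sets (sigma (space M) (sets B \<union> sets C)))"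
    by (simp only: indep_set_def)
qed

lemma (in prob_space) indep_vars_imp_indep_var:
  assumes "indep_vars N X J" "i \<in> J" "j \<in> J" "i \<noteq> j"
  shows "indep_var (N i) (X i) (N j) (X j)"
proof -
  have "indep_var (PiM {i} N) (\<lambda>\<omega>. restrict (\<lambda>i. X i \<omega>) {i}) (PiM {j} N) (\<lambda>\<omega>. restrict (\<lambda>i. X i \<omega>) {j})"
    using assms by (intro indep_var_restrict[OF assms(1)]) auto
  from indep_var_compose[OF this measurable_component_singleton[of i] measurable_component_singleton[of j]]
  show ?thesis by (simp add: comp_def)
qed

lemma (in prob_space) indep_set_sym:
  assumes "indep_set A B"
  shows "indep_set B A"
proof -
  have "prob (y \<inter> x) = prob y * prob x" if "y \<in> B" "x \<in> A" for x y
    using assms that unfolding indep_sets2_eq by (subst Int_commute, subst mult.commute) blast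
  then show ?thesis using assms unfolding indep_sets2_eq by blast
qed

lemma (in prob_space) indep_var_sym: "indep_var S X T Y \<Longrightarrow> indep_var T Y S X"
  unfolding indep_var_eq using indep_set_sym by simp

text \<open>Conditioning on \<open>X\<close> without conditional expectations: independence makes
  the joint law a product, and Tonelli's theorem freezes \<open>X\<close> at \<open>x\<close> while
  \<open>Y\<close> stays random on the original space.\<close>

lemma (in prob_space) nn_integral_independent_pair:
  assumes indep: "indep_set (sets A) (sets B)" and space: "space A = space M" "space B = space M"
    and X: "X \<in> measurable A S" and Y: "Y \<in> measurable B T"
    and f: "f \<in> borel_measurable (S \<Otimes>\<^sub>M T)"
  shows "(\<integral>\<^sup>+\<omega>. f (X \<omega>, Y \<omega>) \<partial>M) = (\<integral>\<^sup>+x. (\<integral>\<^sup>+\<omega>. f (x, Y \<omega>) \<partial>M) \<partial>distr M S X)"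
proof -
  have sub: "sets A \<subseteq> events" "sets B \<subseteq> events" using indep by (auto simp: indep_sets2_eq)
  have X': "random_variable S X" and Y': "random_variable T Y"
    using X Y sub space by (auto simp: measurable_def)
  interpret X: prob_space "distr M S X" by (rule prob_space_distr[OF X'])
  interpret Y: prob_space "distr M T Y" by (rule prob_space_distr[OF Y'])
  have pair: "random_variable (S \<Otimes>\<^sub>M T) (\<lambda>\<omega>. (X \<omega>, Y \<omega>))" by (intro measurable_Pair X' Y')
  have joint: "distr M S X \<Otimes>\<^sub>M distr M T Y = distr M (S \<Otimes>\<^sub>M T) (\<lambda>\<omega>. (X \<omega>, Y \<omega>))"
  proof (rule pair_measure_eqI)
    show "sigma_finite_measure (distr M S X)" "sigma_finite_measure (distr M T Y)" by unfold_locales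
    show "sets (distr M S X \<Otimes>\<^sub>M distr M T Y) = sets (distr M (S \<Otimes>\<^sub>M T) (\<lambda>\<omega>. (X \<omega>, Y \<omega>)))"
      by (simp cong: sets_pair_measure_cong)
    fix C D assume "C \<in> sets (distr M S X)" "D \<in> sets (distr M T Y)"
    then have CD: "C \<in> sets S" "D \<in> sets T" by simp_all
    have "X -` C \<inter> space M \<in> sets A" "Y -` D \<inter> space M \<in> sets B"
      using measurable_sets[OF X CD(1)] measurable_sets[OF Y CD(2)] space by simp_all
    then have "prob ((X -` C \<inter> space M) \<inter> (Y -` D \<inter> space M)) = prob (X -` C \<inter> space M) * prob (Y -` D \<inter> space M)"
      using indep unfolding indep_sets2_eq by blast
    moreover have "(X -` C \<inter> space M) \<inter> (Y -` D \<inter> space M) = (\<lambda>\<omega>. (X \<omega>, Y \<omega>)) -` (C \<times> D) \<inter> space M"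
      by auto
    ultimately show "emeasure (distr M S X) C * emeasure (distr M T Y) D
        = emeasure (distr M (S \<Otimes>\<^sub>M T) (\<lambda>\<omega>. (X \<omega>, Y \<omega>))) (C \<times> D)"
      using CD X' Y' pair by (simp add: emeasure_distr emeasure_eq_measure ennreal_mult)
  qed
  have f': "f \<in> borel_measurable (distr M S X \<Otimes>\<^sub>M distr M T Y)"
    using f by (simp add: joint)
  have "(\<integral>\<^sup>+\<omega>. f (X \<omega>, Y \<omega>) \<partial>M) = (\<integral>\<^sup>+z. f z \<partial>distr M (S \<Otimes>\<^sub>M T) (\<lambda>\<omega>. (X \<omega>, Y \<omega>)))"
    using f pair by (intro nn_integral_distr[symmetric]) auto
  also have "\<dots> = (\<integral>\<^sup>+x. (\<integral>\<^sup>+y. f (x, y) \<partial>distr M T Y) \<partial>distr M S X)"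
    unfolding joint[symmetric] by (rule Y.nn_integral_fst[OF f', symmetric])
  also have "\<dots> = (\<integral>\<^sup>+x. (\<integral>\<^sup>+\<omega>. f (x, Y \<omega>) \<partial>M) \<partial>distr M S X)"
    using Y' measurable_Pair2[OF f] by (intro nn_integral_cong nn_integral_distr) auto
  finally show ?thesis .
qed

text \<open>Connects the iterated Bochner integral in \<open>cov_trace\<close> with an integral in
  [0, \<infinity>]. Finiteness is what rules out default values of the former.\<close>

lemma nn_integral_square_eq_integral:
  assumes "sigma_finite_measure N" "sigma_finite_measure N'"
    and f: "f \<in> borel_measurable (N \<Otimes>\<^sub>M N')"
    and fin: "(\<integral>\<^sup>+x. (\<integral>\<^sup>+y. ennreal ((f (x, y))\<^sup>2) \<partial>N') \<partial>N) < \<infinity>"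
  shows "(\<integral>\<^sup>+x. (\<integral>\<^sup>+y. ennreal ((f (x, y))\<^sup>2) \<partial>N') \<partial>N) = ennreal (LINT x|N. (LINT y|N'. f (x, y) * f (x, y)))"
proof -
  interpret N: sigma_finite_measure N by fact
  interpret N': sigma_finite_measure N' by fact
  interpret pair_sigma_finite N N' ..
  have eq: "(\<integral>\<^sup>+x. (\<integral>\<^sup>+y. ennreal ((f (x, y))\<^sup>2) \<partial>N') \<partial>N) = (\<integral>\<^sup>+z. ennreal ((f z)\<^sup>2) \<partial>(N \<Otimes>\<^sub>M N'))"
    using f by (intro N'.nn_integral_fst) simp
  have int: "integrable (N \<Otimes>\<^sub>M N') (\<lambda>z. (f z)\<^sup>2)"
    using f fin unfolding eq by (intro integrableI_nonneg) auto
  have "(\<integral>\<^sup>+z. ennreal ((f z)\<^sup>2) \<partial>(N \<Otimes>\<^sub>M N')) = ennreal (LINT z|(N \<Otimes>\<^sub>M N'). (f z)\<^sup>2)"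
    using int by (intro nn_integral_eq_integral) auto
  also have "(LINT z|(N \<Otimes>\<^sub>M N'). (f z)\<^sup>2) = (LINT x|N. (LINT y|N'. (f (x, y))\<^sup>2))"
    by (rule integral_fst'[OF int, symmetric])
  finally show ?thesis unfolding eq by (simp add: power2_eq_square)
qed

section \<open>Second moment of the observation error at a frozen design\<close>

lemma sum_visits: "(\<Sum>p\<in>visits n m. f p) = (\<Sum>i=1..n. \<Sum>j=1..m i. f (i, j))"
  unfolding visits_def by (subst sum.Sigma) auto

text \<open>The functionals \<open>x p\<close> and \<open>e p\<close> stand for evaluation of the
  fields at fixed arguments. Visits of one subject share the same field and are dependent, so they
  are collected in \<open>A i\<close> before independence is used; the summands are then indexed by
  the disjoint sum of subjects and visits.\<close>

lemma (in prob_space) conditional_observation_moment: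
  fixes Xs :: "nat \<Rightarrow> 'a \<Rightarrow> 'x" and \<eta> :: "nat \<times> nat \<Rightarrow> 'a \<Rightarrow> 'e"
    and x :: "nat \<times> nat \<Rightarrow> 'x \<Rightarrow> real" and e :: "nat \<times> nat \<Rightarrow> 'e \<Rightarrow> real"
  assumes X_indep: "\<And>i j. i \<in> {1..n} \<Longrightarrow> j \<in> {1..n} \<Longrightarrow> i \<noteq> j \<Longrightarrow> indep_var \<X> (Xs i) \<X> (Xs j)"
    and eta_indep: "\<And>p q. p \<in> visits n m \<Longrightarrow> q \<in> visits n m \<Longrightarrow> p \<noteq> q \<Longrightarrow> indep_var \<E> (\<eta> p) \<E> (\<eta> q)"
    and X_eta: "\<And>i p f h. i \<in> {1..n} \<Longrightarrow> p \<in> visits n m \<Longrightarrow>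
      f \<in> borel_measurable \<X> \<Longrightarrow> h \<in> borel_measurable \<E> \<Longrightarrow>
      indep_var borel (\<lambda>\<omega>. f (Xs i \<omega>) :: real) borel (\<lambda>\<omega>. h (\<eta> p \<omega>) :: real)"
    and x: "\<And>p. p \<in> visits n m \<Longrightarrow> x p \<in> borel_measurable \<X>"
    and e: "\<And>p. p \<in> visits n m \<Longrightarrow> e p \<in> borel_measurable \<E>"
    and X_int: "\<And>p. p \<in> visits n m \<Longrightarrow> integrable M (\<lambda>\<omega>. x p (Xs (fst p) \<omega>))"
    and X_0: "\<And>p. p \<in> visits n m \<Longrightarrow> expectation (\<lambda>\<omega>. x p (Xs (fst p) \<omega>)) = 0"
    and eta_int: "\<And>p. p \<in> visits n m \<Longrightarrow> integrable M (\<lambda>\<omega>. e p (\<eta> p \<omega>))"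
    and eta_0: "\<And>p. p \<in> visits n m \<Longrightarrow> expectation (\<lambda>\<omega>. e p (\<eta> p \<omega>)) = 0"
  shows "(\<integral>\<^sup>+\<omega>. ennreal ((b + (\<Sum>p\<in>visits n m. c p * x p (Xs (fst p) \<omega>)) + (\<Sum>p\<in>visits n m. d p * e p (\<eta> p \<omega>)))\<^sup>2) \<partial>M)
    \<le> ennreal (b\<^sup>2) + (\<Sum>p\<in>visits n m. ennreal (real (m (fst p)) * (c p)\<^sup>2) * (\<integral>\<^sup>+\<omega>. ennreal ((x p (Xs (fst p) \<omega>))\<^sup>2) \<partial>M))
      + (\<Sum>p\<in>visits n m. ennreal ((d p)\<^sup>2) * (\<integral>\<^sup>+\<omega>. ennreal ((e p (\<eta> p \<omega>))\<^sup>2) \<partial>M))"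
proof -
  define A where "A i y = (\<Sum>j=1..m i. c (i, j) * x (i, j) y)" for i y
  define B where "B p y = d p * e p y" for p y
  define Z where "Z = case_sum (\<lambda>i \<omega>. A i (Xs i \<omega>)) (\<lambda>p \<omega>. B p (\<eta> p \<omega>))"
  let ?R = "{1..n} <+> visits n m"
  have visit: "(i, j) \<in> visits n m" if "i \<in> {1..n}" "j \<in> {1..m i}" for i j
    using that by (auto simp: visits_def)
  have A: "A i \<in> borel_measurable \<X>" if "i \<in> {1..n}" for i
    unfolding A_def using x visit that by (intro borel_measurable_sum borel_measurable_times) auto
  have B: "B p \<in> borel_measurable \<E>" if "p \<in> visits n m" for p
    unfolding B_def using e that by (intro borel_measurable_times) auto
  have sumA: "(\<Sum>i=1..n. A i (Xs i \<omega>)) = (\<Sum>p\<in>visits n m. c p * x p (Xs (fst p) \<omega>))" for \<omega>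
    unfolding sum_visits A_def by simp
  have sumZ: "(\<Sum>r\<in>?R. Z r \<omega>) = (\<Sum>p\<in>visits n m. c p * x p (Xs (fst p) \<omega>)) + (\<Sum>p\<in>visits n m. d p * e p (\<eta> p \<omega>))" for \<omega>
    by (subst sum.Plus) (auto simp: Z_def B_def simp flip: sumA)
  have SX:  "(\<Sum>i=1..n. \<integral>\<^sup>+\<omega>. ennreal ((A i (Xs i \<omega>))\<^sup>2) \<partial>M)
      \<le> (\<Sum>p\<in>visits n m. ennreal (real (m (fst p)) * (c p)\<^sup>2) * (\<integral>\<^sup>+\<omega>. ennreal ((x p (Xs (fst p) \<omega>))\<^sup>2) \<partial>M))"
    unfolding sum_visits
  proof (intro sum_mono)
    fix i assume i: "i \<in> {1..n}"
    have meas: "(\<lambda>\<omega>. x (i, j) (Xs i \<omega>)) \<in> borel_measurable M" if "j \<in> {1..m i}" for j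
      using borel_measurable_integrable[OF X_int[OF visit[OF i that]]] by simp
    have "(\<integral>\<^sup>+\<omega>. ennreal ((A i (Xs i \<omega>))\<^sup>2) \<partial>M)
        \<le> (\<integral>\<^sup>+\<omega>. (\<Sum>j=1..m i. ennreal (real (m i) * (c (i, j))\<^sup>2) * ennreal ((x (i, j) (Xs i \<omega>))\<^sup>2)) \<partial>M)"
    proof (intro nn_integral_mono)
      fix \<omega>
      \<comment> \<open>Cauchy-Schwarz over the visits of one subject; this is the origin of the
        factor \<open>m i\<close>.\<close>
      have "(A i (Xs i \<omega>))\<^sup>2 \<le> (\<Sum>j=1..m i. real (m i) * (c (i, j))\<^sup>2 * (x (i, j) (Xs i \<omega>))\<^sup>2)"
        using sum_squared_le_sum_of_squares[of "\<lambda>j. c (i, j) * x (i, j) (Xs i \<omega>)" "{1..m i}"]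
        by (simp add: A_def sum_distrib_left power_mult_distrib mult.commute mult.left_commute)
      then show "ennreal ((A i (Xs i \<omega>))\<^sup>2) \<le> (\<Sum>j=1..m i. ennreal (real (m i) * (c (i, j))\<^sup>2) * ennreal ((x (i, j) (Xs i \<omega>))\<^sup>2))"
        by (simp add: sum_ennreal ennreal_leI flip: ennreal_mult)
    qed
    also have "\<dots> = (\<Sum>j=1..m i. ennreal (real (m i) * (c (i, j))\<^sup>2) * (\<integral>\<^sup>+\<omega>. ennreal ((x (i, j) (Xs i \<omega>))\<^sup>2) \<partial>M))"
    proof -
      have m2: "(\<lambda>\<omega>. ennreal ((x (i, j) (Xs i \<omega>))\<^sup>2)) \<in> borel_measurable M" if "j \<in> {1..m i}" for j
        using meas[OF that] by simp
      show ?thesis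
        by (subst nn_integral_sum) (auto intro!: sum.cong nn_integral_cmult m2 borel_measurable_times_ennreal)
    qed
    finally show "(\<integral>\<^sup>+\<omega>. ennreal ((A i (Xs i \<omega>))\<^sup>2) \<partial>M)
        \<le> (\<Sum>j=1..m i. ennreal (real (m (fst (i, j))) * (c (i, j))\<^sup>2) * (\<integral>\<^sup>+\<omega>. ennreal ((x (i, j) (Xs (fst (i, j)) \<omega>))\<^sup>2) \<partial>M))"
      by simp
  qed
  have "(\<integral>\<^sup>+\<omega>. ennreal ((b + (\<Sum>r\<in>?R. Z r \<omega>))\<^sup>2) \<partial>M) \<le> ennreal (b\<^sup>2) + (\<Sum>r\<in>?R. \<integral>\<^sup>+\<omega>. ennreal ((Z r \<omega>)\<^sup>2) \<partial>M)"
  proof (rule second_moment_pairwise_indep)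
    show "finite ?R" by simp
    have iA: "integrable M (\<lambda>\<omega>. A i (Xs i \<omega>)) \<and> expectation (\<lambda>\<omega>. A i (Xs i \<omega>)) = 0" if "i \<in> {1..n}" for i
    proof -
      have *: "integrable M (\<lambda>\<omega>. x (i, j) (Xs i \<omega>))" "expectation (\<lambda>\<omega>. x (i, j) (Xs i \<omega>)) = 0" if "j \<in> {1..m i}" for j
        using X_int[OF visit[OF \<open>i \<in> {1..n}\<close> that]] X_0[OF visit[OF \<open>i \<in> {1..n}\<close> that]] by auto
      show ?thesis
      proof
        show "integrable M (\<lambda>\<omega>. A i (Xs i \<omega>))"
          unfolding A_def by (intro Bochner_Integration.integrable_sum integrable_mult_right *)
        have "expectation (\<lambda>\<omega>. A i (Xs i \<omega>)) = (\<Sum>j=1..m i. expectation (\<lambda>\<omega>. c (i, j) * x (i, j) (Xs i \<omega>)))"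
          unfolding A_def by (intro Bochner_Integration.integral_sum integrable_mult_right *)
        then show "expectation (\<lambda>\<omega>. A i (Xs i \<omega>)) = 0" using *(2) by simp
      qed
    qed
    have iB: "integrable M (\<lambda>\<omega>. B p (\<eta> p \<omega>)) \<and> expectation (\<lambda>\<omega>. B p (\<eta> p \<omega>)) = 0" if "p \<in> visits n m" for p
      unfolding B_def using eta_int[OF that] eta_0[OF that] by simp
    show "integrable M (Z r)" "expectation (Z r) = 0" if "r \<in> ?R" for r
      using that iA iB by (auto simp: Z_def)
    have AA: "indep_var borel (\<lambda>\<omega>. A i (Xs i \<omega>)) borel (\<lambda>\<omega>. A j (Xs j \<omega>))"
      if "i \<in> {1..n}" "j \<in> {1..n}" "i \<noteq> j" for i j
      using indep_var_compose[OF X_indep[OF that] A[OF that(1)] A[OF that(2)]] by (simp add: comp_def)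
    have BB: "indep_var borel (\<lambda>\<omega>. B p (\<eta> p \<omega>)) borel (\<lambda>\<omega>. B q (\<eta> q \<omega>))"
      if "p \<in> visits n m" "q \<in> visits n m" "p \<noteq> q" for p q
      using indep_var_compose[OF eta_indep[OF that] B[OF that(1)] B[OF that(2)]] by (simp add: comp_def)
    have AB: "indep_var borel (\<lambda>\<omega>. A i (Xs i \<omega>)) borel (\<lambda>\<omega>. B p (\<eta> p \<omega>))"
      "indep_var borel (\<lambda>\<omega>. B p (\<eta> p \<omega>)) borel (\<lambda>\<omega>. A i (Xs i \<omega>))"
      if "i \<in> {1..n}" "p \<in> visits n m" for i p
    proof -
      show *: "indep_var borel (\<lambda>\<omega>. A i (Xs i \<omega>)) borel (\<lambda>\<omega>. B p (\<eta> p \<omega>))"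
        by (intro X_eta A B that)
      show "indep_var borel (\<lambda>\<omega>. B p (\<eta> p \<omega>)) borel (\<lambda>\<omega>. A i (Xs i \<omega>))"
        by (rule indep_var_sym[OF *])
    qed
    show "indep_var borel (Z r) borel (Z r')" if "r \<in> ?R" "r' \<in> ?R" "r \<noteq> r'" for r r'
      using that by (cases r; cases r') (auto simp: Z_def intro: AA BB AB)
  qed
  also have "(\<Sum>r\<in>?R. \<integral>\<^sup>+\<omega>. ennreal ((Z r \<omega>)\<^sup>2) \<partial>M)
      = (\<Sum>i=1..n. \<integral>\<^sup>+\<omega>. ennreal ((A i (Xs i \<omega>))\<^sup>2) \<partial>M) + (\<Sum>p\<in>visits n m. \<integral>\<^sup>+\<omega>. ennreal ((B p (\<eta> p \<omega>))\<^sup>2) \<partial>M)"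
    by (subst sum.Plus) (auto simp: Z_def)
  also have "(\<Sum>p\<in>visits n m. \<integral>\<^sup>+\<omega>. ennreal ((B p (\<eta> p \<omega>))\<^sup>2) \<partial>M)
      = (\<Sum>p\<in>visits n m. ennreal ((d p)\<^sup>2) * (\<integral>\<^sup>+\<omega>. ennreal ((e p (\<eta> p \<omega>))\<^sup>2) \<partial>M))"
    using eta_int unfolding B_def
    by (intro sum.cong refl) (simp add: power_mult_distrib ennreal_mult nn_integral_cmult borel_measurable_integrable)
  finally have le: "(\<integral>\<^sup>+\<omega>. ennreal ((b + (\<Sum>r\<in>?R. Z r \<omega>))\<^sup>2) \<partial>M)
      \<le> ennreal (b\<^sup>2) + ((\<Sum>i=1..n. \<integral>\<^sup>+\<omega>. ennreal ((A i (Xs i \<omega>))\<^sup>2) \<partial>M)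
        + (\<Sum>p\<in>visits n m. ennreal ((d p)\<^sup>2) * (\<integral>\<^sup>+\<omega>. ennreal ((e p (\<eta> p \<omega>))\<^sup>2) \<partial>M)))" .
  show ?thesis
    using order_trans[OF le add_left_mono[OF add_right_mono[OF SX]]]
    unfolding sumZ by (simp only: add.assoc)
qed

subsection \<open>The sampling model\<close>

locale sampling_model = design a b g for a b :: real and g :: "real \<Rightarrow> real" +
  fixes \<nu> :: "'u measure" and P :: "'w measure"
    and n m_max :: nat and m :: "nat \<Rightarrow> nat"
    and T :: "nat \<times> nat \<Rightarrow> 'w \<Rightarrow> real"
    and \<X> :: "('u \<Rightarrow> real \<Rightarrow> real) measure"
    and X :: "'w \<Rightarrow> 'u \<Rightarrow> real \<Rightarrow> real" and Xs :: "nat \<Rightarrow> 'w \<Rightarrow> 'u \<Rightarrow> real \<Rightarrow> real"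
    and \<E> :: "('u \<Rightarrow> real) measure" and \<eta> :: "nat \<times> nat \<Rightarrow> 'w \<Rightarrow> 'u \<Rightarrow> real"
    and \<tau> :: "real \<Rightarrow> real" and \<mu> :: "'u \<Rightarrow> real \<Rightarrow> real"
  assumes nu: "finite_measure \<nu>" "space \<nu> = UNIV"
    and prob: "prob_space P"
    and visits: "\<forall>i\<in>{1..n}. 1 \<le> m i \<and> m i \<le> m_max"
    and sample_size: "4 \<le> (\<Sum>i=1..n. m i)"
    and mu_meas: "(\<lambda>(u, t). \<mu> u t) \<in> borel_measurable (\<nu> \<Otimes>\<^sub>M leb_on a b)"
    and X_space: "surface_space a b \<nu> \<X>"
    and X_meas: "X \<in> measurable P \<X>"
    and X_copies: "\<forall>i\<in>{1..n}. Xs i \<in> measurable P \<X> \<and> distr P \<X> (Xs i) = distr P \<X> X"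
    and X_indep: "prob_space.indep_vars P (\<lambda>_. \<X>) Xs {1..n}"
    and X_moment: "(\<integral>\<^sup>+\<omega>. sq_norm_L2 (\<nu> \<Otimes>\<^sub>M leb_on a b) (\<lambda>(u, t). X \<omega> u t) \<partial>P) < \<infinity>"
    and X_centred: "\<forall>u. \<forall>t\<in>{a..b}. integrable P (\<lambda>\<omega>. X \<omega> u t) \<and> (LINT \<omega>|P. X \<omega> u t) = 0"
    and T_law: "\<forall>p\<in>visits n m. distributed P (leb_on a b) (T p) (\<lambda>t. ennreal (g t))"
    and T_indep: "prob_space.indep_vars P (\<lambda>_. leb_on a b) T (visits n m)"
    and tau: "\<tau> \<in> borel_measurable (leb_on a b)" "\<forall>t\<in>{a..b}. 0 \<le> \<tau> t" "bdd_above (\<tau> ` {a..b})"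
    and eta_space: "curve_space \<nu> \<E>"
    and eta_meas: "\<forall>p\<in>visits n m. \<eta> p \<in> measurable P \<E>"
    and eta_indep: "prob_space.indep_vars P (\<lambda>_. \<E>) \<eta> (visits n m)"
    and eta_centred: "\<forall>p\<in>visits n m. \<forall>u. integrable P (\<lambda>\<omega>. \<eta> p \<omega> u) \<and> (LINT \<omega>|P. \<eta> p \<omega> u) = 0"
    and eta_var: "\<forall>p\<in>visits n m. \<forall>u. integrable P (\<lambda>\<omega>. (\<eta> p \<omega> u)\<^sup>2) \<and>
                    prob_space.variance P (\<lambda>\<omega>. \<eta> p \<omega> u) = 1"
    and mutual_indep: "prob_space.indep_sets P
        ((!) [sets (family_algebra P (leb_on a b) T (visits n m)),
              sets (family_algebra P \<X> Xs {1..n}),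
              sets (family_algebra P \<E> \<eta> (visits n m))]) {..<3}"
    and Gamma: "continuous_on ({a..b} \<times> {a..b}) (\<lambda>(t, t'). cov_trace P \<nu> X t t')"
begin

abbreviation "I \<equiv> visits n m"
abbreviation "L \<equiv> leb_on a b"
abbreviation "T_algebra \<equiv> family_algebra P L T I"
abbreviation "X_algebra \<equiv> family_algebra P \<X> Xs {1..n}"
abbreviation "eta_algebra \<equiv> family_algebra P \<E> \<eta> I"
abbreviation "Gamma_max \<equiv> SUP (t, t')\<in>{a..b} \<times> {a..b}. \<bar>cov_trace P \<nu> X t t'\<bar>"
abbreviation "tau_max \<equiv> SUP t\<in>{a..b}. \<bar>\<tau> t\<bar>"

sublocale P: prob_space P by (rule prob)
sublocale \<nu>: finite_measure \<nu> by (rule nu)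

lemma card_I: "card I = (\<Sum>i=1..n. m i)" "4 \<le> card I"
  using card_visits sample_size by auto

lemma nonempty_I: "I \<noteq> {}"
  using card_I(2) by auto

lemma fst_visit: "p \<in> I \<Longrightarrow> fst p \<in> {1..n}"
  by (auto simp: visits_def)

lemma T_measurable: "p \<in> I \<Longrightarrow> T p \<in> measurable P L"
  using T_law distributed_measurable by blast

lemma T_range: "p \<in> I \<Longrightarrow> \<omega> \<in> space P \<Longrightarrow> T p \<omega> \<in> {a..b}"
  using measurable_space[OF T_measurable] by simp

lemma distr_T: "p \<in> I \<Longrightarrow> distr P L (T p) = law"
  using T_law distributed_distr_eq_density unfolding design_law_def by blast

definition design_points :: "'w \<Rightarrow> nat \<times> nat \<Rightarrow> real" where
  "design_points \<omega> = (\<lambda>p\<in>I. T p \<omega>)"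

text \<open>The observation noise apart from the design, packed into one random element so that a
  single application of \<open>nn_integral_independent_pair\<close> freezes the design.\<close>

definition noise_sources :: "'w \<Rightarrow> (nat \<Rightarrow> 'u \<Rightarrow> real \<Rightarrow> real) \<times> (nat \<times> nat \<Rightarrow> 'u \<Rightarrow> real)" where
  "noise_sources \<omega> = (\<lambda>i\<in>{1..n}. Xs i \<omega>, \<lambda>p\<in>I. \<eta> p \<omega>)"

abbreviation "point_space \<equiv> PiM I (\<lambda>_. L)"
abbreviation "noise_space \<equiv> PiM {1..n} (\<lambda>_. \<X>) \<Otimes>\<^sub>M PiM I (\<lambda>_. \<E>)"

lemma design_points_apply: "p \<in> I \<Longrightarrow> design_points \<omega> p = T p \<omega>"
  by (simp add: design_points_def)

text \<open>Links the sample space to the coordinate space on which the moment constant is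
  formulated.\<close>

lemma design_points_law: "distr P point_space design_points = design_product I"
proof -
  have "distr P point_space (\<lambda>\<omega>. \<lambda>p\<in>I. T p \<omega>) = PiM I (\<lambda>p. distr P L (T p))"
    using P.indep_vars_iff_distr_eq_PiM'[where I = I and M' = "\<lambda>_. L" and X = T] nonempty_I T_measurable T_indep by simp
  also have "\<dots> = design_product I" by (intro PiM_cong distr_T refl)
  finally show ?thesis by (simp add: design_points_def[abs_def])
qed

lemma design_points_measurable_T: "design_points \<in> measurable T_algebra point_space"
  unfolding design_points_def[abs_def] by (intro measurable_restrict_family_algebra T_measurable)

lemma design_points_measurable: "design_points \<in> measurable P point_space"
  unfolding design_points_def[abs_def] by (intro measurable_restrict T_measurable)

lemma
  shows indep_X_eta: "P.indep_set (sets X_algebra) (sets eta_algebra)"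
    and indep_T_noise: "P.indep_set (sets T_algebra) (sets (sigma (space P) (sets X_algebra \<union> sets eta_algebra)))"
  using P.indep_sets_three[OF mutual_indep] by auto

lemma sets_noise_algebra:
  "sets X_algebra \<subseteq> sets (sigma (space P) (sets X_algebra \<union> sets eta_algebra))"
  "sets eta_algebra \<subseteq> sets (sigma (space P) (sets X_algebra \<union> sets eta_algebra))"
proof -
  have "sets X_algebra \<union> sets eta_algebra \<subseteq> Pow (space P)"
    using sets.space_closed[of X_algebra] sets.space_closed[of eta_algebra] by simp
  then show "sets X_algebra \<subseteq> sets (sigma (space P) (sets X_algebra \<union> sets eta_algebra))"
    "sets eta_algebra \<subseteq> sets (sigma (space P) (sets X_algebra \<union> sets eta_algebra))"
    by (auto simp: sets_measure_of)
qed

lemma noise_sources_measurable: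
  "noise_sources \<in> measurable (sigma (space P) (sets X_algebra \<union> sets eta_algebra)) noise_space"
proof -
  let ?B = "sigma (space P) (sets X_algebra \<union> sets eta_algebra)"
  have sp: "space ?B = space P" by (simp add: space_measure_of_conv)
  have mono: "f \<in> measurable A S \<Longrightarrow> sets A \<subseteq> sets ?B \<Longrightarrow> space A = space P \<Longrightarrow> f \<in> measurable ?B S"
    for f :: "'w \<Rightarrow> 'x" and A S
    using sp by (auto simp: measurable_def)
  show ?thesis
    unfolding noise_sources_def[abs_def]
    by (intro measurable_Pair mono[OF measurable_restrict_family_algebra[of "{1..n}" Xs P \<X>]]
        mono[OF measurable_restrict_family_algebra[of I \<eta> P \<E>]])
      (use X_copies eta_meas sets_noise_algebra in auto)
qed

lemma noise_sources_measurable_P: "noise_sources \<in> measurable P noise_space"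
  unfolding noise_sources_def[abs_def]
  using X_copies eta_meas by (intro measurable_Pair measurable_restrict) auto

section \<open>Moments of the fields at fixed arguments, and bounds by the suprema\<close>

lemma surface_eval: "t \<in> {a..b} \<Longrightarrow> (\<lambda>x. x u t) \<in> borel_measurable \<X>"
proof -
  assume "t \<in> {a..b}"
  then have "(\<lambda>x. (x, (u, t))) \<in> measurable \<X> (\<X> \<Otimes>\<^sub>M (\<nu> \<Otimes>\<^sub>M L))"
    using nu by (intro measurable_Pair measurable_ident_sets refl measurable_const) (auto simp: space_pair_measure)
  from measurable_compose[OF this X_space[unfolded surface_space_def]] show ?thesis by simp
qed

lemma curve_eval: "(\<lambda>e. e u) \<in> borel_measurable \<E>"
proof -
  have "(\<lambda>x. (x, u)) \<in> measurable \<E> (\<E> \<Otimes>\<^sub>M \<nu>)"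
    using nu by (intro measurable_Pair measurable_ident_sets refl measurable_const) auto
  from measurable_compose[OF this eta_space[unfolded curve_space_def]] show ?thesis by simp
qed

lemma Xs_centred:
  assumes "i \<in> {1..n}" "t \<in> {a..b}"
  shows "integrable P (\<lambda>\<omega>. Xs i \<omega> u t)" "P.expectation (\<lambda>\<omega>. Xs i \<omega> u t) = 0"
proof -
  note ev = surface_eval[OF assms(2), of u]
  have copy: "Xs i \<in> measurable P \<X>" "distr P \<X> (Xs i) = distr P \<X> X" using X_copies assms by auto
  have c: "integrable P (\<lambda>\<omega>. X \<omega> u t)" "(LINT \<omega>|P. X \<omega> u t) = 0" using X_centred assms by auto
  show "integrable P (\<lambda>\<omega>. Xs i \<omega> u t)"
    using c(1) integrable_distr_eq[OF copy(1) ev] integrable_distr_eq[OF X_meas ev] copy(2) by simp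
  show "P.expectation (\<lambda>\<omega>. Xs i \<omega> u t) = 0"
    using c(2) integral_distr[OF copy(1) ev] integral_distr[OF X_meas ev] copy(2) by simp
qed

lemma Xs_second_moment:
  assumes "i \<in> {1..n}" "t \<in> {a..b}"
  shows "(\<integral>\<^sup>+\<omega>. ennreal ((Xs i \<omega> u t)\<^sup>2) \<partial>P) = (\<integral>\<^sup>+\<omega>. ennreal ((X \<omega> u t)\<^sup>2) \<partial>P)"
proof -
  have ev: "(\<lambda>x. ennreal ((x u t)\<^sup>2)) \<in> borel_measurable \<X>"
    using surface_eval[OF assms(2), of u] by simp
  have copy: "Xs i \<in> measurable P \<X>" "distr P \<X> (Xs i) = distr P \<X> X" using X_copies assms by auto
  show ?thesis
    using nn_integral_distr[OF copy(1), of "\<lambda>x. ennreal ((x u t)\<^sup>2)"]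
      nn_integral_distr[OF X_meas, of "\<lambda>x. ennreal ((x u t)\<^sup>2)"] ev copy(2) by simp
qed

lemma eta_second_moment:
  assumes "p \<in> I"
  shows "(\<integral>\<^sup>+\<omega>. ennreal ((\<eta> p \<omega> u)\<^sup>2) \<partial>P) = 1"
proof -
  have "integrable P (\<lambda>\<omega>. (\<eta> p \<omega> u)\<^sup>2)" "P.expectation (\<lambda>\<omega>. (\<eta> p \<omega> u)\<^sup>2) = 1"
    using eta_var eta_centred assms by auto
  then show ?thesis by (subst nn_integral_eq_integral) auto
qed

lemma X_joint_measurable: "(\<lambda>z. X (fst z) (fst (snd z)) (snd (snd z))) \<in> borel_measurable (P \<Otimes>\<^sub>M (\<nu> \<Otimes>\<^sub>M L))"
proof -
  have "(\<lambda>z. (X (fst z), snd z)) \<in> measurable (P \<Otimes>\<^sub>M (\<nu> \<Otimes>\<^sub>M L)) (\<X> \<Otimes>\<^sub>M (\<nu> \<Otimes>\<^sub>M L))"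
    by (intro measurable_Pair measurable_compose[OF measurable_fst X_meas] measurable_snd)
  from measurable_compose[OF this X_space[unfolded surface_space_def]] show ?thesis
    by (simp add: split_beta')
qed

lemma bdd_Gamma: "bdd_above ((\<lambda>(t, t'). \<bar>cov_trace P \<nu> X t t'\<bar>) ` ({a..b} \<times> {a..b}))"
proof -
  have "continuous_on ({a..b} \<times> {a..b}) (\<lambda>z. \<bar>case z of (t, t') \<Rightarrow> cov_trace P \<nu> X t t'\<bar>)"
    by (intro continuous_on_rabs Gamma)
  then have "bounded ((\<lambda>z. \<bar>case z of (t, t') \<Rightarrow> cov_trace P \<nu> X t t'\<bar>) ` ({a..b} \<times> {a..b}))"
    by (intro compact_imp_bounded compact_continuous_image compact_Times) auto
  then show ?thesis by (auto intro: bounded_imp_bdd_above simp: split_beta')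
qed

lemma le_Gamma_max: "t \<in> {a..b} \<Longrightarrow> t' \<in> {a..b} \<Longrightarrow> \<bar>cov_trace P \<nu> X t t'\<bar> \<le> Gamma_max"
  using cSUP_upper[OF _ bdd_Gamma, of "(t, t')"] by simp

lemma Gamma_max_nonneg: "0 \<le> Gamma_max"
  using le_Gamma_max[of a a] less by (meson abs_ge_zero atLeastAtMost_iff order_refl order_trans less_imp_le)

lemma le_tau_max: "t \<in> {a..b} \<Longrightarrow> \<tau> t \<le> tau_max"
proof -
  have "(\<lambda>t. \<bar>\<tau> t\<bar>) ` {a..b} = \<tau> ` {a..b}" using tau(2) by (intro image_cong) auto
  then have "bdd_above ((\<lambda>t. \<bar>\<tau> t\<bar>) ` {a..b})" using tau(3) by simp
  then show "t \<in> {a..b} \<Longrightarrow> \<tau> t \<le> tau_max"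
    using tau(2) cSUP_upper[of t "{a..b}" "\<lambda>t. \<bar>\<tau> t\<bar>"] by auto
qed

text \<open>The exceptional null set of times matters: there \<open>cov_trace\<close> may be the junk value of a
  non-existing integral, although \<open>\<Gamma>\<^sub>X\<close> is bounded everywhere.\<close>

lemma surface_energy_bound:
  "AE t in law. (\<integral>\<^sup>+u. (\<integral>\<^sup>+\<omega>. ennreal ((X \<omega> u t)\<^sup>2) \<partial>P) \<partial>\<nu>) \<le> ennreal Gamma_max"
proof -
  interpret finL: finite_measure L by (rule finite_measure_leb_on)
  interpret \<nu>L: pair_sigma_finite \<nu> L ..
  interpret P\<nu>: pair_sigma_finite P \<nu> ..
  interpret S: sigma_finite_measure "\<nu> \<Otimes>\<^sub>M L" by (rule \<nu>L.sigma_finite_measure_axioms)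
  interpret PS: pair_sigma_finite P "\<nu> \<Otimes>\<^sub>M L" ..
  have sq: "(\<lambda>z. ennreal ((X (fst z) (fst (snd z)) (snd (snd z)))\<^sup>2)) \<in> borel_measurable (P \<Otimes>\<^sub>M (\<nu> \<Otimes>\<^sub>M L))"
    using X_joint_measurable by simp
  have sq_ut: "(\<lambda>z. (\<integral>\<^sup>+\<omega>. ennreal ((X \<omega> (fst z) (snd z))\<^sup>2) \<partial>P)) \<in> borel_measurable (\<nu> \<Otimes>\<^sub>M L)"
    using measurable_compose[OF measurable_pair_swap' sq]
    by (intro P.borel_measurable_nn_integral) (simp add: split_beta')
  have "(\<integral>\<^sup>+\<omega>. sq_norm_L2 (\<nu> \<Otimes>\<^sub>M L) (\<lambda>(u, t). X \<omega> u t) \<partial>P)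
      = (\<integral>\<^sup>+z. (\<integral>\<^sup>+\<omega>. ennreal ((X \<omega> (fst z) (snd z))\<^sup>2) \<partial>P) \<partial>(\<nu> \<Otimes>\<^sub>M L))"
    unfolding sq_norm_L2_def split_beta' using sq by (intro PS.Fubini'[symmetric]) (simp add: split_beta')
  also have "\<dots> = (\<integral>\<^sup>+t. (\<integral>\<^sup>+u. (\<integral>\<^sup>+\<omega>. ennreal ((X \<omega> u t)\<^sup>2) \<partial>P) \<partial>\<nu>) \<partial>L)"
    using \<nu>L.nn_integral_snd[OF sq_ut] by simp
  finally have fin: "(\<integral>\<^sup>+t. (\<integral>\<^sup>+u. (\<integral>\<^sup>+\<omega>. ennreal ((X \<omega> u t)\<^sup>2) \<partial>P) \<partial>\<nu>) \<partial>L) \<noteq> \<infinity>"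
    using X_moment by auto
  have "(\<lambda>t. (\<integral>\<^sup>+u. (\<integral>\<^sup>+\<omega>. ennreal ((X \<omega> u t)\<^sup>2) \<partial>P) \<partial>\<nu>)) \<in> borel_measurable L"
    using measurable_compose[OF measurable_pair_swap' sq_ut]
    by (intro \<nu>.borel_measurable_nn_integral) (simp add: split_beta')
  from nn_integral_PInf_AE[OF this fin]
  have "AE t in L. (\<integral>\<^sup>+u. (\<integral>\<^sup>+\<omega>. ennreal ((X \<omega> u t)\<^sup>2) \<partial>P) \<partial>\<nu>) \<noteq> \<infinity>" .
  then have "AE t in L. (\<integral>\<^sup>+u. (\<integral>\<^sup>+\<omega>. ennreal ((X \<omega> u t)\<^sup>2) \<partial>P) \<partial>\<nu>) \<le> ennreal Gamma_max"
  proof (rule AE_mp[OF _ AE_I2], intro impI)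
    fix t assume "t \<in> space L" and finite: "(\<integral>\<^sup>+u. (\<integral>\<^sup>+\<omega>. ennreal ((X \<omega> u t)\<^sup>2) \<partial>P) \<partial>\<nu>) \<noteq> \<infinity>"
    then have t: "t \<in> {a..b}" by simp
    have "(\<lambda>z. (fst z, (snd z, t))) \<in> measurable (P \<Otimes>\<^sub>M \<nu>) (P \<Otimes>\<^sub>M (\<nu> \<Otimes>\<^sub>M L))"
      using t by (intro measurable_Pair measurable_fst measurable_snd measurable_const) auto
    from measurable_compose[OF this X_joint_measurable]
    have m: "(\<lambda>z. X (fst z) (snd z) t) \<in> borel_measurable (P \<Otimes>\<^sub>M \<nu>)" by simp
    have swap: "(\<integral>\<^sup>+u. (\<integral>\<^sup>+\<omega>. ennreal ((X \<omega> u t)\<^sup>2) \<partial>P) \<partial>\<nu>) = (\<integral>\<^sup>+\<omega>. (\<integral>\<^sup>+u. ennreal ((X \<omega> u t)\<^sup>2) \<partial>\<nu>) \<partial>P)"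
      using m by (intro P\<nu>.Fubini') (simp add: split_beta')
    have "(\<integral>\<^sup>+\<omega>. (\<integral>\<^sup>+u. ennreal ((X \<omega> u t)\<^sup>2) \<partial>\<nu>) \<partial>P) = ennreal (cov_trace P \<nu> X t t)"
      using nn_integral_square_eq_integral[OF P.sigma_finite_measure_axioms \<nu>.sigma_finite_measure_axioms m] finite
      unfolding swap cov_trace_def by (simp add: less_top)
    also have "\<dots> \<le> ennreal Gamma_max"
      using le_Gamma_max[OF t t] by (intro ennreal_leI) simp
    finally show "(\<integral>\<^sup>+u. (\<integral>\<^sup>+\<omega>. ennreal ((X \<omega> u t)\<^sup>2) \<partial>P) \<partial>\<nu>) \<le> ennreal Gamma_max"
      unfolding swap .
  qed
  then show ?thesis
    unfolding design_law_def by (subst AE_density) auto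
qed

section \<open>The error of one estimated coefficient as a function of design and noise\<close>

definition reg_weight :: "(real \<Rightarrow> real) \<Rightarrow> (nat \<times> nat \<Rightarrow> real) \<Rightarrow> nat \<times> nat \<Rightarrow> real" where
  "reg_weight f s p = mc_weight a b g I s p * f (s p) / g (s p)"

lemma reg_weight_design_points:
  "p \<in> I \<Longrightarrow> reg_weight f (design_points \<omega>) p = mc_weights a b g I T p \<omega> * f (T p \<omega>) / g (T p \<omega>)"
  using mc_weight_cong[of I "design_points \<omega>" "\<lambda>q. T q \<omega>" a b g p]
  by (simp add: reg_weight_def mc_weights_def design_points_apply)

text \<open>A function of a realised design \<open>s\<close> and realised noise \<open>y\<close>
  instead of the sample point, so that \<open>s\<close> can be frozen while \<open>y\<close> remains
  random. For frozen \<open>s\<close> the factors \<open>reg_weight f s p\<close>,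
  \<open>\<mu> u (s p)\<close> and \<open>\<tau> (s p)\<close> are constants.\<close>

definition coef_error ::
    "(real \<Rightarrow> real) \<Rightarrow> ('u \<Rightarrow> real) \<Rightarrow> 'u \<Rightarrow> (nat \<times> nat \<Rightarrow> real)
      \<Rightarrow> (nat \<Rightarrow> 'u \<Rightarrow> real \<Rightarrow> real) \<times> (nat \<times> nat \<Rightarrow> 'u \<Rightarrow> real) \<Rightarrow> real" where
  "coef_error f \<beta> u s y = ((\<Sum>p\<in>I. reg_weight f s p * \<mu> u (s p)) - \<beta> u)
     + (\<Sum>p\<in>I. reg_weight f s p * fst y (fst p) u (s p))
     + (\<Sum>p\<in>I. (reg_weight f s p * \<tau> (s p)) * snd y p u)"

lemma coef_error_eq:
  "(\<Sum>p\<in>I. mc_weights a b g I T p \<omega> * obs \<mu> Xs \<tau> \<eta> T p \<omega> u * f (T p \<omega>) / g (T p \<omega>)) - \<beta> u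
    = coef_error f \<beta> u (design_points \<omega>) (noise_sources \<omega>)"
proof -
  have "(\<Sum>p\<in>I. mc_weights a b g I T p \<omega> * obs \<mu> Xs \<tau> \<eta> T p \<omega> u * f (T p \<omega>) / g (T p \<omega>))
      = (\<Sum>p\<in>I. reg_weight f (design_points \<omega>) p * \<mu> u (design_points \<omega> p)
          + reg_weight f (design_points \<omega>) p * fst (noise_sources \<omega>) (fst p) u (design_points \<omega> p)
          + (reg_weight f (design_points \<omega>) p * \<tau> (design_points \<omega> p)) * snd (noise_sources \<omega>) p u)"
  proof (intro sum.cong refl)
    fix p assume p: "p \<in> I"
    then have "fst p \<in> {1..n}" by (rule fst_visit)
    with p show "mc_weights a b g I T p \<omega> * obs \<mu> Xs \<tau> \<eta> T p \<omega> u * f (T p \<omega>) / g (T p \<omega>)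
      = reg_weight f (design_points \<omega>) p * \<mu> u (design_points \<omega> p)
          + reg_weight f (design_points \<omega>) p * fst (noise_sources \<omega>) (fst p) u (design_points \<omega> p)
          + (reg_weight f (design_points \<omega>) p * \<tau> (design_points \<omega> p)) * snd (noise_sources \<omega>) p u"
      unfolding reg_weight_design_points[OF p] design_points_apply[OF p] noise_sources_def obs_def
      by (simp add: add_divide_distrib algebra_simps)
  qed
  then show ?thesis by (simp add: coef_error_def sum.distrib)
qed

lemma reg_weight_measurable:
  assumes f: "continuous_on {a..b} f" and p: "p \<in> I"
  shows "(\<lambda>s. reg_weight f s p) \<in> borel_measurable point_space"
proof -
  have c: "(\<lambda>s. s p) \<in> measurable point_space L" using p by (rule measurable_component_singleton)
  have "(\<lambda>s. mc_weight a b g I s p) \<in> borel_measurable point_space"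
    using p card_I by (intro mc_weight_measurable) auto
  then show ?thesis
    unfolding reg_weight_def
    by (intro borel_measurable_divide borel_measurable_times measurable_compose[OF c]
        borel_measurable_leb_on_continuous f density_measurable)
qed

text \<open>Here the evaluation of a field at a random design point becomes measurable:
  \<open>surface_space\<close> and \<open>curve_space\<close> make evaluation jointly measurable in
  the function and its argument. The variable \<open>u\<close> is included because the integral over
  it is exchanged with the expectation.\<close>

lemma coef_error_measurable:
  assumes f: "continuous_on {a..b} f" and \<beta>: "\<beta> \<in> borel_measurable \<nu>"
  shows "(\<lambda>z. coef_error f \<beta> (fst z) (fst (snd z)) (snd (snd z)))
    \<in> borel_measurable (\<nu> \<Otimes>\<^sub>M (point_space \<Otimes>\<^sub>M noise_space))" (is "_ \<in> borel_measurable ?Z")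
proof -
  have s: "(\<lambda>z. fst (snd z)) \<in> measurable ?Z point_space"
    by (intro measurable_compose[OF measurable_snd measurable_fst])
  have sp: "(\<lambda>z. fst (snd z) p) \<in> measurable ?Z L" if "p \<in> I" for p
    by (rule measurable_compose[OF s measurable_component_singleton[OF that]])
  have x: "(\<lambda>z. fst (snd (snd z)) i) \<in> measurable ?Z \<X>" if "i \<in> {1..n}" for i
    by (rule measurable_compose[OF measurable_compose[OF measurable_compose[OF measurable_snd measurable_snd] measurable_fst]
          measurable_component_singleton[OF that]])
  have e: "(\<lambda>z. snd (snd (snd z)) p) \<in> measurable ?Z \<E>" if "p \<in> I" for p
    by (rule measurable_compose[OF measurable_compose[OF measurable_compose[OF measurable_snd measurable_snd] measurable_snd]
          measurable_component_singleton[OF that]])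
  have w: "(\<lambda>z. reg_weight f (fst (snd z)) p) \<in> borel_measurable ?Z" if "p \<in> I" for p
    by (rule measurable_compose[OF s reg_weight_measurable[OF f that]])
  have "(\<lambda>z. \<mu> (fst z) (fst (snd z) p)) \<in> borel_measurable ?Z" if "p \<in> I" for p
    using measurable_compose[OF measurable_Pair[OF measurable_fst sp[OF that]] mu_meas] by simp
  moreover have "(\<lambda>z. fst (snd (snd z)) (fst p) (fst z) (fst (snd z) p)) \<in> borel_measurable ?Z" if "p \<in> I" for p
    using measurable_compose[OF measurable_Pair[OF x[OF fst_visit[OF that]] measurable_Pair[OF measurable_fst sp[OF that]]]
        X_space[unfolded surface_space_def]] by simp
  moreover have "(\<lambda>z. snd (snd (snd z)) p (fst z)) \<in> borel_measurable ?Z" if "p \<in> I" for p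
    using measurable_compose[OF measurable_Pair[OF e[OF that] measurable_fst] eta_space[unfolded curve_space_def]]
    by simp
  moreover have "(\<lambda>z. \<tau> (fst (snd z) p)) \<in> borel_measurable ?Z" if "p \<in> I" for p
    by (rule measurable_compose[OF sp[OF that] tau(1)])
  moreover have "(\<lambda>z. \<beta> (fst z)) \<in> borel_measurable ?Z"
    by (rule measurable_compose[OF measurable_fst \<beta>])
  ultimately show ?thesis
    unfolding coef_error_def using w
    by (intro borel_measurable_add borel_measurable_diff borel_measurable_sum borel_measurable_times)
qed

text \<open>For frozen \<open>s\<close> the signal part is the constant term of
  \<open>conditional_observation_moment\<close>. The unit variance of the errors leaves the square
  of \<tau>, and equality in law with \<open>X\<close> together with \<open>m_max\<close> removes
  the subject from the noise factor.\<close>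

lemma conditional_coef_error:
  assumes s: "s \<in> space point_space"
  shows "(\<integral>\<^sup>+\<omega>. ennreal ((coef_error f \<beta> u s (noise_sources \<omega>))\<^sup>2) \<partial>P)
    \<le> ennreal (((\<Sum>p\<in>I. reg_weight f s p * \<mu> u (s p)) - \<beta> u)\<^sup>2)
      + (\<Sum>p\<in>I. ennreal ((reg_weight f s p)\<^sup>2)
          * (ennreal (real m_max) * (\<integral>\<^sup>+\<omega>. ennreal ((X \<omega> u (s p))\<^sup>2) \<partial>P) + ennreal (tau_max\<^sup>2)))"
proof -
  have sp: "s p \<in> {a..b}" if "p \<in> I" for p
    using s that by (auto simp: space_PiM)
  let ?b = "(\<Sum>p\<in>I. reg_weight f s p * \<mu> u (s p)) - \<beta> u"
  let ?c = "reg_weight f s" and ?d = "\<lambda>p. reg_weight f s p * \<tau> (s p)"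
  have "(\<integral>\<^sup>+\<omega>. ennreal ((coef_error f \<beta> u s (noise_sources \<omega>))\<^sup>2) \<partial>P)
      = (\<integral>\<^sup>+\<omega>. ennreal ((?b + (\<Sum>p\<in>I. ?c p * Xs (fst p) \<omega> u (s p)) + (\<Sum>p\<in>I. ?d p * \<eta> p \<omega> u))\<^sup>2) \<partial>P)"
    using fst_visit by (simp add: coef_error_def noise_sources_def cong: sum.cong)
  also have "\<dots> \<le> ennreal (?b\<^sup>2)
      + (\<Sum>p\<in>I. ennreal (real (m (fst p)) * (?c p)\<^sup>2) * (\<integral>\<^sup>+\<omega>. ennreal ((Xs (fst p) \<omega> u (s p))\<^sup>2) \<partial>P))
      + (\<Sum>p\<in>I. ennreal ((?d p)\<^sup>2) * (\<integral>\<^sup>+\<omega>. ennreal ((\<eta> p \<omega> u)\<^sup>2) \<partial>P))"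
  proof (rule P.conditional_observation_moment[where \<X> = \<X> and \<E> = \<E> and x = "\<lambda>p x. x u (s p)" and e = "\<lambda>p e. e u"])
    show "P.indep_var \<X> (Xs i) \<X> (Xs j)" if "i \<in> {1..n}" "j \<in> {1..n}" "i \<noteq> j" for i j
      by (rule P.indep_vars_imp_indep_var[OF X_indep that])
    show "P.indep_var \<E> (\<eta> p) \<E> (\<eta> q)" if "p \<in> I" "q \<in> I" "p \<noteq> q" for p q
      by (rule P.indep_vars_imp_indep_var[OF eta_indep that])
    show "P.indep_var borel (\<lambda>\<omega>. f (Xs i \<omega>)) borel (\<lambda>\<omega>. h (\<eta> p \<omega>))"
      if "i \<in> {1..n}" "p \<in> I" "f \<in> borel_measurable \<X>" "h \<in> borel_measurable \<E>" for i p f and h :: "('u \<Rightarrow> real) \<Rightarrow> real"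
      using X_copies eta_meas that
      by (intro P.indep_var_from_subalgebras[OF indep_X_eta] space_family_algebra
          measurable_compose[OF measurable_family_algebra that(3)]
          measurable_compose[OF measurable_family_algebra that(4)]) auto
  qed (use sp surface_eval curve_eval Xs_centred fst_visit eta_centred in auto)
  also have "\<dots> \<le> ennreal (?b\<^sup>2)
      + (\<Sum>p\<in>I. ennreal ((?c p)\<^sup>2) * (ennreal (real m_max) * (\<integral>\<^sup>+\<omega>. ennreal ((X \<omega> u (s p))\<^sup>2) \<partial>P)))
      + (\<Sum>p\<in>I. ennreal ((?c p)\<^sup>2) * ennreal (tau_max\<^sup>2))"
  proof (intro add_mono order_refl sum_mono)
    fix p assume p: "p \<in> I"
    have "ennreal (real (m (fst p)) * (?c p)\<^sup>2) \<le> ennreal ((?c p)\<^sup>2) * ennreal (real m_max)"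
    proof -
      have "real (m (fst p)) * (?c p)\<^sup>2 \<le> (?c p)\<^sup>2 * real m_max"
        using visits fst_visit[OF p] by (subst mult.commute) (intro mult_left_mono, auto)
      then show ?thesis by (simp add: ennreal_leI flip: ennreal_mult)
    qed
    then show "ennreal (real (m (fst p)) * (?c p)\<^sup>2) * (\<integral>\<^sup>+\<omega>. ennreal ((Xs (fst p) \<omega> u (s p))\<^sup>2) \<partial>P)
        \<le> ennreal ((?c p)\<^sup>2) * (ennreal (real m_max) * (\<integral>\<^sup>+\<omega>. ennreal ((X \<omega> u (s p))\<^sup>2) \<partial>P))"
      unfolding Xs_second_moment[OF fst_visit[OF p] sp[OF p]] mult.assoc[symmetric] by (intro mult_right_mono) auto
    have "(\<tau> (s p))\<^sup>2 \<le> tau_max\<^sup>2"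
      using tau(2) le_tau_max[OF sp[OF p]] sp[OF p] by (intro power_mono) auto
    then show "ennreal ((?d p)\<^sup>2) * (\<integral>\<^sup>+\<omega>. ennreal ((\<eta> p \<omega> u)\<^sup>2) \<partial>P) \<le> ennreal ((?c p)\<^sup>2) * ennreal (tau_max\<^sup>2)"
      unfolding eta_second_moment[OF p]
      by (simp add: power_mult_distrib ennreal_leI mult_left_mono flip: ennreal_mult)
  qed
  finally show ?thesis by (simp add: distrib_left sum.distrib add.assoc)
qed

lemma surface_energy_measurable:
  "(\<lambda>z. \<integral>\<^sup>+\<omega>. ennreal ((X \<omega> (fst z) (snd z))\<^sup>2) \<partial>P) \<in> borel_measurable (\<nu> \<Otimes>\<^sub>M L)"
  using measurable_compose[OF measurable_pair_swap' X_joint_measurable]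
  by (intro P.borel_measurable_nn_integral) (simp add: split_beta')

lemma pair_design_measurable:
  "measurable (\<nu> \<Otimes>\<^sub>M design_product I) N = measurable (\<nu> \<Otimes>\<^sub>M point_space) N"
  "measurable (design_product I) N = measurable point_space N"
  by (intro measurable_cong_sets sets_pair_measure_cong PiM_law_sets refl)+

lemma noise_measurable:
  assumes f: "continuous_on {a..b} f"
  shows "(\<lambda>z. \<Sum>p\<in>I. ennreal ((reg_weight f (snd z) p)\<^sup>2)
          * (ennreal (real m_max) * (\<integral>\<^sup>+\<omega>. ennreal ((X \<omega> (fst z) (snd z p))\<^sup>2) \<partial>P) + ennreal (tau_max\<^sup>2)))
    \<in> borel_measurable (\<nu> \<Otimes>\<^sub>M design_product I)"
proof -
  have "(\<lambda>z. snd z p) \<in> measurable (\<nu> \<Otimes>\<^sub>M point_space) L" if "p \<in> I" for p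
    by (rule measurable_compose[OF measurable_snd measurable_component_singleton[OF that]])
  from measurable_compose[OF measurable_Pair[OF measurable_fst this] surface_energy_measurable]
  have "(\<lambda>z. \<integral>\<^sup>+\<omega>. ennreal ((X \<omega> (fst z) (snd z p))\<^sup>2) \<partial>P) \<in> borel_measurable (\<nu> \<Otimes>\<^sub>M point_space)"
    if "p \<in> I" for p using that by simp
  moreover have "(\<lambda>z. reg_weight f (snd z) p) \<in> borel_measurable (\<nu> \<Otimes>\<^sub>M point_space)" if "p \<in> I" for p
    by (rule measurable_compose[OF measurable_snd reg_weight_measurable[OF f that]])
  ultimately show ?thesis
    unfolding pair_design_measurable
    by (intro borel_measurable_sum borel_measurable_times_ennreal borel_measurable_add
        borel_measurable_const measurable_compose[OF _ measurable_ennreal] borel_measurable_power) auto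
qed

text \<open>The integral over \<open>u\<close> has to be taken first: only the energy integrated
  over \<open>u\<close> is controlled by the covariance trace, and the constant
  \<open>tau_max\<^sup>2\<close> acquires the total mass of \<nu>.\<close>

lemma noise_energy:
  assumes f: "continuous_on {a..b} f"
  shows "(\<integral>\<^sup>+u. (\<integral>\<^sup>+s. (\<Sum>p\<in>I. ennreal ((reg_weight f s p)\<^sup>2)
          * (ennreal (real m_max) * (\<integral>\<^sup>+\<omega>. ennreal ((X \<omega> u (s p))\<^sup>2) \<partial>P) + ennreal (tau_max\<^sup>2))) \<partial>design_product I) \<partial>\<nu>)
    \<le> ennreal (real m_max * Gamma_max + tau_max\<^sup>2 * measure \<nu> UNIV)
      * (\<integral>\<^sup>+s. ennreal (\<Sum>p\<in>I. (reg_weight f s p)\<^sup>2) \<partial>design_product I)"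
proof -
  let ?Q = "design_product I"
  let ?\<xi> = "\<lambda>u t. \<integral>\<^sup>+\<omega>. ennreal ((X \<omega> u t)\<^sup>2) \<partial>P"
  let ?\<Lambda> = "real m_max * Gamma_max + tau_max\<^sup>2 * measure \<nu> UNIV"
  interpret \<nu>Q: pair_sigma_finite ?Q \<nu> ..
  have w: "(\<lambda>s. reg_weight f s p) \<in> borel_measurable ?Q" if "p \<in> I" for p
    using reg_weight_measurable[OF f that] by (simp add: pair_design_measurable)
  have xi_u: "(\<lambda>u. ?\<xi> u t) \<in> borel_measurable \<nu>" if "t \<in> {a..b}" for t
    using measurable_Pair1[OF surface_energy_measurable, of t] that by simp
  have "(\<integral>\<^sup>+u. (\<integral>\<^sup>+s. (\<Sum>p\<in>I. ennreal ((reg_weight f s p)\<^sup>2) * (ennreal (real m_max) * ?\<xi> u (s p) + ennreal (tau_max\<^sup>2))) \<partial>?Q) \<partial>\<nu>)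
      = (\<integral>\<^sup>+s. (\<integral>\<^sup>+u. (\<Sum>p\<in>I. ennreal ((reg_weight f s p)\<^sup>2) * (ennreal (real m_max) * ?\<xi> u (s p) + ennreal (tau_max\<^sup>2))) \<partial>\<nu>) \<partial>?Q)"
    using measurable_compose[OF measurable_pair_swap' noise_measurable[OF f]]
    by (intro \<nu>Q.Fubini') (simp add: split_beta')
  also have "\<dots> = (\<integral>\<^sup>+s. (\<Sum>p\<in>I. ennreal ((reg_weight f s p)\<^sup>2) * (ennreal (real m_max) * (\<integral>\<^sup>+u. ?\<xi> u (s p) \<partial>\<nu>) + ennreal (tau_max\<^sup>2 * measure \<nu> UNIV))) \<partial>?Q)"
  proof (intro nn_integral_cong)
    fix s assume "s \<in> space ?Q"
    then have sp: "s p \<in> {a..b}" if "p \<in> I" for p using that by (auto simp: space_PiM)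
    have *: "(\<integral>\<^sup>+u. ennreal ((reg_weight f s p)\<^sup>2) * (ennreal (real m_max) * ?\<xi> u (s p) + ennreal (tau_max\<^sup>2)) \<partial>\<nu>)
        = ennreal ((reg_weight f s p)\<^sup>2) * (ennreal (real m_max) * (\<integral>\<^sup>+u. ?\<xi> u (s p) \<partial>\<nu>) + ennreal (tau_max\<^sup>2 * measure \<nu> UNIV))"
      if "p \<in> I" for p
      using xi_u[OF sp[OF that]] nu
      by (simp add: nn_integral_cmult nn_integral_add \<nu>.emeasure_eq_measure ennreal_mult)
    show "(\<integral>\<^sup>+u. (\<Sum>p\<in>I. ennreal ((reg_weight f s p)\<^sup>2) * (ennreal (real m_max) * ?\<xi> u (s p) + ennreal (tau_max\<^sup>2))) \<partial>\<nu>)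
        = (\<Sum>p\<in>I. ennreal ((reg_weight f s p)\<^sup>2) * (ennreal (real m_max) * (\<integral>\<^sup>+u. ?\<xi> u (s p) \<partial>\<nu>) + ennreal (tau_max\<^sup>2 * measure \<nu> UNIV)))"
      using xi_u sp
      by (subst nn_integral_sum) (auto intro!: sum.cong * borel_measurable_times_ennreal borel_measurable_add)
  qed
  also have "\<dots> \<le> (\<integral>\<^sup>+s. ennreal ?\<Lambda> * ennreal (\<Sum>p\<in>I. (reg_weight f s p)\<^sup>2) \<partial>?Q)"
  proof (rule nn_integral_mono_AE)
    \<comment> \<open>Each coordinate of the design has law \<open>law\<close>, so a null set of
      times yields a null set of designs; finitely many coordinates are then handled
      together.\<close>
    have "AE s in ?Q. (\<integral>\<^sup>+u. ?\<xi> u (s p) \<partial>\<nu>) \<le> ennreal Gamma_max" if "p \<in> I" for p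
      using that surface_energy_bound prob_space_axioms by (intro AE_PiM_component) auto
    then have "AE s in ?Q. \<forall>p\<in>I. (\<integral>\<^sup>+u. ?\<xi> u (s p) \<partial>\<nu>) \<le> ennreal Gamma_max"
      by (intro AE_finite_allI) auto
    then show "AE s in ?Q. (\<Sum>p\<in>I. ennreal ((reg_weight f s p)\<^sup>2) * (ennreal (real m_max) * (\<integral>\<^sup>+u. ?\<xi> u (s p) \<partial>\<nu>) + ennreal (tau_max\<^sup>2 * measure \<nu> UNIV)))
        \<le> ennreal ?\<Lambda> * ennreal (\<Sum>p\<in>I. (reg_weight f s p)\<^sup>2)"
    proof eventually_elim
      case (elim s)
      have "(\<Sum>p\<in>I. ennreal ((reg_weight f s p)\<^sup>2) * (ennreal (real m_max) * (\<integral>\<^sup>+u. ?\<xi> u (s p) \<partial>\<nu>) + ennreal (tau_max\<^sup>2 * measure \<nu> UNIV)))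
          \<le> (\<Sum>p\<in>I. ennreal ((reg_weight f s p)\<^sup>2) * (ennreal (real m_max) * ennreal Gamma_max + ennreal (tau_max\<^sup>2 * measure \<nu> UNIV)))"
        using elim by (intro sum_mono mult_left_mono add_right_mono) auto
      also have "\<dots> = (\<Sum>p\<in>I. ennreal ((reg_weight f s p)\<^sup>2) * ennreal ?\<Lambda>)"
        using Gamma_max_nonneg by (simp add: ennreal_mult)
      also have "\<dots> = ennreal ?\<Lambda> * ennreal (\<Sum>p\<in>I. (reg_weight f s p)\<^sup>2)"
        by (simp add: sum_distrib_right[symmetric] sum_ennreal mult.commute)
      finally show ?case .
    qed
  qed
  also have "\<dots> = ennreal ?\<Lambda> * (\<integral>\<^sup>+s. ennreal (\<Sum>p\<in>I. (reg_weight f s p)\<^sup>2) \<partial>?Q)"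
    using w by (intro nn_integral_cmult) (auto intro!: measurable_compose[OF _ measurable_ennreal] borel_measurable_sum borel_measurable_power)
  finally show ?thesis .
qed

text \<open>Tonelli's theorem puts \<open>u\<close> outside, so that the design is frozen and the
  conditional bound applied for each \<open>u\<close> separately. The measurability claim allows the
  risk to be written as a sum of such expectations.\<close>

lemma coef_error_second_moment:
  assumes f: "continuous_on {a..b} f" and \<beta>: "\<beta> \<in> borel_measurable \<nu>"
  shows "(\<integral>\<^sup>+\<omega>. sq_norm_L2 \<nu> (\<lambda>u. coef_error f \<beta> u (design_points \<omega>) (noise_sources \<omega>)) \<partial>P)
    \<le> (\<integral>\<^sup>+u. (\<integral>\<^sup>+\<omega>. ennreal (((\<Sum>p\<in>I. reg_weight f (design_points \<omega>) p * \<mu> u (T p \<omega>)) - \<beta> u)\<^sup>2) \<partial>P) \<partial>\<nu>)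
      + ennreal (real m_max * Gamma_max + tau_max\<^sup>2 * measure \<nu> UNIV)
        * (\<integral>\<^sup>+s. ennreal (\<Sum>p\<in>I. (reg_weight f s p)\<^sup>2) \<partial>design_product I)" (is ?moment)
    and "(\<lambda>\<omega>. sq_norm_L2 \<nu> (\<lambda>u. coef_error f \<beta> u (design_points \<omega>) (noise_sources \<omega>))) \<in> borel_measurable P" (is ?meas)
proof -
  let ?Q = "design_product I"
  let ?bias = "\<lambda>s u. (\<Sum>p\<in>I. reg_weight f s p * \<mu> u (s p)) - \<beta> u"
  let ?noise = "\<lambda>s u. \<Sum>p\<in>I. ennreal ((reg_weight f s p)\<^sup>2)
          * (ennreal (real m_max) * (\<integral>\<^sup>+\<omega>. ennreal ((X \<omega> u (s p))\<^sup>2) \<partial>P) + ennreal (tau_max\<^sup>2))"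
  interpret P\<nu>: pair_sigma_finite P \<nu> ..
  have Q: "sigma_finite_measure ?Q"
    by (intro prob_space_imp_sigma_finite prob_space_PiM) (rule prob_space_axioms)
  note ce = coef_error_measurable[OF f \<beta>]
  have "(\<lambda>z. (snd z, (design_points (fst z), noise_sources (fst z)))) \<in> measurable (P \<Otimes>\<^sub>M \<nu>) (\<nu> \<Otimes>\<^sub>M (point_space \<Otimes>\<^sub>M noise_space))"
    by (intro measurable_Pair measurable_snd measurable_compose[OF measurable_fst design_points_measurable]
        measurable_compose[OF measurable_fst noise_sources_measurable_P])
  from measurable_compose[OF this ce]
  have joint: "(\<lambda>z. coef_error f \<beta> (snd z) (design_points (fst z)) (noise_sources (fst z))) \<in> borel_measurable (P \<Otimes>\<^sub>M \<nu>)"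
    by simp
  show ?meas
    unfolding sq_norm_L2_def using joint by (intro \<nu>.borel_measurable_nn_integral) (simp add: split_beta')
  have bias_m: "(\<lambda>z. ?bias (snd z) (fst z)) \<in> borel_measurable (\<nu> \<Otimes>\<^sub>M point_space)"
  proof -
    have c: "(\<lambda>z. snd z p) \<in> measurable (\<nu> \<Otimes>\<^sub>M point_space) L" if "p \<in> I" for p
      by (rule measurable_compose[OF measurable_snd measurable_component_singleton[OF that]])
    have "(\<lambda>z. \<mu> (fst z) (snd z p)) \<in> borel_measurable (\<nu> \<Otimes>\<^sub>M point_space)" if "p \<in> I" for p
      using measurable_compose[OF measurable_Pair[OF measurable_fst c[OF that]] mu_meas] by simp
    then show ?thesis
      using measurable_compose[OF measurable_fst \<beta>]
      by (intro borel_measurable_diff borel_measurable_sum borel_measurable_times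
          measurable_compose[OF measurable_snd reg_weight_measurable[OF f]]) auto
  qed
  have "(\<integral>\<^sup>+\<omega>. sq_norm_L2 \<nu> (\<lambda>u. coef_error f \<beta> u (design_points \<omega>) (noise_sources \<omega>)) \<partial>P)
      = (\<integral>\<^sup>+u. (\<integral>\<^sup>+\<omega>. ennreal ((coef_error f \<beta> u (design_points \<omega>) (noise_sources \<omega>))\<^sup>2) \<partial>P) \<partial>\<nu>)"
    unfolding sq_norm_L2_def using joint by (intro P\<nu>.Fubini'[symmetric]) (simp add: split_beta')
  also have "\<dots> \<le> (\<integral>\<^sup>+u. (\<integral>\<^sup>+s. ennreal ((?bias s u)\<^sup>2) \<partial>?Q) + (\<integral>\<^sup>+s. ?noise s u \<partial>?Q) \<partial>\<nu>)"
  proof (intro nn_integral_mono)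
    fix u assume u: "u \<in> space \<nu>"
    have m: "(\<lambda>z. coef_error f \<beta> u (fst z) (snd z)) \<in> borel_measurable (point_space \<Otimes>\<^sub>M noise_space)"
      using measurable_Pair2[OF ce u] by simp
    have sp: "space (sigma (space P) (sets X_algebra \<union> sets eta_algebra)) = space P"
      by (simp add: space_measure_of_conv)
    have "(\<integral>\<^sup>+\<omega>. ennreal ((coef_error f \<beta> u (design_points \<omega>) (noise_sources \<omega>))\<^sup>2) \<partial>P)
        = (\<integral>\<^sup>+s. (\<integral>\<^sup>+\<omega>. ennreal ((coef_error f \<beta> u s (noise_sources \<omega>))\<^sup>2) \<partial>P) \<partial>?Q)"
      using P.nn_integral_independent_pair[OF indep_T_noise space_family_algebra sp
          design_points_measurable_T noise_sources_measurable,
          of "\<lambda>z. ennreal ((coef_error f \<beta> u (fst z) (snd z))\<^sup>2)"] m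
      by (simp add: design_points_law)
    also have "\<dots> \<le> (\<integral>\<^sup>+s. ennreal ((?bias s u)\<^sup>2) + ?noise s u \<partial>?Q)"
      by (intro nn_integral_mono conditional_coef_error) (simp add: sets_eq_imp_space_eq[OF PiM_law_sets])
    also have "\<dots> = (\<integral>\<^sup>+s. ennreal ((?bias s u)\<^sup>2) \<partial>?Q) + (\<integral>\<^sup>+s. ?noise s u \<partial>?Q)"
    proof (rule nn_integral_add)
      show "(\<lambda>s. ennreal ((?bias s u)\<^sup>2)) \<in> borel_measurable ?Q"
        using measurable_Pair2[OF bias_m u] by (simp add: pair_design_measurable)
      show "(\<lambda>s. ?noise s u) \<in> borel_measurable ?Q"
        using measurable_Pair2[OF noise_measurable[OF f] u] by simp
    qed
    finally show "(\<integral>\<^sup>+\<omega>. ennreal ((coef_error f \<beta> u (design_points \<omega>) (noise_sources \<omega>))\<^sup>2) \<partial>P)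
        \<le> (\<integral>\<^sup>+s. ennreal ((?bias s u)\<^sup>2) \<partial>?Q) + (\<integral>\<^sup>+s. ?noise s u \<partial>?Q)" .
  qed
  also have "\<dots> = (\<integral>\<^sup>+u. (\<integral>\<^sup>+s. ennreal ((?bias s u)\<^sup>2) \<partial>?Q) \<partial>\<nu>) + (\<integral>\<^sup>+u. (\<integral>\<^sup>+s. ?noise s u \<partial>?Q) \<partial>\<nu>)"
  proof (rule nn_integral_add)
    show "(\<lambda>u. \<integral>\<^sup>+s. ennreal ((?bias s u)\<^sup>2) \<partial>?Q) \<in> borel_measurable \<nu>"
      using bias_m by (intro sigma_finite_measure.borel_measurable_nn_integral[OF Q]) (simp add: split_beta' pair_design_measurable)
    show "(\<lambda>u. \<integral>\<^sup>+s. ?noise s u \<partial>?Q) \<in> borel_measurable \<nu>"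
      using noise_measurable[OF f] by (intro sigma_finite_measure.borel_measurable_nn_integral[OF Q]) (simp add: split_beta')
  qed
  \<comment> \<open>The signal part is carried back to the sample space, where the variance of the
    growth condition is taken.\<close>
  also have "(\<integral>\<^sup>+u. (\<integral>\<^sup>+s. ennreal ((?bias s u)\<^sup>2) \<partial>?Q) \<partial>\<nu>)
      = (\<integral>\<^sup>+u. (\<integral>\<^sup>+\<omega>. ennreal (((\<Sum>p\<in>I. reg_weight f (design_points \<omega>) p * \<mu> u (T p \<omega>)) - \<beta> u)\<^sup>2) \<partial>P) \<partial>\<nu>)"
  proof (intro nn_integral_cong)
    fix u assume "u \<in> space \<nu>"
    then have "(\<lambda>s. ?bias s u) \<in> borel_measurable point_space" using measurable_Pair2[OF bias_m] by simp
    then have "(\<integral>\<^sup>+s. ennreal ((?bias s u)\<^sup>2) \<partial>?Q) = (\<integral>\<^sup>+\<omega>. ennreal ((?bias (design_points \<omega>) u)\<^sup>2) \<partial>P)"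
      unfolding design_points_law[symmetric] by (intro nn_integral_distr design_points_measurable) simp
    then show "(\<integral>\<^sup>+s. ennreal ((?bias s u)\<^sup>2) \<partial>?Q)
        = (\<integral>\<^sup>+\<omega>. ennreal (((\<Sum>p\<in>I. reg_weight f (design_points \<omega>) p * \<mu> u (T p \<omega>)) - \<beta> u)\<^sup>2) \<partial>P)"
      by (simp add: design_points_apply cong: sum.cong)
  qed
  finally show ?moment
    using noise_energy[OF f] by (meson add_left_mono order_trans)
qed

end

section \<open>Quadrature error of the signal, energy of the regression weights, and the risk of one
  coefficient\<close>

lemma continuous_on_interval_bounded:
  fixes k :: "real \<Rightarrow> real"
  assumes "continuous_on {a..b} k"
  obtains S where "\<And>t. t \<in> {a..b} \<Longrightarrow> \<bar>k t\<bar> \<le> S"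
proof -
  have "bounded (k ` {a..b})" using assms by (intro compact_imp_bounded compact_continuous_image) auto
  then obtain S where "\<forall>x\<in>k ` {a..b}. \<bar>x\<bar> \<le> S" by (auto simp: bounded_iff)
  then show ?thesis using that[of S] by blast
qed

lemma integrable_leb_on_continuous:
  fixes k :: "real \<Rightarrow> real"
  assumes k: "continuous_on {a..b} k"
  shows "integrable (leb_on a b) k"
proof -
  interpret finite_measure "leb_on a b" by (rule finite_measure_leb_on)
  obtain S where "\<And>t. t \<in> {a..b} \<Longrightarrow> \<bar>k t\<bar> \<le> S"
    using continuous_on_interval_bounded[OF k] by blast
  then show ?thesis
    by (intro integrable_const_bound[of _ S] borel_measurable_leb_on_continuous k) (auto intro!: AE_I2)
qed

lemma (in design) integrable_law_continuous:
  fixes k :: "real \<Rightarrow> real"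
  assumes k: "continuous_on {a..b} k"
  shows "integrable law k"
proof -
  obtain S where "\<And>t. t \<in> {a..b} \<Longrightarrow> \<bar>k t\<bar> \<le> S"
    using continuous_on_interval_bounded[OF k] by blast
  then show ?thesis
    using borel_measurable_leb_on_continuous[OF k]
    by (intro integrable_const_bound[of _ S])
      (auto simp: measurable_cong_sets[OF sets_design_law refl] intro!: AE_I2)
qed

context sampling_model
begin

lemma mc_weights_measurable:
  assumes "p \<in> I"
  shows "mc_weights a b g I T p \<in> borel_measurable P"
proof -
  have "mc_weights a b g I T p \<omega> = mc_weight a b g I (design_points \<omega>) p" for \<omega>
    unfolding mc_weights_def by (intro mc_weight_cong) (simp add: design_points_apply)
  moreover have "(\<lambda>\<omega>. mc_weight a b g I (design_points \<omega>) p) \<in> borel_measurable P"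
    using assms card_I
    by (intro measurable_compose[OF design_points_measurable mc_weight_measurable]) auto
  ultimately show ?thesis by (simp add: fun_eq_iff[symmetric] cong: measurable_cong)
qed

text \<open>Admissibility makes the weighted sum unbiased, so its mean square deviation from the
  integral is the variance. The almost sure bound on the squared weights makes the sum bounded,
  hence the variance a genuine integral and not a default value.\<close>

lemma signal_variance:
  assumes adm: "admissible_weights P a b g I T (mc_weights a b g I T)"
    and h: "continuous_on {a..b} h"
  shows "(\<integral>\<^sup>+\<omega>. ennreal (((\<Sum>p\<in>I. mc_weights a b g I T p \<omega> * h (T p \<omega>)) - (LINT t|law. h t))\<^sup>2) \<partial>P)
    = ennreal (P.variance (\<lambda>\<omega>. \<Sum>p\<in>I. mc_weights a b g I T p \<omega> * h (T p \<omega>)))"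
proof -
  let ?W = "mc_weights a b g I T"
  let ?B = "\<lambda>\<omega>. \<Sum>p\<in>I. ?W p \<omega> * h (T p \<omega>)"
  have hm: "h \<in> borel_measurable L" by (rule borel_measurable_leb_on_continuous[OF h])
  obtain S where S: "\<And>t. t \<in> {a..b} \<Longrightarrow> \<bar>h t\<bar> \<le> S"
    using continuous_on_interval_bounded[OF h] by blast
  have S0: "0 \<le> S" using S[of a] less by (meson abs_ge_zero atLeastAtMost_iff order_refl order_trans less_imp_le)
  obtain C0 where "0 \<le> C0" and W2: "AE \<omega> in P. (\<Sum>p\<in>I. (?W p \<omega>)\<^sup>2) \<le> 1 + C0 / real (card I)"
    using adm by (auto simp: admissible_weights_def)
  define R where "R = 1 + C0 / real (card I)"
  have R1: "1 \<le> R" using \<open>0 \<le> C0\<close> by (simp add: R_def)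
  have W_bound: "AE \<omega> in P. \<forall>p\<in>I. \<bar>?W p \<omega>\<bar> \<le> R"
    using W2
  proof eventually_elim
    case (elim \<omega>)
    show ?case
    proof
      fix p assume "p \<in> I"
      then have "(?W p \<omega>)\<^sup>2 \<le> (\<Sum>p\<in>I. (?W p \<omega>)\<^sup>2)" by (intro member_le_sum) auto
      also have "\<dots> \<le> R" using elim by (simp add: R_def)
      \<comment> \<open>Since \<open>1 \<le> R\<close>, this gives the bound \<open>R\<close> for
        the absolute value without a square root.\<close>
      also have "\<dots> \<le> R\<^sup>2" using R1 by (simp add: power2_eq_square)
      finally show "\<bar>?W p \<omega>\<bar> \<le> R" using R1 abs_le_square_iff[of "?W p \<omega>" R] by simp
    qed
  qed
  have term_meas: "(\<lambda>\<omega>. ?W p \<omega> * h (T p \<omega>)) \<in> borel_measurable P" if "p \<in> I" for p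
    using mc_weights_measurable[OF that] measurable_compose[OF T_measurable[OF that] hm]
    by (intro borel_measurable_times)
  have B_meas: "?B \<in> borel_measurable P" by (intro borel_measurable_sum term_meas)
  have term_bound: "\<bar>?W p \<omega> * h (T p \<omega>)\<bar> \<le> R * S" if "p \<in> I" "\<omega> \<in> space P" "\<bar>?W p \<omega>\<bar> \<le> R" for p \<omega>
    using that S[OF T_range[OF that(1,2)]] R1 S0 unfolding abs_mult by (intro mult_mono) auto
  have int: "integrable P (\<lambda>\<omega>. ?W p \<omega> * h (T p \<omega>))" if "p \<in> I" for p
  proof (rule P.integrable_const_bound[OF _ term_meas[OF that]])
    show "AE \<omega> in P. norm (?W p \<omega> * h (T p \<omega>)) \<le> R * S"
      using W_bound AE_space by eventually_elim (use that term_bound in auto)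
  qed
  have mean: "P.expectation ?B = (LINT t|law. h t)"
  proof -
    have "integrable law h" by (rule integrable_law_continuous[OF h])
    then have "(\<Sum>p\<in>I. P.expectation (\<lambda>\<omega>. ?W p \<omega> * h (T p \<omega>))) = (LINT t|law. h t)"
      using adm unfolding admissible_weights_def by blast
    then show ?thesis using int by (simp add: Bochner_Integration.integral_sum)
  qed
  have "integrable P (\<lambda>\<omega>. (?B \<omega> - (LINT t|law. h t))\<^sup>2)"
  proof (rule P.integrable_const_bound)
    show "(\<lambda>\<omega>. (?B \<omega> - (LINT t|law. h t))\<^sup>2) \<in> borel_measurable P" using B_meas by simp
    show "AE \<omega> in P. norm ((?B \<omega> - (LINT t|law. h t))\<^sup>2) \<le> (real (card I) * (R * S) + \<bar>LINT t|law. h t\<bar>)\<^sup>2"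
      using W_bound AE_space
    proof eventually_elim
      case (elim \<omega>)
      have "\<bar>?B \<omega>\<bar> \<le> (\<Sum>p\<in>I. R * S)"
        using elim term_bound by (intro order_trans[OF sum_abs sum_mono]) auto
      then have "\<bar>?B \<omega> - (LINT t|law. h t)\<bar> \<le> real (card I) * (R * S) + \<bar>LINT t|law. h t\<bar>"
        by simp
      then have "\<bar>?B \<omega> - (LINT t|law. h t)\<bar>\<^sup>2 \<le> (real (card I) * (R * S) + \<bar>LINT t|law. h t\<bar>)\<^sup>2"
        by (intro power_mono) auto
      then show ?case by simp
    qed
  qed
  then show ?thesis unfolding mean by (intro nn_integral_eq_integral) auto
qed

lemma moment_constantD:
  assumes "mc_moment_constant \<kappa>" "\<And>t. t \<in> {a..b} \<Longrightarrow> 0 \<le> h t" "integrable law h"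
  shows "(\<integral>\<^sup>+s. ennreal (\<Sum>p\<in>I. (mc_weight a b g I s p)\<^sup>2 * h (s p)) \<partial>design_product I)
    \<le> ennreal (\<kappa> g_min g_max / real (\<Sum>i=1..n. m i) * (LINT t|L. h t * g t))"
  using assms(1)[unfolded mc_moment_constant_def, rule_format, OF less density _ sample_size assms(2,3)]
    visits by blast

text \<open>A negative value of \<open>\<kappa>\<close> is not excluded by the shape of \<open>mc_moment_constant\<close>, since \<open>ennreal\<close> maps
  negative numbers to \<open>0\<close>; it is excluded by \<open>h = 1\<close>, because the weights sum to \<open>1\<close>.\<close>

lemma moment_constant_pos:
  assumes \<kappa>: "mc_moment_constant \<kappa>"
    and adm: "admissible_weights P a b g I T (mc_weights a b g I T)"
  shows "0 < \<kappa> g_min g_max"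
proof -
  let ?M = "real (\<Sum>i=1..n. m i)"
  have M: "0 < ?M" "?M = real (card I)" using sample_size card_I by linarith+
  \<comment> \<open>Cauchy-Schwarz applied to the weights and the constant 1.\<close>
  have "1 / ?M \<le> (\<Sum>p\<in>I. (mc_weights a b g I T p \<omega>)\<^sup>2)" if "(\<Sum>p\<in>I. mc_weights a b g I T p \<omega>) = 1" for \<omega>
    using sum_squared_le_sum_of_squares[of "\<lambda>p. mc_weights a b g I T p \<omega>" I] that M
    by (simp add: field_simps)
  moreover have "AE \<omega> in P. (\<Sum>p\<in>I. mc_weights a b g I T p \<omega>) = 1"
    using adm by (simp add: admissible_weights_def)
  ultimately have "AE \<omega> in P. ennreal (1 / ?M) \<le> ennreal (\<Sum>p\<in>I. (mc_weights a b g I T p \<omega>)\<^sup>2)"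
    by (auto elim!: eventually_mono intro!: ennreal_leI simp del: of_nat_sum)
  from nn_integral_mono_AE[OF this]
  have "ennreal (1 / ?M) \<le> (\<integral>\<^sup>+\<omega>. ennreal (\<Sum>p\<in>I. (mc_weights a b g I T p \<omega>)\<^sup>2) \<partial>P)"
    by (simp add: P.emeasure_space_1 del: of_nat_sum)
  also have "\<dots> = (\<integral>\<^sup>+\<omega>. ennreal (\<Sum>p\<in>I. (mc_weight a b g I (design_points \<omega>) p)\<^sup>2) \<partial>P)"
    unfolding mc_weights_def
    by (intro nn_integral_cong arg_cong[where f = ennreal] sum.cong arg_cong[where f = "\<lambda>x. x\<^sup>2"] mc_weight_cong refl)
      (simp add: design_points_apply)
  also have "\<dots> = (\<integral>\<^sup>+s. ennreal (\<Sum>p\<in>I. (mc_weight a b g I s p)\<^sup>2 * (\<lambda>_. 1) (s p)) \<partial>design_product I)"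
    unfolding design_points_law[symmetric]
    using card_I by (subst nn_integral_distr[OF design_points_measurable])
      (auto intro!: measurable_compose[OF _ measurable_ennreal] borel_measurable_sum borel_measurable_power mc_weight_measurable)
  also have "\<dots> \<le> ennreal (\<kappa> g_min g_max / ?M * (LINT t|L. 1 * g t))"
    by (rule moment_constantD[OF \<kappa>]) simp_all
  finally have le: "ennreal (1 / ?M) \<le> ennreal (\<kappa> g_min g_max / ?M * (LINT t|L. 1 * g t))" .
  have "0 \<le> (LINT t|L. 1 * g t)"
    using density_pos by (intro Bochner_Integration.integral_nonneg) (auto intro: less_imp_le)
  show ?thesis
  proof (rule ccontr)
    assume "\<not> ?thesis"
    then have "\<kappa> g_min g_max / ?M * (LINT t|L. 1 * g t) \<le> 0"
      using M \<open>0 \<le> (LINT t|L. 1 * g t)\<close> by (intro mult_nonpos_nonneg divide_nonpos_pos) auto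
    then have "ennreal (1 / ?M) \<le> 0" using le by (simp only: ennreal_neg)
    then show False using M by (simp add: ennreal_eq_0_iff del: of_nat_sum)
  qed
qed

text \<open>The moment constant is applied to \<open>f\<^sup>2 / g\<^sup>2\<close>. One power of
  \<open>g\<close> cancels against the density; the other is bounded below by \<open>g_min\<close>,
  which is the origin of the division by \<open>g_min\<close> in the final constant.\<close>

lemma reg_weight_energy:
  assumes \<kappa>: "mc_moment_constant \<kappa>" "0 \<le> \<kappa> g_min g_max"
    and f: "continuous_on {a..b} f"
  shows "(\<integral>\<^sup>+s. ennreal (\<Sum>p\<in>I. (reg_weight f s p)\<^sup>2) \<partial>design_product I)
    \<le> ennreal (\<kappa> g_min g_max / real (\<Sum>i=1..n. m i) * ((LINT t|L. (f t)\<^sup>2) / g_min))"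
proof -
  let ?h = "\<lambda>t. (f t)\<^sup>2 / (g t)\<^sup>2" and ?M = "real (\<Sum>i=1..n. m i)"
  have hc: "continuous_on {a..b} ?h"
    using density_pos by (intro continuous_intros f continuous_density) force
  have hint: "integrable law ?h" by (rule integrable_law_continuous[OF hc])
  have "(\<integral>\<^sup>+s. ennreal (\<Sum>p\<in>I. (reg_weight f s p)\<^sup>2) \<partial>design_product I)
      = (\<integral>\<^sup>+s. ennreal (\<Sum>p\<in>I. (mc_weight a b g I s p)\<^sup>2 * ?h (s p)) \<partial>design_product I)"
    by (simp add: reg_weight_def power_mult_distrib power_divide)
  also have "\<dots> \<le> ennreal (\<kappa> g_min g_max / ?M * (LINT t|L. ?h t * g t))"
    by (rule moment_constantD[OF \<kappa>(1) _ hint]) simp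
  also have "\<dots> \<le> ennreal (\<kappa> g_min g_max / ?M * ((LINT t|L. (f t)\<^sup>2) / g_min))"
  proof (intro ennreal_leI mult_left_mono)
    have "(LINT t|L. ?h t * g t) \<le> (LINT t|L. (f t)\<^sup>2 / g_min)"
    proof (rule integral_mono)
      show "integrable L (\<lambda>t. ?h t * g t)" "integrable L (\<lambda>t. (f t)\<^sup>2 / g_min)"
        using g_min_pos by (intro integrable_leb_on_continuous continuous_intros hc f continuous_density; simp)+
      fix t assume "t \<in> space L"
      then have t: "0 < g t" "g_min \<le> g t" using density_pos g_min_le by auto
      then have "?h t * g t = (f t)\<^sup>2 / g t" by (simp add: power2_eq_square)
      also have "\<dots> \<le> (f t)\<^sup>2 / g_min" using t g_min_pos by (intro divide_left_mono) auto
      finally show "?h t * g t \<le> (f t)\<^sup>2 / g_min" .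
    qed
    then show "(LINT t|L. ?h t * g t) \<le> (LINT t|L. (f t)\<^sup>2) / g_min" by simp
    show "0 \<le> \<kappa> g_min g_max / ?M" using \<kappa>(2) of_nat_0_le_iff by (intro divide_nonneg_nonneg)
  qed
  finally show ?thesis .
qed

text \<open>The division by \<open>g (T p \<omega>)\<close> in the estimator cancels the sampling
  density, so the integral of the signal term under the design law is the Fourier coefficient itself
  and the signal error becomes a variance.\<close>

lemma coefficient_risk:
  assumes \<kappa>: "mc_moment_constant \<kappa>"
    and adm: "admissible_weights P a b g I T (mc_weights a b g I T)"
    and f: "continuous_on {a..b} f" and norm: "(LINT t|L. (f t)\<^sup>2) = 1"
    and mu: "\<And>u. continuous_on {a..b} (\<mu> u)"
  defines "\<beta> \<equiv> \<lambda>u. LINT t|L. \<mu> u t * f t"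
  shows "(\<integral>\<^sup>+\<omega>. sq_norm_L2 \<nu> (\<lambda>u. coef_error f \<beta> u (design_points \<omega>) (noise_sources \<omega>)) \<partial>P)
    \<le> (\<integral>\<^sup>+u. ennreal (P.variance (\<lambda>\<omega>. \<Sum>p\<in>I. mc_weights a b g I T p \<omega> * \<mu> u (T p \<omega>) * f (T p \<omega>) / g (T p \<omega>))) \<partial>\<nu>)
      + ennreal ((real m_max * Gamma_max + tau_max\<^sup>2 * measure \<nu> UNIV)
          * (\<kappa> g_min g_max / real (\<Sum>i=1..n. m i) / g_min))"
proof -
  interpret finL: finite_measure L by (rule finite_measure_leb_on)
  let ?\<Lambda> = "real m_max * Gamma_max + tau_max\<^sup>2 * measure \<nu> UNIV"
  have \<beta>: "\<beta> \<in> borel_measurable \<nu>"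
    unfolding \<beta>_def using mu_meas measurable_compose[OF measurable_snd borel_measurable_leb_on_continuous[OF f]]
    by (intro finL.borel_measurable_lebesgue_integral) (auto simp: split_beta' intro!: borel_measurable_times)
  have pos: "0 < \<kappa> g_min g_max" by (rule moment_constant_pos[OF \<kappa> adm])
  have "(\<integral>\<^sup>+\<omega>. ennreal (((\<Sum>p\<in>I. reg_weight f (design_points \<omega>) p * \<mu> u (T p \<omega>)) - \<beta> u)\<^sup>2) \<partial>P)
      = ennreal (P.variance (\<lambda>\<omega>. \<Sum>p\<in>I. mc_weights a b g I T p \<omega> * \<mu> u (T p \<omega>) * f (T p \<omega>) / g (T p \<omega>)))" for u
  proof -
    let ?h = "\<lambda>t. \<mu> u t * f t / g t"
    have hc: "continuous_on {a..b} ?h"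
      using density_pos by (intro continuous_intros mu f continuous_density) force
    have "(LINT t|law. ?h t) = (LINT t|L. g t *\<^sub>R ?h t)"
      unfolding design_law_def using density_pos borel_measurable_leb_on_continuous[OF hc]
      by (intro integral_density) (auto intro!: AE_I2 less_imp_le)
    also have "\<dots> = \<beta> u"
      unfolding \<beta>_def using density_pos by (intro Bochner_Integration.integral_cong) force+
    finally have mean: "(LINT t|law. ?h t) = \<beta> u" .
    have "(\<Sum>p\<in>I. reg_weight f (design_points \<omega>) p * \<mu> u (T p \<omega>)) = (\<Sum>p\<in>I. mc_weights a b g I T p \<omega> * ?h (T p \<omega>))" for \<omega>
      by (intro sum.cong refl) (simp add: reg_weight_design_points mult_ac)
    then show ?thesis
      using signal_variance[OF adm hc] unfolding mean by (simp add: mult_ac)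
  qed
  then have "(\<integral>\<^sup>+\<omega>. sq_norm_L2 \<nu> (\<lambda>u. coef_error f \<beta> u (design_points \<omega>) (noise_sources \<omega>)) \<partial>P)
    \<le> (\<integral>\<^sup>+u. ennreal (P.variance (\<lambda>\<omega>. \<Sum>p\<in>I. mc_weights a b g I T p \<omega> * \<mu> u (T p \<omega>) * f (T p \<omega>) / g (T p \<omega>))) \<partial>\<nu>)
      + ennreal ?\<Lambda> * (\<integral>\<^sup>+s. ennreal (\<Sum>p\<in>I. (reg_weight f s p)\<^sup>2) \<partial>design_product I)"
    using coef_error_second_moment(1)[OF f \<beta>] by simp
  also have "\<dots> \<le> (\<integral>\<^sup>+u. ennreal (P.variance (\<lambda>\<omega>. \<Sum>p\<in>I. mc_weights a b g I T p \<omega> * \<mu> u (T p \<omega>) * f (T p \<omega>) / g (T p \<omega>))) \<partial>\<nu>)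
      + ennreal ?\<Lambda> * ennreal (\<kappa> g_min g_max / real (\<Sum>i=1..n. m i) * ((LINT t|L. (f t)\<^sup>2) / g_min))"
    using pos by (intro add_left_mono mult_left_mono reg_weight_energy \<kappa> f) auto
  also have "ennreal ?\<Lambda> * ennreal (\<kappa> g_min g_max / real (\<Sum>i=1..n. m i) * ((LINT t|L. (f t)\<^sup>2) / g_min))
      = ennreal (?\<Lambda> * (\<kappa> g_min g_max / real (\<Sum>i=1..n. m i) / g_min))"
    using Gamma_max_nonneg by (subst ennreal_mult'[symmetric]) (simp_all add: norm)
  finally show ?thesis .
qed

end

subsection \<open>The risk bound\<close>

text \<open>Source of the power \<open>1 + 2 * q\<close> of \<open>K\<close>: each summand is
  bounded by the last one.\<close>

lemma sum_powr_le:
  assumes "0 \<le> r"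
  shows "(\<Sum>k=1..K. real k powr r) \<le> real K powr (1 + r)"
proof (cases "K = 0")
  case False
  have "(\<Sum>k=1..K. real k powr r) \<le> (\<Sum>k=1..K. real K powr r)"
    using assms by (intro sum_mono powr_mono2) auto
  also have "\<dots> = real K powr (1 + r)" using False by (simp add: powr_add)
  finally show ?thesis .
qed simp

text \<open>Turns the growth condition at each \<open>u\<close> into an integrated one;
  \<open>c\<close> and \<open>d\<close> play the roles of \<open>C1\<close> and of \<open>C2\<close>
  at a fixed \<open>k\<close>, while \<open>x\<close> and \<open>y\<close> are the two powers of
  \<open>M\<close>.\<close>

lemma nn_integral_variance_bound:
  assumes v: "\<And>u. v u \<le> (c u)\<^sup>2 * x + (d u)\<^sup>2 * y" and "0 \<le> x" "0 \<le> y" "0 \<le> C" "0 \<le> D"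
    and c: "c \<in> borel_measurable \<nu>" "sq_norm_L2 \<nu> c \<le> ennreal C"
    and d: "d \<in> borel_measurable \<nu>" "sq_norm_L2 \<nu> d \<le> ennreal D"
  shows "(\<integral>\<^sup>+u. ennreal (v u) \<partial>\<nu>) \<le> ennreal (C * x + D * y)"
proof -
  have "(\<integral>\<^sup>+u. ennreal (v u) \<partial>\<nu>) \<le> (\<integral>\<^sup>+u. ennreal ((c u)\<^sup>2) * ennreal x + ennreal ((d u)\<^sup>2) * ennreal y \<partial>\<nu>)"
    using v assms(2,3) by (intro nn_integral_mono) (simp add: ennreal_leI flip: ennreal_mult ennreal_plus)
  also have "\<dots> = sq_norm_L2 \<nu> c * ennreal x + sq_norm_L2 \<nu> d * ennreal y"
    using c d by (simp add: sq_norm_L2_def nn_integral_add nn_integral_multc)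
  also have "\<dots> \<le> ennreal C * ennreal x + ennreal D * ennreal y"
    using c d by (intro add_mono mult_right_mono) auto
  also have "\<dots> = ennreal (C * x + D * y)"
    using assms(2-5) by (simp add: ennreal_mult)
  finally show ?thesis .
qed

text \<open>Applied to \<open>\<mu> u\<close>, whose continuity gives boundedness and square
  integrability in \<open>t\<close> at every \<open>u\<close>, without exceptional sets.\<close>

lemma continuous_on_powr_modulus:
  fixes f :: "real \<Rightarrow> real"
  assumes "0 < \<alpha>" and f: "\<And>t t'. t \<in> S \<Longrightarrow> t' \<in> S \<Longrightarrow> \<bar>f t - f t'\<bar> \<le> C * \<bar>t - t'\<bar> powr \<alpha>"
  shows "continuous_on S f"
  unfolding continuous_on_def
proof
  fix t assume t: "t \<in> S"
  have "((\<lambda>y. C * \<bar>y - t\<bar> powr \<alpha>) \<longlongrightarrow> C * \<bar>t - t\<bar> powr \<alpha>) (at t within S)"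
    using assms(1) by (intro tendsto_intros) auto
  then have lim: "((\<lambda>y. C * \<bar>y - t\<bar> powr \<alpha>) \<longlongrightarrow> 0) (at t within S)" by simp
  have "((\<lambda>y. f y - f t) \<longlongrightarrow> 0) (at t within S)"
    using f t by (intro Lim_null_comparison[OF _ lim]) (auto simp: eventually_at_filter)
  then show "(f \<longlongrightarrow> f t) (at t within S)" by (rule LIM_zero_cancel)
qed

theorem theorem2:
  fixes a b :: real
    and \<nu> :: "'u::{metric_space, second_countable_topology} measure"
    and P :: "'w measure"
    and n M m_max :: nat and m :: "nat \<Rightarrow> nat"
    and I :: "(nat \<times> nat) set"
    and T :: "nat \<times> nat \<Rightarrow> 'w \<Rightarrow> real" and g :: "real \<Rightarrow> real"
    and \<X> :: "('u \<Rightarrow> real \<Rightarrow> real) measure"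
    and X :: "'w \<Rightarrow> 'u \<Rightarrow> real \<Rightarrow> real" and Xs :: "nat \<Rightarrow> 'w \<Rightarrow> 'u \<Rightarrow> real \<Rightarrow> real"
    and \<E> :: "('u \<Rightarrow> real) measure" and \<eta> :: "nat \<times> nat \<Rightarrow> 'w \<Rightarrow> 'u \<Rightarrow> real"
    and \<tau> :: "real \<Rightarrow> real"
    and \<mu> :: "'u \<Rightarrow> real \<Rightarrow> real" and \<phi> :: "nat \<Rightarrow> real \<Rightarrow> real"
    and L\<^sub>\<mu> :: "'u \<Rightarrow> real" and \<alpha> s C\<^sub>s q Cbar :: real
    and C1 :: "'u \<Rightarrow> real" and C2 :: "'u \<Rightarrow> nat \<Rightarrow> real"
  defines "I \<equiv> visits n m" and "M \<equiv> (\<Sum>i=1..n. m i)"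
  assumes interval: "a < b"
    and nu: "finite_measure \<nu>" "sets \<nu> = sets borel"
    and prob: "prob_space P"
    and visits: "\<forall>i\<in>{1..n}. 1 \<le> m i \<and> m i \<le> m_max"
    and mu_L2: "in_L2 (\<nu> \<Otimes>\<^sub>M leb_on a b) (\<lambda>(u, t). \<mu> u t)"
    \<comment> \<open>(i)\<close>
    and X_space: "surface_space a b \<nu> \<X>"
    and X_meas: "X \<in> measurable P \<X>"
    and X_copies: "\<forall>i\<in>{1..n}. Xs i \<in> measurable P \<X> \<and> distr P \<X> (Xs i) = distr P \<X> X"
    and X_indep: "prob_space.indep_vars P (\<lambda>_. \<X>) Xs {1..n}"
    and X_moment: "(\<integral>\<^sup>+\<omega>. sq_norm_L2 (\<nu> \<Otimes>\<^sub>M leb_on a b) (\<lambda>(u, t). X \<omega> u t) \<partial>P) < \<infinity>"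
    and X_centred: "\<forall>u. \<forall>t\<in>{a..b}. integrable P (\<lambda>\<omega>. X \<omega> u t) \<and> (LINT \<omega>|P. X \<omega> u t) = 0"
    \<comment> \<open>(ii)\<close>
    and g_density: "design_density a b g"
    and T_law: "\<forall>p\<in>I. distributed P (leb_on a b) (T p) (\<lambda>t. ennreal (g t))"
    and T_indep: "prob_space.indep_vars P (\<lambda>_. leb_on a b) T I"
    \<comment> \<open>(iii)\<close>
    and tau: "\<tau> \<in> borel_measurable (leb_on a b)" "\<forall>t\<in>{a..b}. 0 \<le> \<tau> t" "bdd_above (\<tau> ` {a..b})"
    and eta_space: "curve_space \<nu> \<E>"
    and eta_meas: "\<forall>p\<in>I. \<eta> p \<in> measurable P \<E>"
    and eta_law: "\<forall>p\<in>I. \<forall>p'\<in>I. distr P \<E> (\<eta> p) = distr P \<E> (\<eta> p')"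
    and eta_indep: "prob_space.indep_vars P (\<lambda>_. \<E>) \<eta> I"
    and eta_centred: "\<forall>p\<in>I. \<forall>u. integrable P (\<lambda>\<omega>. \<eta> p \<omega> u) \<and> (LINT \<omega>|P. \<eta> p \<omega> u) = 0"
    and eta_var: "\<forall>p\<in>I. \<forall>u. integrable P (\<lambda>\<omega>. (\<eta> p \<omega> u)\<^sup>2) \<and>
                    prob_space.variance P (\<lambda>\<omega>. \<eta> p \<omega> u) = 1"
    \<comment> \<open>(iv)\<close>
    and mutual_indep: "prob_space.indep_sets P
        ((!) [sets (family_algebra P (leb_on a b) T I),
              sets (family_algebra P \<X> Xs {1..n}),
              sets (family_algebra P \<E> \<eta> I)]) {..<3}"
    and basis: "orthonormal_basis_L2 (leb_on a b) \<phi>"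
    and admissible: "admissible_weights P a b g I T (mc_weights a b g I T)"
    and phi_lipschitz: "\<forall>k\<ge>1. \<exists>L. L-lipschitz_on {a..b} (\<phi> k)"
    and alpha: "0 < \<alpha>" "\<alpha> \<le> 1"
    and L_mu: "in_L2 \<nu> L\<^sub>\<mu>" "\<forall>u. 0 \<le> L\<^sub>\<mu> u"
    and holder: "\<forall>u. \<forall>t\<in>{a..b}. \<forall>t'\<in>{a..b}. \<bar>\<mu> u t - \<mu> u t'\<bar> \<le> L\<^sub>\<mu> u * \<bar>t - t'\<bar> powr \<alpha>"
    and s: "0 < s" and C_s: "0 < C\<^sub>s"
    and smooth: "(\<Sum>k. ennreal (real (Suc k) powr (2 * s)) * sq_norm_L2 \<nu> (coef a b \<mu> \<phi> (Suc k)))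
                   \<le> ennreal C\<^sub>s"
    and q: "0 \<le> q" and Cbar: "0 < Cbar"
    and growth_meas: "C1 \<in> borel_measurable \<nu>" "\<forall>k\<ge>1. (\<lambda>u. C2 u k) \<in> borel_measurable \<nu>"
    and growth_var: "\<forall>u. \<forall>k\<ge>1. prob_space.variance P (mc_signal_coef a b g I T \<mu> \<phi> k u)
                       \<le> (C1 u)\<^sup>2 * real M powr (- 1 - 2 * \<alpha>) + (C2 u k)\<^sup>2 * real M powr (- 3)"
    and growth_C1: "sq_norm_L2 \<nu> C1 \<le> ennreal Cbar"
    and growth_C2: "\<forall>k\<ge>1. sq_norm_L2 \<nu> (\<lambda>u. C2 u k) \<le> ennreal (Cbar * real k powr (2 * q))"
    and Gamma: "continuous_on ({a..b} \<times> {a..b}) (\<lambda>(t, t'). cov_trace P \<nu> X t t')"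
    and M: "4 \<le> M"
  shows "(\<exists>\<kappa>. mc_moment_constant \<kappa>) \<and>
    (\<forall>\<kappa>. mc_moment_constant \<kappa> \<longrightarrow> (\<forall>K\<ge>1.
       risk P \<nu> a b (mean_hat I (mc_weights a b g I T) g \<phi> T (obs \<mu> Xs \<tau> \<eta> T) K) \<mu>
       \<le> ennreal
          (C\<^sub>s * real K powr (- 2 * s)
           + \<kappa> (INF t\<in>{a..b}. g t) (SUP t\<in>{a..b}. g t)
               * ((SUP (t, t')\<in>{a..b} \<times> {a..b}. \<bar>cov_trace P \<nu> X t t'\<bar>) * real m_max
                  + (SUP t\<in>{a..b}. \<bar>\<tau> t\<bar>)\<^sup>2 * measure \<nu> UNIV)
               / (INF t\<in>{a..b}. g t) * (real K / real M)
           + Cbar * (real K / real M powr (1 + 2 * \<alpha>) + real K powr (1 + 2 * q) / real M ^ 3))))"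
proof -
  interpret sampling_model a b g \<nu> P n m_max m T \<X> X Xs \<E> \<eta> \<tau> \<mu>
  proof (intro sampling_model.intro design.intro sampling_model_axioms.intro)
    show "space \<nu> = UNIV" using sets_eq_imp_space_eq[OF nu(2)] by simp
    show "4 \<le> (\<Sum>i=1..n. m i)" using M by (simp only: M_def)
    show "(\<lambda>(u, t). \<mu> u t) \<in> borel_measurable (\<nu> \<Otimes>\<^sub>M leb_on a b)" using mu_L2 by (simp add: in_L2_def)
  qed (fact assms(3-)[unfolded I_def])+
  have I_eq: "I = visits n m" by (simp add: I_def)
  have M_eq: "real (\<Sum>i=1..n. m i) = real M" by (simp add: M_def)
  interpret finL: finite_measure L by (rule finite_measure_leb_on)
  note adm = admissible[unfolded I_eq]
  let ?\<Lambda> = "Gamma_max * real m_max + tau_max\<^sup>2 * measure \<nu> UNIV"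
  have \<phi>_cont: "continuous_on {a..b} (\<phi> k)" if "1 \<le> k" for k
    using phi_lipschitz that lipschitz_on_continuous_on by blast
  have \<mu>_cont: "continuous_on {a..b} (\<mu> u)" for u
    using holder alpha(1) by (intro continuous_on_powr_modulus[of \<alpha> _ _ "L\<^sub>\<mu> u"]) auto
  have \<mu>_L2: "in_L2 L (\<mu> u)" for u
  proof -
    have "integrable L (\<lambda>t. (\<mu> u t)\<^sup>2)" by (intro integrable_leb_on_continuous continuous_intros \<mu>_cont)
    then have "sq_norm_L2 L (\<mu> u) < \<infinity>"
      unfolding sq_norm_L2_def by (subst nn_integral_eq_integral) auto
    then show ?thesis
      using borel_measurable_leb_on_continuous[OF \<mu>_cont] by (simp add: in_L2_def)
  qed
  have \<beta>_meas: "coef a b \<mu> \<phi> k \<in> borel_measurable \<nu>" if "1 \<le> k" for k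
    unfolding coef_def[abs_def]
    using mu_meas measurable_compose[OF measurable_snd borel_measurable_leb_on_continuous[OF \<phi>_cont[OF that]]]
    by (intro finL.borel_measurable_lebesgue_integral) (auto simp: split_beta' intro!: borel_measurable_times)
  define err where "err k \<omega> u = coef_error (\<phi> k) (coef a b \<mu> \<phi> k) u (design_points \<omega>) (noise_sources \<omega>)" for k \<omega> u
  have est: "coef_hat I (mc_weights a b g I T) g \<phi> T (obs \<mu> Xs \<tau> \<eta> T) k \<omega> u - coef a b \<mu> \<phi> k u = err k \<omega> u" for k \<omega> u
    unfolding err_def coef_hat_def I_eq by (rule coef_error_eq)
  have est_meas: "coef_hat I (mc_weights a b g I T) g \<phi> T (obs \<mu> Xs \<tau> \<eta> T) k \<omega> \<in> borel_measurable \<nu>"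
    if "1 \<le> k" "\<omega> \<in> space P" for k \<omega>
  proof -
    have "(design_points \<omega>, noise_sources \<omega>) \<in> space (point_space \<Otimes>\<^sub>M noise_space)"
      using measurable_space[OF design_points_measurable that(2)] measurable_space[OF noise_sources_measurable_P that(2)]
      by (simp add: space_pair_measure)
    from measurable_Pair1[OF coef_error_measurable[OF \<phi>_cont[OF that(1)] \<beta>_meas[OF that(1)]] this]
    have "(\<lambda>u. err k \<omega> u + coef a b \<mu> \<phi> k u) \<in> borel_measurable \<nu>"
      using \<beta>_meas[OF that(1)] unfolding err_def by (intro borel_measurable_add) simp_all
    then show ?thesis by (simp flip: est)
  qed
  have main: "risk P \<nu> a b (mean_hat I (mc_weights a b g I T) g \<phi> T (obs \<mu> Xs \<tau> \<eta> T) K) \<mu>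
       \<le> ennreal
          (C\<^sub>s * real K powr (- 2 * s)
           + \<kappa> g_min g_max * ?\<Lambda> / g_min * (real K / real M)
           + Cbar * (real K / real M powr (1 + 2 * \<alpha>) + real K powr (1 + 2 * q) / real M ^ 3))"
    if \<kappa>: "mc_moment_constant \<kappa>" and K: "1 \<le> K" for \<kappa> and K :: nat
  proof -
    \<comment> \<open>\<open>V\<close> bounds the contribution of subjects and measurement errors to
      one coefficient, \<open>D k\<close> the integrated variance of the signal coefficient.\<close>
    define V where "V = ?\<Lambda> * (\<kappa> g_min g_max / real M / g_min)"
    define D where "D k = Cbar * real M powr (- 1 - 2 * \<alpha>) + Cbar * real k powr (2 * q) * real M powr (- 3)" for k :: nat
    let ?tail = "\<Sum>k. sq_norm_L2 \<nu> (coef a b \<mu> \<phi> (Suc (k + K)))"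
    have M0: "0 < real M" using M by simp
    \<comment> \<open>Positivity of \<kappa> is used here: a negative \<open>V\<close> would be
      truncated to 0 inside \<open>ennreal\<close>, and the bounds on single coefficients could not
      be added up as real numbers.\<close>
    have V0: "0 \<le> V"
      unfolding V_def using Gamma_max_nonneg moment_constant_pos[OF \<kappa> adm] g_min_pos by simp
    have D0: "0 \<le> D k" for k unfolding D_def using Cbar by simp
    have term_bound: "(\<integral>\<^sup>+\<omega>. sq_norm_L2 \<nu> (err k \<omega>) \<partial>P) \<le> ennreal (D k + V)" if k: "1 \<le> k" for k
    proof -
      have norm: "(LINT t|L. (\<phi> k t)\<^sup>2) = 1"
        using basis k by (simp add: orthonormal_basis_L2_def power2_eq_square)
      have "(\<integral>\<^sup>+\<omega>. sq_norm_L2 \<nu> (err k \<omega>) \<partial>P)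
          \<le> (\<integral>\<^sup>+u. ennreal (P.variance (mc_signal_coef a b g I T \<mu> \<phi> k u)) \<partial>\<nu>) + ennreal V"
        using coefficient_risk[OF \<kappa> adm \<phi>_cont[OF k] norm \<mu>_cont]
        unfolding err_def coef_def[abs_def] mc_signal_coef_def[abs_def] V_def I_eq M_eq
        by (simp only: mult.commute[of "real m_max"])
      also have "(\<integral>\<^sup>+u. ennreal (P.variance (mc_signal_coef a b g I T \<mu> \<phi> k u)) \<partial>\<nu>) \<le> ennreal (D k)"
        unfolding D_def using growth_var growth_C1 growth_C2 growth_meas Cbar k
        by (intro nn_integral_variance_bound[of _ C1 _ "\<lambda>u. C2 u k"]) auto
      finally show ?thesis
        using D0[of k] V0 by (simp add: ennreal_plus add_right_mono)
    qed
    have tail: "?tail \<le> ennreal (C\<^sub>s * real K powr (- 2 * s))"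
      using smooth s K C_s by (intro suminf_tail_le) auto
    \<comment> \<open>The tail is the same for every sample point, so it passes through the
      expectation unchanged.\<close>
    have "risk P \<nu> a b (mean_hat I (mc_weights a b g I T) g \<phi> T (obs \<mu> Xs \<tau> \<eta> T) K) \<mu>
        = (\<integral>\<^sup>+\<omega>. (\<Sum>k=1..K. sq_norm_L2 \<nu> (err k \<omega>)) + ?tail \<partial>P)"
      unfolding risk_def mean_hat_def
    proof (intro nn_integral_cong)
      fix \<omega> assume \<omega>: "\<omega> \<in> space P"
      show "sq_norm_L2 (\<nu> \<Otimes>\<^sub>M L) (\<lambda>(u, t). (\<Sum>k=1..K. coef_hat I (mc_weights a b g I T) g \<phi> T (obs \<mu> Xs \<tau> \<eta> T) k \<omega> u * \<phi> k t) - \<mu> u t)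
          = (\<Sum>k=1..K. sq_norm_L2 \<nu> (err k \<omega>)) + ?tail"
        using sq_norm_L2_surface_error[OF basis finL.sigma_finite_measure_axioms mu_meas \<mu>_L2,
            of K "\<lambda>k. coef_hat I (mc_weights a b g I T) g \<phi> T (obs \<mu> Xs \<tau> \<eta> T) k \<omega>"] est_meas[OF _ \<omega>]
        unfolding coef_def[symmetric] est by (simp add: coef_def[abs_def])
    qed
    also have "\<dots> = (\<Sum>k=1..K. \<integral>\<^sup>+\<omega>. sq_norm_L2 \<nu> (err k \<omega>) \<partial>P) + ?tail"
    proof -
      have m: "(\<lambda>\<omega>. sq_norm_L2 \<nu> (err k \<omega>)) \<in> borel_measurable P" if "k \<in> {1..K}" for k
        unfolding err_def using that by (intro coef_error_second_moment(2) \<phi>_cont \<beta>_meas) auto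
      have "(\<integral>\<^sup>+\<omega>. (\<Sum>k=1..K. sq_norm_L2 \<nu> (err k \<omega>)) + ?tail \<partial>P)
          = (\<integral>\<^sup>+\<omega>. (\<Sum>k=1..K. sq_norm_L2 \<nu> (err k \<omega>)) \<partial>P) + (\<integral>\<^sup>+\<omega>. ?tail \<partial>P)"
        using m by (intro nn_integral_add borel_measurable_sum) auto
      also have "(\<integral>\<^sup>+\<omega>. (\<Sum>k=1..K. sq_norm_L2 \<nu> (err k \<omega>)) \<partial>P) = (\<Sum>k=1..K. \<integral>\<^sup>+\<omega>. sq_norm_L2 \<nu> (err k \<omega>) \<partial>P)"
        by (rule nn_integral_sum[OF m])
      finally show ?thesis by (simp add: P.emeasure_space_1)
    qed
    also have "\<dots> \<le> (\<Sum>k=1..K. ennreal (D k + V)) + ennreal (C\<^sub>s * real K powr (- 2 * s))"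
      using term_bound by (intro add_mono sum_mono tail) auto
    also have "\<dots> = ennreal ((\<Sum>k=1..K. D k + V) + C\<^sub>s * real K powr (- 2 * s))"
    proof -
      have "0 \<le> D k + V" for k using D0[of k] V0 by simp
      then have "(\<Sum>k=1..K. ennreal (D k + V)) = ennreal (\<Sum>k=1..K. D k + V)" "0 \<le> (\<Sum>k=1..K. D k + V)"
        by (auto intro: sum_ennreal sum_nonneg)
      then show ?thesis using C_s by (simp only: ennreal_plus mult_nonneg_nonneg less_imp_le powr_ge_zero)
    qed
    also have "\<dots> \<le> ennreal
          (C\<^sub>s * real K powr (- 2 * s)
           + \<kappa> g_min g_max * ?\<Lambda> / g_min * (real K / real M)
           + Cbar * (real K / real M powr (1 + 2 * \<alpha>) + real K powr (1 + 2 * q) / real M ^ 3))"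
    proof (intro ennreal_leI)
      have V_eq: "real K * V = \<kappa> g_min g_max * ?\<Lambda> / g_min * (real K / real M)"
        by (simp add: V_def mult_ac)
      have "(\<Sum>k=1..K. D k + V) = real K * (Cbar * real M powr (- 1 - 2 * \<alpha>))
          + Cbar * real M powr (- 3) * (\<Sum>k=1..K. real k powr (2 * q)) + real K * V"
        by (simp add: D_def sum.distrib sum_distrib_left mult_ac)
      also have "\<dots> \<le> real K * (Cbar * real M powr (- 1 - 2 * \<alpha>))
          + Cbar * real M powr (- 3) * real K powr (1 + 2 * q) + real K * V"
        using Cbar q by (intro add_mono mult_left_mono sum_powr_le order_refl) auto
      also have "real M powr (- 1 - 2 * \<alpha>) = 1 / real M powr (1 + 2 * \<alpha>)"
        using M0 by (simp add: powr_minus_divide[symmetric])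
      also have "real M powr (- 3) = 1 / real M ^ 3"
        using M0 by (simp add: powr_minus_divide powr_numeral)
      finally show "(\<Sum>k=1..K. D k + V) + C\<^sub>s * real K powr (- 2 * s)
          \<le> C\<^sub>s * real K powr (- 2 * s)
           + \<kappa> g_min g_max * ?\<Lambda> / g_min * (real K / real M)
           + Cbar * (real K / real M powr (1 + 2 * \<alpha>) + real K powr (1 + 2 * q) / real M ^ 3)"
        unfolding V_eq[symmetric] by (simp add: distrib_left mult.commute)
    qed
    finally show ?thesis .
  qed
  show ?thesis
    using mc_moment_constant_exists main by blast
qed

end
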